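(* Let $(M,L)$ be a pseudo-Finsler manifold, $V$ an $L$-admissible vector field on an open subset $\Omega\subset M$, and let $X,Y,Z$ be arbitrary smooth vector fields on $\Omega$. Then $$R^V(X,Y)Z=R_V(X,Y)Z+P_V(Y,Z,\nabla^V_XV)-P_V(X,Z,\nabla^V_YV).$$
   Context: Pseudo-Finsler manifold: $M$ is a smooth manifold, $\pi:TM\to M$ the tangent bundle, $A\subset TM\setminus 0$ an open conic subset ($v\in A,\lambda>0\Rightarrow \lambda v\in A$), and $L:A\to\mathbb{R}$ is smooth with $L(\lambda v)=\lambda^2L(v)$ for $\lambda>0$ and such that for every $v\in A$ the fundamental tensor $g_v(u,w)=\frac12\frac{\partial^2}{\partial t\,\partial s}L(v+tu+sw)|_{t=s=0}$ ($u,w\in T_{\pi(v)}M$) is nondegenerate. The Cartan tensor is $C_v(w_1,w_2,w_3)=\frac14\frac{\partial^3}{\partial s_1\partial s_2\partial s_3}L(v+s_1w_1+s_2w_2+s_3w_3)|_{s_1=s_2=s_3=0}$. Chern connection: a smooth vector field $V$ on an open set $\Omega\subset M$ is $L$-admissible if $V(p)\in A$ for all $p\in\Omega$. For such $V$, $\nabla^V$ is the unique torsion-free affine connection on $\Omega$ with $X(g_V(Y,Z))=g_V(\nabla^V_XY,Z)+g_V(Y,\nabla^V_XZ)+2C_V(\nabla^V_XV,Y,Z)$ for all smooth vector fields $X,Y,Z$ on $\Omega$. In a chart $(\Omega,(u^i))$ of $M$ with induced chart $(x^i,y^i)$ on $TM$ ($x^i=u^i\circ\pi$, $y^i(v)=v(u^i)$),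 the Christoffel symbols are the functions $\Gamma^i_{\,jk}:A\cap\pi^{-1}(\Omega)\to\mathbb{R}$, symmetric in $j,k$, with $\nabla^V_{\partial/\partial u^j}\frac{\partial}{\partial u^k}=\Gamma^i_{\,jk}(V)\frac{\partial}{\partial u^i}$ for every $L$-admissible $V$. Put $N^i_{\,j}=y^k\Gamma^i_{\,kj}$ and $\frac{\delta}{\delta x^k}=\frac{\partial}{\partial x^k}-N^i_{\,k}\frac{\partial}{\partial y^i}$. Curvature tensor of the affine connection $\nabla^V$: $R^V(X,Y)Z=\nabla^V_X\nabla^V_YZ-\nabla^V_Y\nabla^V_XZ-\nabla^V_{[X,Y]}Z$. Chern tensor: for $v\in A$ and $X,Y,Z\in T_{\pi(v)}M$, $P_v(X,Y,Z)=X^jY^kZ^l\frac{\partial\Gamma^i_{\,jk}}{\partial y^l}(v)\frac{\partial}{\partial u^i}$; equivalently, for vector fields on $\Omega$ and $L$-admissible $V$, $P_V(X,Y,Z)=\frac{\partial}{\partial t}(\nabla^{V+tZ}_XY)|_{t=0}$. Chern curvature: for $v\in A$ and $X,Y,Z\in T_{\pi(v)}M$, $R_v(X,Y)Z=X^kY^lZ^jR_{j\ kl}^{\ i}(v)\frac{\partial}{\partial u^i}$ with $R_{j\ kl}^{\ i}=\frac{\delta\Gamma^i_{\,jl}}{\delta x^k}-\frac{\delta\Gamma^i_{\,jk}}{\delta x^l}+\Gamma^i_{\,hk}\Gamma^h_{\,jl}-\Gamma^i_{\,hl}\Gamma^h_{\,jk}$. $R_V$ and $P_V$ are evaluated pointwise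 at $v=V(p)$. *)

theory Defs
  imports "HOL-Analysis.Analysis" "HOL-Library.Function_Algebras"
begin

section \<open>Smooth functions on open subsets of a normed space\<close>

text \<open>Meaningful for open \<open>S\<close> only. On a finite-dimensional domain, \<open>f\<close> is of class
  \<open>C\<close>-\<open>(k+1)\<close> iff it is differentiable and all its directional derivatives are of class
  \<open>C\<close>-\<open>k\<close>.\<close>

primrec Ck_on :: "nat \<Rightarrow> 'e::euclidean_space set \<Rightarrow> ('e \<Rightarrow> 'b::real_normed_vector) \<Rightarrow> bool" where
  "Ck_on 0 S f \<longleftrightarrow> continuous_on S f"
| "Ck_on (Suc k) S f \<longleftrightarrow> (\<forall>x\<in>S. f differentiable (at x)) \<and>
     (\<forall>v. Ck_on k S (\<lambda>x. frechet_derivative f (at x) v))"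

definition smooth_on :: "'e::euclidean_space set \<Rightarrow> ('e \<Rightarrow> 'b::real_normed_vector) \<Rightarrow> bool" where
  "smooth_on S f \<longleftrightarrow> (\<forall>k. Ck_on k S f)"

section \<open>Smooth manifolds\<close>

text \<open>A chart is a domain together with a coordinate map, whose values outside the domain are
  irrelevant. The underlying set of a manifold is a whole type, which is Hausdorff and second
  countable by its type classes; the manifold itself is given by its maximal smooth atlas \<open>M\<close>.\<close>

type_synonym ('m, 'n) chart = "'m set \<times> ('m \<Rightarrow> real ^ 'n)"

abbreviation cdom :: "('m, 'n::finite) chart \<Rightarrow> 'm set" where "cdom \<equiv> fst"
abbreviation cmap :: "('m, 'n::finite) chart \<Rightarrow> 'm \<Rightarrow> real ^ 'n" where "cmap \<equiv> snd"
abbreviation cimg :: "('m, 'n::finite) chart \<Rightarrow> (real ^ 'n) set" where "cimg c \<equiv> cmap c ` cdom c"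

definition cinv :: "('m, 'n::finite) chart \<Rightarrow> real ^ 'n \<Rightarrow> 'm" where
  "cinv c = inv_into (cdom c) (cmap c)"

definition is_chart :: "('m::topological_space, 'n::finite) chart \<Rightarrow> bool" where
  "is_chart c \<longleftrightarrow> open (cdom c) \<and> open (cimg c) \<and>
     homeomorphism (cdom c) (cimg c) (cmap c) (cinv c)"

definition smooth_compat :: "('m, 'n::finite) chart \<Rightarrow> ('m, 'n) chart \<Rightarrow> bool" where
  "smooth_compat c d \<longleftrightarrow>
     smooth_on (cmap c ` (cdom c \<inter> cdom d)) (cmap d \<circ> cinv c) \<and>
     smooth_on (cmap d ` (cdom c \<inter> cdom d)) (cmap c \<circ> cinv d)"

definition smooth_manifold ::
    "('m::{t2_space,second_countable_topology}, 'n::finite) chart set \<Rightarrow> bool" where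
  "smooth_manifold M \<longleftrightarrow>
     (\<forall>c\<in>M. is_chart c) \<and>
     (\<Union>c\<in>M. cdom c) = UNIV \<and>
     (\<forall>c\<in>M. \<forall>d\<in>M. smooth_compat c d) \<and>
     (\<forall>c. is_chart c \<and> (\<forall>d\<in>M. smooth_compat c d) \<longrightarrow> c \<in> M)"

definition smooth_fun :: "('m, 'n::finite) chart set \<Rightarrow> 'm set \<Rightarrow> ('m \<Rightarrow> real) \<Rightarrow> bool" where
  "smooth_fun M W f \<longleftrightarrow> (\<forall>c\<in>M. smooth_on (cmap c ` (cdom c \<inter> W)) (f \<circ> cinv c))"

definition smooth_at ::
    "('m::topological_space, 'n::finite) chart set \<Rightarrow> 'm \<Rightarrow> ('m \<Rightarrow> real) set" where
  "smooth_at M p = {f. \<exists>W. open W \<and> p \<in> W \<and> smooth_fun M W f}"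

section \<open>Tangent vectors and vector fields\<close>

text \<open>Tangent vectors at \<open>p\<close> are the derivations of the smooth functions defined near \<open>p\<close>,
  taken to be zero on functions that are not smooth near \<open>p\<close>. Independence of the values away
  from \<open>p\<close> need not be required: if \<open>h\<close> vanishes near \<open>p\<close>, then \<open>h = \<chi> * h\<close> for the indicator
  function \<open>\<chi>\<close> of the complement of a neighbourhood of \<open>p\<close>, whence \<open>v h = 0\<close> by the Leibniz
  rule. Sums and differences of tangent vectors are those of functions.\<close>

type_synonym 'm tvec = "('m \<Rightarrow> real) \<Rightarrow> real"
type_synonym 'm vfield = "'m \<Rightarrow> 'm tvec"

definition tscale :: "real \<Rightarrow> 'm tvec \<Rightarrow> 'm tvec"  (infixr \<open>*\<^sub>t\<close> 75) where
  "a *\<^sub>t v = (\<lambda>f. a * v f)"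

definition vfscale :: "('m \<Rightarrow> real) \<Rightarrow> 'm vfield \<Rightarrow> 'm vfield"  (infixr \<open>*\<^sub>f\<close> 75) where
  "h *\<^sub>f X = (\<lambda>p. h p *\<^sub>t X p)"

definition tangent_space ::
    "('m::topological_space, 'n::finite) chart set \<Rightarrow> 'm \<Rightarrow> 'm tvec set" where
  "tangent_space M p = {v.
     (\<forall>f\<in>smooth_at M p. \<forall>g\<in>smooth_at M p. v (f + g) = v f + v g) \<and>
     (\<forall>a. \<forall>f\<in>smooth_at M p. v (\<lambda>q. a * f q) = a * v f) \<and>
     (\<forall>f\<in>smooth_at M p. \<forall>g\<in>smooth_at M p. v (f * g) = v f * g p + f p * v g) \<and>
     (\<forall>f. f \<notin> smooth_at M p \<longrightarrow> v f = 0)}"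

definition tangent_bundle ::
    "('m::topological_space, 'n::finite) chart set \<Rightarrow> ('m \<times> 'm tvec) set" where
  "tangent_bundle M = (SIGMA p:UNIV. tangent_space M p)"

definition coord_field ::
    "('m::topological_space, 'n::finite) chart set \<Rightarrow> ('m, 'n) chart \<Rightarrow> 'n \<Rightarrow> 'm vfield" where
  "coord_field M c i = (\<lambda>p f. if f \<in> smooth_at M p
     then deriv (\<lambda>t. f (cinv c (cmap c p + t *\<^sub>R axis i 1))) 0 else 0)"

definition comp :: "('m, 'n::finite) chart \<Rightarrow> 'm tvec \<Rightarrow> 'n \<Rightarrow> real" where
  "comp c v i = v (\<lambda>q. cmap c q $ i)"

definition vector_fields ::
    "('m::topological_space, 'n::finite) chart set \<Rightarrow> 'm set \<Rightarrow> 'm vfield set" where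
  "vector_fields M \<Omega> = {X. (\<forall>p\<in>\<Omega>. X p \<in> tangent_space M p) \<and>
     (\<forall>c\<in>M. \<forall>i. smooth_fun M (\<Omega> \<inter> cdom c) (\<lambda>p. comp c (X p) i))}"

definition lie_bracket ::
    "('m::topological_space, 'n::finite) chart set \<Rightarrow> 'm vfield \<Rightarrow> 'm vfield \<Rightarrow> 'm vfield" where
  "lie_bracket M X Y = (\<lambda>p f. if f \<in> smooth_at M p
     then X p (\<lambda>q. Y q f) - Y p (\<lambda>q. X q f) else 0)"

text \<open>Inverse \<open>(x, y) \<mapsto> y\<^sup>i \<partial>/\<partial>u\<^sup>i\<close> of the chart of the tangent bundle induced by \<open>c\<close>; it is
  used to express openness, smoothness and partial derivatives on the tangent bundle.\<close>

definition tparam :: "('m::topological_space, 'n::finite) chart set \<Rightarrow> ('m, 'n) chart \<Rightarrow>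
    (real ^ 'n) \<times> (real ^ 'n) \<Rightarrow> 'm \<times> 'm tvec" where
  "tparam M c = (\<lambda>(x, y). (cinv c x, \<Sum>i\<in>UNIV. (y $ i) *\<^sub>t coord_field M c i (cinv c x)))"

definition tcoord :: "('m, 'n::finite) chart \<Rightarrow> 'm \<times> 'm tvec \<Rightarrow> (real ^ 'n) \<times> (real ^ 'n)" where
  "tcoord c = (\<lambda>(p, v). (cmap c p, \<chi> i. comp c v i))"

definition tdom :: "('m::topological_space, 'n::finite) chart set \<Rightarrow> ('m, 'n) chart \<Rightarrow>
    ('m \<times> 'm tvec) set \<Rightarrow> ((real ^ 'n) \<times> (real ^ 'n)) set" where
  "tdom M c A = {z. fst z \<in> cimg c \<and> tparam M c z \<in> A}"

section \<open>Pseudo-Finsler manifolds\<close>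

text \<open>In \<open>fund_tensor\<close> and \<open>cartan_tensor\<close>, elements of the tangent bundle are pairs of a base
  point and a tangent vector, and \<open>L\<close> only matters on \<open>A\<close>.\<close>

definition fund_tensor ::
    "('m \<times> 'm tvec \<Rightarrow> real) \<Rightarrow> 'm \<times> 'm tvec \<Rightarrow> 'm tvec \<Rightarrow> 'm tvec \<Rightarrow> real" where
  "fund_tensor L = (\<lambda>(p, v) u w.
     1 / 2 * deriv (\<lambda>t. deriv (\<lambda>s. L (p, v + t *\<^sub>t u + s *\<^sub>t w)) 0) 0)"

definition cartan_tensor ::
    "('m \<times> 'm tvec \<Rightarrow> real) \<Rightarrow> 'm \<times> 'm tvec \<Rightarrow> 'm tvec \<Rightarrow> 'm tvec \<Rightarrow> 'm tvec \<Rightarrow> real" where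
  "cartan_tensor L = (\<lambda>(p, v) w1 w2 w3. 1 / 4 *
     deriv (\<lambda>s1. deriv (\<lambda>s2. deriv (\<lambda>s3.
       L (p, v + s1 *\<^sub>t w1 + s2 *\<^sub>t w2 + s3 *\<^sub>t w3)) 0) 0) 0)"

definition pseudo_finsler ::
    "('m::{t2_space,second_countable_topology}, 'n::finite) chart set \<Rightarrow>
     ('m \<times> 'm tvec) set \<Rightarrow> ('m \<times> 'm tvec \<Rightarrow> real) \<Rightarrow> bool" where
  "pseudo_finsler M A L \<longleftrightarrow>
     smooth_manifold M \<and>
     A \<subseteq> tangent_bundle M - {(p, v). v = 0} \<and>
     (\<forall>c\<in>M. open (tdom M c A)) \<and>
     (\<forall>(p, v)\<in>A. \<forall>a>0. (p, a *\<^sub>t v) \<in> A) \<and>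
     (\<forall>c\<in>M. smooth_on (tdom M c A) (L \<circ> tparam M c)) \<and>
     (\<forall>(p, v)\<in>A. \<forall>a>0. L (p, a *\<^sub>t v) = a\<^sup>2 * L (p, v)) \<and>
     (\<forall>(p, v)\<in>A. \<forall>u\<in>tangent_space M p.
        (\<forall>w\<in>tangent_space M p. fund_tensor L (p, v) u w = 0) \<longrightarrow> u = 0)"

definition admissible :: "('m::topological_space, 'n::finite) chart set \<Rightarrow>
    ('m \<times> 'm tvec) set \<Rightarrow> 'm set \<Rightarrow> 'm vfield \<Rightarrow> bool" where
  "admissible M A \<Omega> V \<longleftrightarrow> V \<in> vector_fields M \<Omega> \<and> (\<forall>p\<in>\<Omega>. (p, V p) \<in> A)"

section \<open>The Chern connection\<close>

definition affine_connection :: "('m::topological_space, 'n::finite) chart set \<Rightarrow> 'm set \<Rightarrow>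
    ('m vfield \<Rightarrow> 'm vfield \<Rightarrow> 'm vfield) \<Rightarrow> bool" where
  "affine_connection M \<Omega> D \<longleftrightarrow>
     (\<forall>X\<in>vector_fields M \<Omega>. \<forall>Y\<in>vector_fields M \<Omega>. D X Y \<in> vector_fields M \<Omega>) \<and>
     (\<forall>X\<in>vector_fields M \<Omega>. \<forall>Y\<in>vector_fields M \<Omega>. \<forall>Z\<in>vector_fields M \<Omega>. \<forall>p\<in>\<Omega>.
        D (X + Y) Z p = D X Z p + D Y Z p \<and> D X (Y + Z) p = D X Y p + D X Z p) \<and>
     (\<forall>h. smooth_fun M \<Omega> h \<longrightarrow>
       (\<forall>X\<in>vector_fields M \<Omega>. \<forall>Y\<in>vector_fields M \<Omega>. \<forall>p\<in>\<Omega>.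
          D (h *\<^sub>f X) Y p = h p *\<^sub>t D X Y p \<and>
          D X (h *\<^sub>f Y) p = X p h *\<^sub>t Y p + h p *\<^sub>t D X Y p))"

definition torsion_free :: "('m::topological_space, 'n::finite) chart set \<Rightarrow> 'm set \<Rightarrow>
    ('m vfield \<Rightarrow> 'm vfield \<Rightarrow> 'm vfield) \<Rightarrow> bool" where
  "torsion_free M \<Omega> D \<longleftrightarrow>
     (\<forall>X\<in>vector_fields M \<Omega>. \<forall>Y\<in>vector_fields M \<Omega>. \<forall>p\<in>\<Omega>.
        D X Y p - D Y X p = lie_bracket M X Y p)"

definition almost_metric :: "('m::topological_space, 'n::finite) chart set \<Rightarrow>
    ('m \<times> 'm tvec \<Rightarrow> real) \<Rightarrow> 'm set \<Rightarrow> 'm vfield \<Rightarrow>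
    ('m vfield \<Rightarrow> 'm vfield \<Rightarrow> 'm vfield) \<Rightarrow> bool" where
  "almost_metric M L \<Omega> V D \<longleftrightarrow>
     (\<forall>X\<in>vector_fields M \<Omega>. \<forall>Y\<in>vector_fields M \<Omega>. \<forall>Z\<in>vector_fields M \<Omega>. \<forall>p\<in>\<Omega>.
        X p (\<lambda>q. fund_tensor L (q, V q) (Y q) (Z q)) =
          fund_tensor L (p, V p) (D X Y p) (Z p) + fund_tensor L (p, V p) (Y p) (D X Z p) +
          2 * cartan_tensor L (p, V p) (D X V p) (Y p) (Z p))"

text \<open>The three conditions determine \<open>D X Y p\<close> for smooth vector fields \<open>X\<close>, \<open>Y\<close> on \<open>\<Omega>\<close> and
  \<open>p \<in> \<Omega>\<close>; only irrelevant values are left open, so that \<open>SOME\<close> and not \<open>THE\<close> is called for.\<close>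

definition chern :: "('m::topological_space, 'n::finite) chart set \<Rightarrow>
    ('m \<times> 'm tvec \<Rightarrow> real) \<Rightarrow> 'm set \<Rightarrow> 'm vfield \<Rightarrow> 'm vfield \<Rightarrow> 'm vfield \<Rightarrow> 'm vfield" where
  "chern M L \<Omega> V = (SOME D.
     affine_connection M \<Omega> D \<and> torsion_free M \<Omega> D \<and> almost_metric M L \<Omega> V D)"

definition curvature :: "('m::topological_space, 'n::finite) chart set \<Rightarrow>
    ('m vfield \<Rightarrow> 'm vfield \<Rightarrow> 'm vfield) \<Rightarrow> 'm vfield \<Rightarrow> 'm vfield \<Rightarrow> 'm vfield \<Rightarrow> 'm vfield" where
  "curvature M D X Y Z = D X (D Y Z) - D Y (D X Z) - D (lie_bracket M X Y) Z"

section \<open>Christoffel symbols, Chern tensor and Chern curvature in a chart\<close>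

text \<open>\<open>christoffel M A L c i j k\<close> is \<open>\<Gamma>\<^sup>i\<^sub>j\<^sub>k\<close>. The admissible fields \<open>V\<close> are taken on open subsets
  \<open>W\<close> of the chart domain, because an element of \<open>A\<close> need not extend to an admissible field on
  the whole domain.\<close>

definition christoffel :: "('m::topological_space, 'n::finite) chart set \<Rightarrow>
    ('m \<times> 'm tvec) set \<Rightarrow> ('m \<times> 'm tvec \<Rightarrow> real) \<Rightarrow> ('m, 'n) chart \<Rightarrow>
    'n \<Rightarrow> 'n \<Rightarrow> 'n \<Rightarrow> 'm \<times> 'm tvec \<Rightarrow> real" where
  "christoffel M A L c i j k = (\<lambda>(p, v). THE r.
     \<forall>W V. open W \<and> p \<in> W \<and> W \<subseteq> cdom c \<and> admissible M A W V \<and> V p = v \<longrightarrow>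
       comp c (chern M L W V (coord_field M c j) (coord_field M c k) p) i = r)"

definition pd_x :: "('m::topological_space, 'n::finite) chart set \<Rightarrow> ('m, 'n) chart \<Rightarrow> 'n \<Rightarrow>
    ('m \<times> 'm tvec \<Rightarrow> real) \<Rightarrow> 'm \<times> 'm tvec \<Rightarrow> real" where
  "pd_x M c k F w = deriv (\<lambda>t. F (tparam M c (tcoord c w + t *\<^sub>R (axis k 1, 0)))) 0"

definition pd_y :: "('m::topological_space, 'n::finite) chart set \<Rightarrow> ('m, 'n) chart \<Rightarrow> 'n \<Rightarrow>
    ('m \<times> 'm tvec \<Rightarrow> real) \<Rightarrow> 'm \<times> 'm tvec \<Rightarrow> real" where
  "pd_y M c l F w = deriv (\<lambda>t. F (tparam M c (tcoord c w + t *\<^sub>R (0, axis l 1)))) 0"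

definition nonlin_conn :: "('m::topological_space, 'n::finite) chart set \<Rightarrow>
    ('m \<times> 'm tvec) set \<Rightarrow> ('m \<times> 'm tvec \<Rightarrow> real) \<Rightarrow> ('m, 'n) chart \<Rightarrow>
    'n \<Rightarrow> 'n \<Rightarrow> 'm \<times> 'm tvec \<Rightarrow> real" where
  "nonlin_conn M A L c i j w = (\<Sum>k\<in>UNIV. comp c (snd w) k * christoffel M A L c i k j w)"

definition delta :: "('m::topological_space, 'n::finite) chart set \<Rightarrow>
    ('m \<times> 'm tvec) set \<Rightarrow> ('m \<times> 'm tvec \<Rightarrow> real) \<Rightarrow> ('m, 'n) chart \<Rightarrow> 'n \<Rightarrow>
    ('m \<times> 'm tvec \<Rightarrow> real) \<Rightarrow> 'm \<times> 'm tvec \<Rightarrow> real" where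
  "delta M A L c k F w =
     pd_x M c k F w - (\<Sum>i\<in>UNIV. nonlin_conn M A L c i k w * pd_y M c i F w)"

text \<open>\<open>chern_curv_coeff M A L c i j k l\<close> is \<open>R\<close> with upper index \<open>i\<close> and lower indices
  \<open>j\<close>, \<open>k\<close>, \<open>l\<close>.\<close>

definition chern_curv_coeff :: "('m::topological_space, 'n::finite) chart set \<Rightarrow>
    ('m \<times> 'm tvec) set \<Rightarrow> ('m \<times> 'm tvec \<Rightarrow> real) \<Rightarrow> ('m, 'n) chart \<Rightarrow>
    'n \<Rightarrow> 'n \<Rightarrow> 'n \<Rightarrow> 'n \<Rightarrow> 'm \<times> 'm tvec \<Rightarrow> real" where
  "chern_curv_coeff M A L c i j k l w = (let \<Gamma> = christoffel M A L c in
     delta M A L c k (\<Gamma> i j l) w - delta M A L c l (\<Gamma> i j k) w +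
     (\<Sum>h\<in>UNIV. \<Gamma> i h k w * \<Gamma> h j l w - \<Gamma> i h l w * \<Gamma> h j k w))"

text \<open>The Chern curvature \<open>R\<^sub>w(X, Y)Z\<close> and the Chern tensor \<open>P\<^sub>w(X, Y, Z)\<close> as computed in the
  chart \<open>c\<close>.\<close>

definition chern_curvature :: "('m::topological_space, 'n::finite) chart set \<Rightarrow>
    ('m \<times> 'm tvec) set \<Rightarrow> ('m \<times> 'm tvec \<Rightarrow> real) \<Rightarrow> ('m, 'n) chart \<Rightarrow> 'm \<times> 'm tvec \<Rightarrow>
    'm tvec \<Rightarrow> 'm tvec \<Rightarrow> 'm tvec \<Rightarrow> 'm tvec" where
  "chern_curvature M A L c w X Y Z =
     (\<Sum>i\<in>UNIV. (\<Sum>j\<in>UNIV. \<Sum>k\<in>UNIV. \<Sum>l\<in>UNIV.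
        comp c X k * comp c Y l * comp c Z j * chern_curv_coeff M A L c i j k l w)
      *\<^sub>t coord_field M c i (fst w))"

definition chern_tensor :: "('m::topological_space, 'n::finite) chart set \<Rightarrow>
    ('m \<times> 'm tvec) set \<Rightarrow> ('m \<times> 'm tvec \<Rightarrow> real) \<Rightarrow> ('m, 'n) chart \<Rightarrow> 'm \<times> 'm tvec \<Rightarrow>
    'm tvec \<Rightarrow> 'm tvec \<Rightarrow> 'm tvec \<Rightarrow> 'm tvec" where
  "chern_tensor M A L c w X Y Z =
     (\<Sum>i\<in>UNIV. (\<Sum>j\<in>UNIV. \<Sum>k\<in>UNIV. \<Sum>l\<in>UNIV.
        comp c X j * comp c Y k * comp c Z l * pd_y M c l (christoffel M A L c i j k) w)
      *\<^sub>t coord_field M c i (fst w))"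

end

theory Submission
  imports Defs
begin

text \<open>In a chart, almost-metricity and torsion-freeness are solved for the connection coefficients by
  Koszul's trick; the Cartan term is handled by first contracting twice, then once, with the
  reference direction \<open>y\<close>, because \<open>C\<^sub>y(y, \<cdot>, \<cdot>) = 0\<close> by homogeneity. Hence
  \<open>\<nabla>\<^sup>V\<^sub>X Y = dY(X) + \<Gamma>(x, V)(X, Y)\<close> for a function \<open>\<Gamma>\<close> on \<open>A\<close> that is smooth and
  independent of \<open>V\<close>, and the Chern connection exists globally because the local solutions are
  unique. In the curvature of \<open>\<nabla>\<^sup>V\<close> the chain rule produces \<open>\<partial>\<Gamma>/\<partial>y\<close> applied to
  \<open>dV(X) = \<nabla>\<^sup>V\<^sub>X V - \<Gamma>(x, V)(X, V)\<close>. The second summand turns \<open>\<partial>/\<partial>x\<close> into \<open>\<delta>/\<delta>x\<close> and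
  yields the Chern curvature, the first one yields the two Chern tensor terms.\<close>

section \<open>Calculus of smooth functions\<close>

text \<open>\<open>chern\<close> is a choice term, so nothing is known about it until a connection
  with all three properties exists on the whole of \<Omega>. Such a connection, however, acts only
  on fields defined on all of \<Omega>, whereas a coordinate frame lives on a chart domain.
  Uniqueness in a chart therefore needs bump functions, and uniqueness in turn makes the chart
  formulas agree on overlaps, so that they glue to a global solution. Tangent vectors are abstract
  derivations; only Hadamard's lemma identifies them with coordinate vectors. The metric may be
  indefinite, so indices are raised by Cramer's rule, which needs nothing but a nonzero determinant
  and also yields smoothness. Coordinate objects are kept as maps of vectors instead of arrays of
  components: equations are then proved by testing against \<open>g\<close>, and indices return only
  where the given definitions of the Chern curvature and the Chern tensor are matched.
  \<open>dd\<close> takes the direction first, so that \<open>dd v f\<close> is again a function and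
  mixed derivatives are nested applications.\<close>

definition dd :: "'e::real_normed_vector \<Rightarrow> ('e \<Rightarrow> 'b::real_normed_vector) \<Rightarrow> 'e \<Rightarrow> 'b" where
  "dd v f x = frechet_derivative f (at x) v"

lemma dd_eqI: "(f has_derivative f') (at x) \<Longrightarrow> dd v f x = f' v"
  unfolding dd_def using frechet_derivative_at by metis

lemma has_derivative_dd: "f differentiable (at x) \<Longrightarrow> (f has_derivative (\<lambda>v. dd v f x)) (at x)"
  unfolding dd_def using frechet_derivative_works by metis

lemma linear_dd: "f differentiable (at x) \<Longrightarrow> linear (\<lambda>v. dd v f x)"
  unfolding dd_def using linear_frechet_derivative[of f "at x"] by simp

lemma differentiable_cong_open:
  assumes "open S" "x \<in> S" "\<And>y. y \<in> S \<Longrightarrow> f y = g y" "f differentiable (at x)"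
  shows "g differentiable (at x)"
  using assms has_derivative_transform_within_open unfolding differentiable_def by metis

lemma dd_cong:
  assumes "open S" "x \<in> S" "\<And>y. y \<in> S \<Longrightarrow> f y = g y"
  shows "dd v f x = dd v g x"
proof (cases "f differentiable (at x)")
  case True
  have "(g has_derivative (\<lambda>v. dd v f x)) (at x)"
    using has_derivative_transform_within_open[OF has_derivative_dd[OF True] assms(1,2)] assms(3) by simp
  then show ?thesis by (simp add: dd_eqI)
next
  case False
  \<comment> \<open>\<open>frechet_derivative\<close> is a choice among all derivatives. Functions
    that agree near \<open>x\<close> have the same set of derivatives, hence the same choice, even
    when this set is empty.\<close>
  have "(f has_derivative f') (at x) \<longleftrightarrow> (g has_derivative f') (at x)" for f'
    using assms has_derivative_transform_within_open[of f f' x UNIV S g]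
      has_derivative_transform_within_open[of g f' x UNIV S f] by auto
  then show ?thesis unfolding dd_def frechet_derivative_def by simp
qed

lemma Ck_on_Suc:
  "Ck_on (Suc k) S f \<longleftrightarrow> (\<forall>x\<in>S. f differentiable (at x)) \<and> (\<forall>v. Ck_on k S (dd v f))"
proof -
  have "(\<lambda>x. frechet_derivative f (at x) v) = dd v f" for v
    by (simp add: dd_def fun_eq_iff)
  then show ?thesis by simp
qed

declare Ck_on.simps(2) [simp del]

lemma Ck_on_cong:
  assumes "open S" "\<And>x. x \<in> S \<Longrightarrow> f x = g x" "Ck_on k S f"
  shows "Ck_on k S g"
  using assms(2,3)
proof (induction k arbitrary: f g)
  case 0
  then show ?case by (simp cong: continuous_on_cong)
next
  case (Suc k)
  have "Ck_on k S (dd v g)" for v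
  proof (rule Suc.IH)
    show "dd v f x = dd v g x" if "x \<in> S" for x
      using Suc.prems(1) by (rule dd_cong[OF assms(1) that])
    show "Ck_on k S (dd v f)" using Suc.prems(2) by (simp add: Ck_on_Suc)
  qed
  then show ?case
    using Suc.prems differentiable_cong_open[OF assms(1)] by (metis Ck_on_Suc)
qed

lemma Ck_on_subset: "Ck_on k S f \<Longrightarrow> T \<subseteq> S \<Longrightarrow> Ck_on k T f"
  by (induction k arbitrary: f) (auto simp: Ck_on_Suc intro: continuous_on_subset)

lemma Ck_on_SucD: "Ck_on (Suc k) S f \<Longrightarrow> Ck_on k S f"
proof (induction k arbitrary: f)
  case 0
  then show ?case
    by (simp add: Ck_on_Suc continuous_at_imp_continuous_on differentiable_imp_continuous_within)
next
  case (Suc k)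
  from Suc.prems have "Ck_on k S (dd v f)" for v
    by (intro Suc.IH[of "dd v f"]) (simp add: Ck_on_Suc)
  with Suc.prems show ?case by (simp add: Ck_on_Suc)
qed

lemma Ck_on_local:
  assumes "\<And>x. x \<in> S \<Longrightarrow> \<exists>U. open U \<and> x \<in> U \<and> Ck_on k U f"
  shows "Ck_on k S f"
  using assms
proof (induction k arbitrary: f)
  case 0
  then have "continuous (at x) f" if "x \<in> S" for x
    using that continuous_on_eq_continuous_at by (metis Ck_on.simps(1))
  then show ?case by (simp add: continuous_at_imp_continuous_on)
next
  case (Suc k)
  have "Ck_on k S (dd v f)" for v
    using Suc.prems by (intro Suc.IH) (metis Ck_on_Suc)
  moreover have "f differentiable (at x)" if "x \<in> S" for x
    using Suc.prems[OF that] by (metis Ck_on_Suc)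
  ultimately show ?case by (simp add: Ck_on_Suc)
qed

lemma Ck_on_const: "Ck_on k S (\<lambda>x. c)"
proof (induction k arbitrary: c)
  case (Suc k)
  have "dd v (\<lambda>x. c) = (\<lambda>x. 0)" for v :: 'a by (auto simp: dd_def)
  then show ?case using Suc by (simp add: Ck_on_Suc)
qed simp

lemma Ck_on_add:
  assumes "open S" "Ck_on k S f" "Ck_on k S g"
  shows "Ck_on k S (\<lambda>x. f x + g x)"
  using assms(2,3)
proof (induction k arbitrary: f g)
  case 0
  then show ?case by (auto intro: continuous_intros)
next
  case (Suc k)
  have "dd v f x + dd v g x = dd v (\<lambda>x. f x + g x) x" if "x \<in> S" for v x
    using Suc.prems that by (intro dd_eqI[symmetric] has_derivative_add has_derivative_dd) (auto simp: Ck_on_Suc)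
  then have "Ck_on k S (dd v (\<lambda>x. f x + g x))" for v
    by (rule Ck_on_cong[OF assms(1) _ Suc.IH[of "dd v f" "dd v g"]])
       (use Suc.prems in \<open>simp_all add: Ck_on_Suc\<close>)
  then show ?case using Suc.prems by (simp add: Ck_on_Suc)
qed

text \<open>One product rule for real multiplication, \<open>scaleR\<close> and the inner product.
  Each summand of the derivative keeps one factor undifferentiated, which \<open>Ck_on_SucD\<close>
  lowers to the order of the induction hypothesis.\<close>

lemma Ck_on_bilinear:
  fixes f :: "'e::euclidean_space \<Rightarrow> 'a::real_normed_vector" and g :: "'e \<Rightarrow> 'b::real_normed_vector"
  assumes "bounded_bilinear m" "open S" "Ck_on k S f" "Ck_on k S g"
  shows "Ck_on k S (\<lambda>x. m (f x) (g x))"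
  using assms(3,4)
proof (induction k arbitrary: f g)
  case 0
  then show ?case
    by (simp add: bounded_bilinear.continuous_on[OF assms(1)])
next
  case (Suc k)
  interpret bounded_bilinear m by fact
  have d: "((\<lambda>x. m (f x) (g x)) has_derivative (\<lambda>v. m (f x) (dd v g x) + m (dd v f x) (g x))) (at x)"
    if "x \<in> S" for x
    by (intro FDERIV has_derivative_dd) (use Suc.prems that in \<open>auto simp: Ck_on_Suc\<close>)
  have "Ck_on k S (\<lambda>x. m (f x) (dd v g x) + m (dd v f x) (g x))" for v
    using Suc.prems Suc.prems[THEN Ck_on_SucD]
    by (intro Ck_on_add assms Suc.IH) (simp_all add: Ck_on_Suc)
  then have "Ck_on k S (dd v (\<lambda>x. m (f x) (g x)))" for v
    by (rule Ck_on_cong[OF assms(2), rotated]) (use dd_eqI[OF d] in auto)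
  then show ?case using d by (auto simp: Ck_on_Suc intro: differentiableI)
qed

lemma Ck_on_bounded_linear:
  assumes "bounded_linear h" "Ck_on k S f" "open S"
  shows "Ck_on k S (\<lambda>x. h (f x))"
  using assms(2)
proof (induction k arbitrary: f)
  case 0
  then show ?case by (simp add: bounded_linear.continuous_on[OF assms(1)])
next
  case (Suc k)
  have d: "((\<lambda>x. h (f x)) has_derivative (\<lambda>v. h (dd v f x))) (at x)" if "x \<in> S" for x
    by (intro bounded_linear.has_derivative[OF assms(1)] has_derivative_dd)
       (use Suc.prems that in \<open>auto simp: Ck_on_Suc\<close>)
  have "Ck_on k S (dd v (\<lambda>x. h (f x)))" for v
    by (rule Ck_on_cong[OF assms(3) _ Suc.IH[of "dd v f"]])
       (use Suc.prems dd_eqI[OF d] in \<open>auto simp: Ck_on_Suc\<close>)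
  then show ?case using d by (auto simp: Ck_on_Suc intro: differentiableI)
qed

lemma Ck_on_ident: "Ck_on k S (\<lambda>x. x)"
proof (cases k)
  case (Suc j)
  have "dd v (\<lambda>x. x) = (\<lambda>x. v)" for v :: 'a by (auto simp: dd_def)
  then show ?thesis by (simp add: Suc Ck_on_Suc Ck_on_const)
qed simp

lemma Ck_on_sum:
  assumes "open S" "\<And>i. i \<in> I \<Longrightarrow> Ck_on k S (f i)"
  shows "Ck_on k S (\<lambda>x. \<Sum>i\<in>I. f i x)"
  using assms(2) by (induction I rule: infinite_finite_induct) (auto intro!: Ck_on_const Ck_on_add[OF assms(1)])

lemma Ck_on_compose:
  fixes f :: "'a::euclidean_space \<Rightarrow> 'e::euclidean_space" and g :: "'e \<Rightarrow> 'b::real_normed_vector"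
  assumes "open S" "open T" "Ck_on k S f" "Ck_on k T g" "f ` S \<subseteq> T"
  shows "Ck_on k S (\<lambda>x. g (f x))"
  using assms(3,4)
proof (induction k arbitrary: g)
  case 0
  then show ?case using assms(5) continuous_on_compose2[of T g S f] by simp
next
  case (Suc k)
  have d: "((\<lambda>x. g (f x)) has_derivative (\<lambda>v. dd (dd v f x) g (f x))) (at x)" if "x \<in> S" for x
    using has_derivative_compose[OF has_derivative_dd has_derivative_dd] Suc.prems that assms(5)
    unfolding Ck_on_Suc by blast
  \<comment> \<open>In the chain rule the direction \<open>dd v f x\<close> varies with
    \<open>x\<close>. Expanding it in the basis gives a finite sum of products with fixed directions
    \<open>b\<close>, to which the induction hypothesis for \<open>dd b g\<close> applies.\<close>
  have lin: "dd v g y = (\<Sum>b\<in>Basis. (v \<bullet> b) *\<^sub>R dd b g y)" if "y \<in> T" for v y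
  proof -
    interpret linear "\<lambda>v. dd v g y"
      using that Suc.prems by (intro linear_dd) (auto simp: Ck_on_Suc)
    have "dd v g y = dd (\<Sum>b\<in>Basis. (v \<bullet> b) *\<^sub>R b) g y"
      by (simp add: euclidean_representation)
    then show ?thesis by (simp add: sum scale)
  qed
  have "Ck_on k S (\<lambda>x. \<Sum>b\<in>Basis. (dd v f x \<bullet> b) *\<^sub>R dd b g (f x))" for v
    using Suc.prems Suc.prems[THEN Ck_on_SucD]
    by (intro Ck_on_sum assms Ck_on_bilinear[OF bounded_bilinear_scaleR]
        Ck_on_bounded_linear[OF bounded_linear_inner_left] Suc.IH) (simp_all add: Ck_on_Suc)
  then have "Ck_on k S (dd v (\<lambda>x. g (f x)))" for v
    by (rule Ck_on_cong[OF assms(1), rotated]) (use dd_eqI[OF d] lin assms(5) in auto)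
  then show ?case using d by (auto simp: Ck_on_Suc intro: differentiableI)
qed

text \<open>The derivative of 1/f is a polynomial in 1/f and the derivative of f, so regularity of
  order k of the inverse itself feeds the step to k + 1.\<close>

lemma Ck_on_inverse:
  fixes f :: "'e::euclidean_space \<Rightarrow> real"
  assumes "open S" "Ck_on k S f" "\<And>x. x \<in> S \<Longrightarrow> f x \<noteq> 0"
  shows "Ck_on k S (\<lambda>x. inverse (f x))"
  using assms(2)
proof (induction k)
  case 0
  then show ?case using assms(3) by (auto intro: continuous_intros)
next
  case (Suc k)
  have d: "((\<lambda>x. inverse (f x)) has_derivative (\<lambda>v. - (inverse (f x) * dd v f x * inverse (f x)))) (at x)"
    if "x \<in> S" for x
    by (rule Deriv.has_derivative_inverse[where f = f], rule assms(3)[OF that], rule has_derivative_dd)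
       (use Suc.prems that in \<open>auto simp: Ck_on_Suc\<close>)
  have i: "Ck_on k S (\<lambda>x. inverse (f x))"
    using Suc.IH Ck_on_SucD[OF Suc.prems] by simp
  have "Ck_on k S (\<lambda>x. - (inverse (f x) * dd v f x * inverse (f x)))" for v
    by (intro Ck_on_bounded_linear[OF bounded_linear_minus[OF bounded_linear_ident]]
        Ck_on_bilinear[OF bounded_bilinear_mult] assms i)
      (use Suc.prems in \<open>auto simp: Ck_on_Suc\<close>)
  then have "Ck_on k S (dd v (\<lambda>x. inverse (f x)))" for v
    by (rule Ck_on_cong[OF assms(1), rotated]) (use dd_eqI[OF d] in auto)
  then show ?case using d by (auto simp: Ck_on_Suc intro: differentiableI)
qed

section \<open>Closure properties of smooth functions\<close>

lemma smooth_on_cong: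
  "smooth_on S f \<Longrightarrow> open S \<Longrightarrow> (\<And>x. x \<in> S \<Longrightarrow> f x = g x) \<Longrightarrow> smooth_on S g"
  unfolding smooth_on_def using Ck_on_cong by blast

lemma smooth_on_subset: "smooth_on S f \<Longrightarrow> T \<subseteq> S \<Longrightarrow> smooth_on T f"
  unfolding smooth_on_def using Ck_on_subset by blast

lemma smooth_on_local:
  "(\<And>x. x \<in> S \<Longrightarrow> \<exists>U. open U \<and> x \<in> U \<and> smooth_on U f) \<Longrightarrow> smooth_on S f"
  unfolding smooth_on_def by (metis Ck_on_local)

lemma smooth_on_dd: "smooth_on S f \<Longrightarrow> smooth_on S (dd v f)"
  unfolding smooth_on_def using Ck_on_Suc by blast

lemma smooth_on_differentiable: "smooth_on S f \<Longrightarrow> x \<in> S \<Longrightarrow> f differentiable (at x)"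
  unfolding smooth_on_def using Ck_on_Suc by blast

lemma smooth_on_has_derivative:
  "smooth_on S f \<Longrightarrow> x \<in> S \<Longrightarrow> (f has_derivative (\<lambda>v. dd v f x)) (at x)"
  by (intro has_derivative_dd smooth_on_differentiable)

lemma smooth_on_linear_dd: "smooth_on S f \<Longrightarrow> x \<in> S \<Longrightarrow> linear (\<lambda>v. dd v f x)"
  by (intro linear_dd smooth_on_differentiable)

lemma smooth_on_continuous_on: "smooth_on S f \<Longrightarrow> continuous_on S f"
  unfolding smooth_on_def using Ck_on.simps(1) by blast

lemma smooth_on_const [simp]: "smooth_on S (\<lambda>x. c)"
  by (simp add: smooth_on_def Ck_on_const)

lemma smooth_on_ident [simp]: "smooth_on S (\<lambda>x. x)"
  by (simp add: smooth_on_def Ck_on_ident)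

lemma smooth_on_add:
  "open S \<Longrightarrow> smooth_on S f \<Longrightarrow> smooth_on S g \<Longrightarrow> smooth_on S (\<lambda>x. f x + g x)"
  by (simp add: smooth_on_def Ck_on_add)

lemma smooth_on_sum:
  "open S \<Longrightarrow> (\<And>i. i \<in> I \<Longrightarrow> smooth_on S (f i)) \<Longrightarrow> smooth_on S (\<lambda>x. \<Sum>i\<in>I. f i x)"
  by (simp add: smooth_on_def Ck_on_sum)

lemma smooth_on_bounded_linear:
  "bounded_linear h \<Longrightarrow> open S \<Longrightarrow> smooth_on S f \<Longrightarrow> smooth_on S (\<lambda>x. h (f x))"
  by (simp add: smooth_on_def Ck_on_bounded_linear)

lemma smooth_on_uminus: "open S \<Longrightarrow> smooth_on S f \<Longrightarrow> smooth_on S (\<lambda>x. - f x)"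
  by (rule smooth_on_bounded_linear[OF bounded_linear_minus[OF bounded_linear_ident]])

lemma smooth_on_diff:
  "open S \<Longrightarrow> smooth_on S f \<Longrightarrow> smooth_on S g \<Longrightarrow> smooth_on S (\<lambda>x. f x - g x)"
  using smooth_on_add[of S f "\<lambda>x. - g x"] smooth_on_uminus[of S g] by simp

lemma smooth_on_scaleR:
  "open S \<Longrightarrow> smooth_on S f \<Longrightarrow> smooth_on S g \<Longrightarrow> smooth_on S (\<lambda>x. f x *\<^sub>R g x)"
  by (simp add: smooth_on_def Ck_on_bilinear[OF bounded_bilinear_scaleR])

lemma smooth_on_mult:
  fixes f g :: "'e::euclidean_space \<Rightarrow> real"
  shows "open S \<Longrightarrow> smooth_on S f \<Longrightarrow> smooth_on S g \<Longrightarrow> smooth_on S (\<lambda>x. f x * g x)"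
  by (simp add: smooth_on_def Ck_on_bilinear[OF bounded_bilinear_mult])

lemma smooth_on_prod:
  fixes f :: "'i \<Rightarrow> 'e::euclidean_space \<Rightarrow> real"
  shows "open S \<Longrightarrow> (\<And>i. i \<in> I \<Longrightarrow> smooth_on S (f i)) \<Longrightarrow> smooth_on S (\<lambda>x. \<Prod>i\<in>I. f i x)"
  by (induction I rule: infinite_finite_induct) (auto intro!: smooth_on_mult)

lemma smooth_on_divide:
  fixes f g :: "'e::euclidean_space \<Rightarrow> real"
  shows "open S \<Longrightarrow> smooth_on S f \<Longrightarrow> smooth_on S g \<Longrightarrow> (\<And>x. x \<in> S \<Longrightarrow> g x \<noteq> 0) \<Longrightarrow>
    smooth_on S (\<lambda>x. f x / g x)"
  unfolding divide_inverse
  by (intro smooth_on_mult) (auto simp add: smooth_on_def Ck_on_inverse)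

lemma smooth_on_compose:
  fixes f :: "'a::euclidean_space \<Rightarrow> 'e::euclidean_space" and g :: "'e \<Rightarrow> 'b::real_normed_vector"
  assumes "smooth_on T g" "open T" "open S" "smooth_on S f" "f ` S \<subseteq> T"
  shows "smooth_on S (\<lambda>x. g (f x))"
  using assms by (auto simp: smooth_on_def intro: Ck_on_compose)

lemma smooth_on_vec_nth: "open S \<Longrightarrow> smooth_on S f \<Longrightarrow> smooth_on S (\<lambda>x. f x $ i)"
  by (rule smooth_on_bounded_linear[OF bounded_linear_vec_nth])

lemma smooth_on_vec_lambda:
  fixes f :: "'i::finite \<Rightarrow> 'e::euclidean_space \<Rightarrow> real"
  assumes "open S" "\<And>i. smooth_on S (f i)"
  shows "smooth_on S (\<lambda>x. \<chi> i. f i x)"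
proof -
  have "(\<lambda>x. \<chi> i. f i x) = (\<lambda>x. \<Sum>i\<in>UNIV. f i x *\<^sub>R axis i 1)"
    by (auto simp: vec_eq_iff axis_def if_distrib cong: if_cong)
  then show ?thesis
    using assms by (auto intro!: smooth_on_sum smooth_on_scaleR)
qed

lemma smooth_on_vec_iff:
  fixes f :: "'e::euclidean_space \<Rightarrow> real ^ 'i::finite"
  assumes "open S"
  shows "smooth_on S f \<longleftrightarrow> (\<forall>i. smooth_on S (\<lambda>x. f x $ i))"
  using smooth_on_vec_nth[OF assms] smooth_on_vec_lambda[OF assms, of "\<lambda>i x. f x $ i"] by auto

lemma smooth_on_Pair:
  fixes f :: "'e::euclidean_space \<Rightarrow> 'a::real_normed_vector" and g :: "'e \<Rightarrow> 'b::real_normed_vector"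
  assumes "open S" "smooth_on S f" "smooth_on S g"
  shows "smooth_on S (\<lambda>x. (f x, g x))"
proof -
  have "smooth_on S (\<lambda>x. (f x, 0) + (0, g x) :: 'a \<times> 'b)"
    by (intro smooth_on_add assms smooth_on_bounded_linear[of "\<lambda>a. (a, 0)"]
        smooth_on_bounded_linear[of "\<lambda>a. (0, a)"] bounded_linear_Pair bounded_linear_ident bounded_linear_zero)
  then show ?thesis by simp
qed

lemma smooth_on_det:
  fixes B :: "'e::euclidean_space \<Rightarrow> real ^ 'n ^ 'n"
  assumes "open S" "\<And>i j. smooth_on S (\<lambda>x. B x $ i $ j)"
  shows "smooth_on S (\<lambda>x. det (B x))"
  unfolding det_def by (intro smooth_on_sum smooth_on_mult smooth_on_prod assms smooth_on_const)

section \<open>Symmetry of second derivatives\<close>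

lemma real_mvt_dd:
  fixes f :: "'e::real_normed_vector \<Rightarrow> real"
  assumes "0 < h" "\<And>s. 0 \<le> s \<Longrightarrow> s \<le> h \<Longrightarrow> f differentiable (at (x + s *\<^sub>R u))"
  shows "\<exists>s. 0 < s \<and> s < h \<and> f (x + h *\<^sub>R u) - f x = h * dd u f (x + s *\<^sub>R u)"
proof -
  have d: "((\<lambda>s. f (x + s *\<^sub>R u)) has_real_derivative dd u f (x + s *\<^sub>R u)) (at s)"
    if "0 \<le> s" "s \<le> h" for s
  proof -
    have "((\<lambda>s. x + s *\<^sub>R u) has_derivative (\<lambda>t. t *\<^sub>R u)) (at s)"
      by (auto intro!: derivative_eq_intros)
    from has_derivative_compose[OF this has_derivative_dd[OF assms(2)[OF that]]]
    show ?thesis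
      using linear_cmul[OF linear_dd[OF assms(2)[OF that]]]
      by (simp add: has_field_derivative_def mult.commute[of _ "dd u f _"])
  qed
  from MVT2[OF assms(1), of "\<lambda>s. f (x + s *\<^sub>R u)", OF d]
  show ?thesis by auto
qed

lemma dd_diff:
  "f differentiable (at x) \<Longrightarrow> g differentiable (at x) \<Longrightarrow> dd v (\<lambda>x. f x - g x) x = dd v f x - dd v g x"
  by (intro dd_eqI has_derivative_diff has_derivative_dd)

lemma dd_translate:
  assumes "f differentiable (at (x + a))"
  shows "(\<lambda>x. f (x + a)) differentiable (at x)" "dd v (\<lambda>x. f (x + a)) x = dd v f (x + a)"
proof -
  have "((\<lambda>x. x + a) has_derivative (\<lambda>t. t)) (at x)" by (auto intro!: derivative_eq_intros)
  from has_derivative_compose[OF this has_derivative_dd[OF assms]]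
  have "((\<lambda>x. f (x + a)) has_derivative (\<lambda>v. dd v f (x + a))) (at x)" .
  then show "(\<lambda>x. f (x + a)) differentiable (at x)" "dd v (\<lambda>x. f (x + a)) x = dd v f (x + a)"
    by (auto intro: differentiableI dd_eqI)
qed

text \<open>The second difference quotient of \<open>f\<close> is a value of either mixed derivative nearby.\<close>

lemma dd_commute:
  fixes f :: "'e::euclidean_space \<Rightarrow> real"
  assumes S: "open S" "smooth_on S f" "x \<in> S"
  shows "dd u (dd v f) x = dd v (dd u f) x"
proof -
  obtain e where e: "e > 0" "ball x e \<subseteq> S" using S openE by blast
  \<comment> \<open>For \<open>h \<le> r\<close> the parallelogram at \<open>x\<close> spanned by
    \<open>h *\<^sub>R u\<close> and \<open>h *\<^sub>R v\<close> stays inside the ball of radius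
    \<open>e\<close>; the summand 1 makes the estimate strict and the denominator positive.\<close>
  define r where "r = e / (norm u + norm v + 1)"
  have r: "r > 0" using e unfolding r_def by (auto intro!: divide_pos_pos add_nonneg_pos)
  have in_S: "x + s *\<^sub>R a + t *\<^sub>R b \<in> ball x (h * (norm u + norm v + 1))" 
    if "0 \<le> s" "s \<le> h" "0 \<le> t" "t \<le> h" "0 < h" "(a = u \<and> b = v) \<or> (a = v \<and> b = u)" for s t a b h
  proof -
    have "norm (s *\<^sub>R a + t *\<^sub>R b) \<le> s * norm a + t * norm b"
      using that by (metis norm_triangle_ineq norm_scaleR abs_of_nonneg)
    also have "\<dots> \<le> h * norm a + h * norm b"
      using that by (intro add_mono mult_right_mono) auto
    also have "\<dots> < h * (norm u + norm v + 1)"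
      using that by (auto simp: algebra_simps)
    finally have "norm (- (s *\<^sub>R a + t *\<^sub>R b)) < h * (norm u + norm v + 1)"
      by (simp only: norm_minus_cancel)
    then show ?thesis by (simp add: dist_norm add.assoc)
  qed
  have sub: "ball x (h * (norm u + norm v + 1)) \<subseteq> ball x e" if "h \<le> r" for h
    using that e unfolding r_def
    by (intro subset_ball) (simp add: pos_le_divide_eq add_nonneg_pos)
  \<comment> \<open>The mean value theorem is applied twice: along \<open>a\<close> to the increment
    of \<open>f\<close> in direction \<open>h *\<^sub>R b\<close>, then along \<open>b\<close> to
    \<open>dd a f\<close>. The second difference is symmetric in \<open>a\<close> and
    \<open>b\<close>, so both orders of differentiation attain the same value near
    \<open>x\<close>.\<close>
  have key: "\<exists>y. y \<in> ball x (h * (norm u + norm v + 1)) \<and>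
      f (x + h *\<^sub>R a + h *\<^sub>R b) - f (x + h *\<^sub>R a) - f (x + h *\<^sub>R b) + f x = h * h * dd b (dd a f) y"
    if h: "0 < h" "h \<le> r" and ab: "(a = u \<and> b = v) \<or> (a = v \<and> b = u)" for h a b
  proof -
    have df: "f differentiable (at (x + s *\<^sub>R a + t *\<^sub>R b))" "dd a f differentiable (at (x + s *\<^sub>R a + t *\<^sub>R b))"
      if "0 \<le> s" "s \<le> h" "0 \<le> t" "t \<le> h" for s t
      using in_S[OF that h(1) ab] sub[OF h(2)] e smooth_on_differentiable[OF S(2)]
        smooth_on_differentiable[OF smooth_on_dd[OF S(2)]] by blast+
    let ?g = "\<lambda>y. f (y + h *\<^sub>R b) - f y"
    have dg: "?g differentiable (at (x + s *\<^sub>R a))" 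
       "dd a ?g (x + s *\<^sub>R a) = dd a f (x + s *\<^sub>R a + h *\<^sub>R b) - dd a f (x + s *\<^sub>R a)"
      if "0 \<le> s" "s \<le> h" for s
      using dd_translate[OF df(1)[OF that, of h]] df(1)[OF that, of 0] h
      by (auto intro!: differentiable_diff simp: dd_diff)
    obtain s where s: "0 < s" "s < h" "?g (x + h *\<^sub>R a) - ?g x = h * dd a ?g (x + s *\<^sub>R a)"
      using real_mvt_dd[OF h(1), of ?g x a] dg(1) by blast
    obtain t where t: "0 < t" "t < h"
      "dd a f (x + s *\<^sub>R a + h *\<^sub>R b) - dd a f (x + s *\<^sub>R a) = h * dd b (dd a f) (x + s *\<^sub>R a + t *\<^sub>R b)"
      using real_mvt_dd[OF h(1), of "dd a f" "x + s *\<^sub>R a" b] df(2)[of s] s by (auto simp: less_imp_le)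
    show ?thesis
      using in_S[of s h t a b] s t h ab dg(2)[of s]
      by (intro exI[of _ "x + s *\<^sub>R a + t *\<^sub>R b"]) (auto simp: algebra_simps)
  qed
  show ?thesis
  proof (rule ccontr)
    assume ne: "dd u (dd v f) x \<noteq> dd v (dd u f) x"
    \<comment> \<open>Half the distance: the mixed derivatives take a common value at
      \<open>y\<close> and \<open>z\<close>, and this value would be closer than \<epsilon> to both
      limits.\<close>
    define \<epsilon> where "\<epsilon> = dist (dd u (dd v f) x) (dd v (dd u f) x) / 2"
    have \<epsilon>: "\<epsilon> > 0" using ne by (simp add: \<epsilon>_def)
    have "continuous (at x) (dd u (dd v f))" "continuous (at x) (dd v (dd u f))"
      using S smooth_on_dd smooth_on_continuous_on continuous_on_eq_continuous_at by metis+
    then obtain d1 d2 where d: "d1 > 0" "d2 > 0"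
      "\<And>y. dist y x < d1 \<Longrightarrow> dist (dd u (dd v f) y) (dd u (dd v f) x) < \<epsilon>"
      "\<And>y. dist y x < d2 \<Longrightarrow> dist (dd v (dd u f) y) (dd v (dd u f) x) < \<epsilon>"
      unfolding continuous_at_eps_delta using \<epsilon> by (metis dist_norm)
    define h where "h = min r (min d1 d2 / (norm u + norm v + 1))"
    have n: "norm u + norm v + 1 > 0" by (intro add_nonneg_pos) auto
    have h: "0 < h" "h \<le> r" using r d n by (auto simp: h_def)
    have hd: "h * (norm u + norm v + 1) \<le> min d1 d2"
      using n pos_le_divide_eq[OF n] unfolding h_def by fastforce
    obtain y z where yz: "y \<in> ball x (h * (norm u + norm v + 1))" "z \<in> ball x (h * (norm u + norm v + 1))"
      "f (x + h *\<^sub>R v + h *\<^sub>R u) - f (x + h *\<^sub>R v) - f (x + h *\<^sub>R u) + f x = h * h * dd u (dd v f) y"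
      "f (x + h *\<^sub>R u + h *\<^sub>R v) - f (x + h *\<^sub>R u) - f (x + h *\<^sub>R v) + f x = h * h * dd v (dd u f) z"
      using key[OF h, of v u] key[OF h, of u v] by blast
    have "f (x + h *\<^sub>R v + h *\<^sub>R u) = f (x + h *\<^sub>R u + h *\<^sub>R v)"
      by (simp add: add.assoc add.commute[of "h *\<^sub>R v"])
    with yz(3,4) have "h * h * dd u (dd v f) y = h * h * dd v (dd u f) z" by linarith
    then have "dd u (dd v f) y = dd v (dd u f) z" using h by simp
    moreover have "dist y x < d1" "dist z x < d2"
      using yz(1,2) hd by (auto simp: dist_commute)
    then have "dist (dd u (dd v f) y) (dd u (dd v f) x) < \<epsilon>" "dist (dd v (dd u f) z) (dd v (dd u f) x) < \<epsilon>"
      by (auto intro: d)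
    ultimately show False
      using dist_triangle3[of "dd u (dd v f) x" "dd v (dd u f) x" "dd u (dd v f) y"]
      unfolding \<epsilon>_def by simp
  qed
qed

section \<open>Hadamard's lemma and tangent vectors\<close>

lemma ray_in_ball:
  fixes a x :: "'e::real_normed_vector"
  assumes "x \<in> ball a r" "0 \<le> t" "t \<le> 1"
  shows "a + t *\<^sub>R (x - a) \<in> ball a r"
proof -
  have "norm (t *\<^sub>R (x - a)) \<le> norm (x - a)"
    using assms mult_right_mono[of t 1 "norm (x - a)"] by simp
  then show ?thesis using assms by (simp add: dist_norm norm_minus_commute)
qed

text \<open>Differentiating under the integral sign reproduces the integral with \<open>m + 1\<close> in place of \<open>m\<close>.\<close>

lemma Ck_on_ray_integral:
  fixes f :: "'e::euclidean_space \<Rightarrow> real"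
  assumes "Ck_on k (ball a r) f"
  shows "Ck_on k (ball a r) (\<lambda>x. integral (cbox 0 1) (\<lambda>t::real. t ^ m * f (a + t *\<^sub>R (x - a))))"
  using assms
proof (induction k arbitrary: f m)
  case 0
  then have cf: "continuous_on (ball a r) f" by simp
  have "continuous_on (ball a r \<times> cbox 0 1) (\<lambda>z. f (a + snd z *\<^sub>R (fst z - a)))"
    by (intro continuous_on_compose2[OF cf] continuous_intros) (auto simp del: mem_ball intro: ray_in_ball)
  then have "continuous_on (ball a r \<times> cbox 0 1) (\<lambda>(x, t). t ^ m * f (a + t *\<^sub>R (x - a)))"
    unfolding case_prod_beta by (intro continuous_intros)
  then show ?case
    unfolding Ck_on.simps by (rule integral_continuous_on_param)
next
  case (Suc k)
  note in_ball = ray_in_ball[of _ a r]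
  have df: "f differentiable (at x)" if "x \<in> ball a r" for x
    using Suc.prems that by (auto simp: Ck_on_Suc)
  have cf: "continuous_on (ball a r) f"
    using Ck_on_SucD[OF Suc.prems] Ck_on_SucD
    by (meson continuous_at_imp_continuous_on df differentiable_imp_continuous_within)
  have cdf: "continuous_on (ball a r) (dd v f)" for v
  proof -
    have "Ck_on k (ball a r) (dd v f)" using Suc.prems by (simp add: Ck_on_Suc)
    then show ?thesis by (induction k) (auto dest: Ck_on_SucD)
  qed
  \<comment> \<open>\<open>leibniz_rule\<close> takes the derivative as a bounded linear operator.
    The exponent \<open>Suc m\<close> contains the factor t that the chain rule produces along the
    ray.\<close>
  define D where "D x t = Blinfun (\<lambda>v. t ^ Suc m * dd v f (a + t *\<^sub>R (x - a)))" for x and t :: real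
  have D: "blinfun_apply (D x t) = (\<lambda>v. t ^ Suc m * dd v f (a + t *\<^sub>R (x - a)))"
    if "x \<in> ball a r" "0 \<le> t" "t \<le> 1" for x t
    unfolding D_def using linear_dd[OF df[OF in_ball[OF that]]]
    by (intro bounded_linear_Blinfun_apply bounded_linear_mult_right[THEN bounded_linear_compose])
       (simp add: linear_conv_bounded_linear)
  have d: "((\<lambda>x. t ^ m * f (a + t *\<^sub>R (x - a))) has_derivative blinfun_apply (D x t)) (at x within ball a r)"
    if t: "x \<in> ball a r" "t \<in> cbox 0 1" for x t
  proof -
    have "((\<lambda>x. a + t *\<^sub>R (x - a)) has_derivative (\<lambda>v. t *\<^sub>R v)) (at x)"
      by (auto intro!: derivative_eq_intros)
    from has_derivative_compose[OF this has_derivative_dd[OF df[OF in_ball]]] t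
    have "((\<lambda>x. f (a + t *\<^sub>R (x - a))) has_derivative (\<lambda>v. dd (t *\<^sub>R v) f (a + t *\<^sub>R (x - a)))) (at x)"
      by simp
    then have "((\<lambda>x. t ^ m * f (a + t *\<^sub>R (x - a))) has_derivative
        (\<lambda>v. t ^ m * dd (t *\<^sub>R v) f (a + t *\<^sub>R (x - a)))) (at x)"
      by (rule has_derivative_mult_right)
    moreover have "(\<lambda>v. t ^ m * dd (t *\<^sub>R v) f (a + t *\<^sub>R (x - a))) = blinfun_apply (D x t)"
      using t linear_cmul[OF linear_dd[OF df[OF in_ball[of x t]]]] by (auto simp: D)
    ultimately show ?thesis by (simp add: has_derivative_at_withinI)
  qed
  have cray: "continuous_on (ball a r \<times> cbox 0 1) (\<lambda>(x, t). t ^ j * h (a + t *\<^sub>R (x - a)))"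
    if "continuous_on (ball a r) h" for h :: "'e \<Rightarrow> real" and j
  proof -
    have "continuous_on (ball a r \<times> cbox 0 1) (\<lambda>z. h (a + snd z *\<^sub>R (fst z - a)))"
      by (intro continuous_on_compose2[OF that] continuous_intros) (auto simp del: mem_ball intro: ray_in_ball)
    then show ?thesis
      unfolding case_prod_beta by (intro continuous_intros)
  qed
  have cD: "continuous_on (ball a r \<times> cbox 0 1) (\<lambda>(x, t). D x t)"
  proof (rule continuous_on_blinfun_componentwise)
    fix v :: 'e assume "v \<in> Basis"
    show "continuous_on (ball a r \<times> cbox 0 1) (\<lambda>z. blinfun_apply (case z of (x, t) \<Rightarrow> D x t) v)"
      using cray[OF cdf, of "Suc m" v] by (rule continuous_on_eq) (auto simp: D)
  qed
  have int: "(\<lambda>t. g (x, t)) integrable_on cbox 0 1"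
    if "continuous_on (ball a r \<times> cbox 0 1) g" "x \<in> ball a r" for g :: "'e \<times> real \<Rightarrow> 'c::banach" and x
    using that by (intro integrable_continuous continuous_on_compose2[OF that(1)] continuous_intros) auto
  let ?F = "\<lambda>x. integral (cbox 0 1) (\<lambda>t::real. t ^ m * f (a + t *\<^sub>R (x - a)))"
  have dF: "(?F has_derivative (\<lambda>v. integral (cbox 0 1) (\<lambda>t. t ^ Suc m * dd v f (a + t *\<^sub>R (x - a))))) (at x)"
    if x: "x \<in> ball a r" for x
  proof -
    have "(?F has_derivative integral (cbox 0 1) (D x)) (at x within ball a r)"
      by (rule leibniz_rule[OF d _ cD]) (use int[OF cray[OF cf, of m]] x in auto)
    moreover have "blinfun_apply (integral (cbox 0 1) (D x)) =
        (\<lambda>v. integral (cbox 0 1) (\<lambda>t. t ^ Suc m * dd v f (a + t *\<^sub>R (x - a))))"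
    proof
      fix v
      have "D x integrable_on cbox 0 1" using int[OF cD x] by simp
      then have "blinfun_apply (integral (cbox 0 1) (D x)) v = integral (cbox 0 1) (\<lambda>t. blinfun_apply (D x t) v)"
        by (rule blinfun_apply_integral)
      also have "\<dots> = integral (cbox 0 1) (\<lambda>t. t ^ Suc m * dd v f (a + t *\<^sub>R (x - a)))"
        using x by (intro integral_cong) (simp add: D)
      finally show "blinfun_apply (integral (cbox 0 1) (D x)) v =
          integral (cbox 0 1) (\<lambda>t. t ^ Suc m * dd v f (a + t *\<^sub>R (x - a)))" .
    qed
    ultimately show ?thesis
      using x at_within_open[OF x open_ball] by metis
  qed
  have IH: "Ck_on k (ball a r) (\<lambda>x. integral (cbox 0 1) (\<lambda>t. t ^ Suc m * dd v f (a + t *\<^sub>R (x - a))))" for v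
    by (rule Suc.IH) (use Suc.prems in \<open>simp add: Ck_on_Suc\<close>)
  have "Ck_on k (ball a r) (dd v ?F)" for v
    by (rule Ck_on_cong[OF open_ball _ IH[of v]]) (rule sym[OF dd_eqI[OF dF]])
  then show ?case unfolding Ck_on_Suc using differentiableI[OF dF] by blast
qed

text \<open>The fundamental theorem of calculus along the ray from \<open>a\<close>, with averaged
  partial derivatives as coefficients. Their smoothness up to \<open>a\<close> allows an abstract
  derivation to be applied to each product.\<close>

lemma hadamard:
  fixes f :: "'e::euclidean_space \<Rightarrow> real"
  assumes f: "smooth_on (ball a r) f" and r: "r > 0"
  obtains G where "\<And>b. smooth_on (ball a r) (G b)" "\<And>b. G b a = dd b f a"
    "\<And>x. x \<in> ball a r \<Longrightarrow> f x = f a + (\<Sum>b\<in>Basis. ((x - a) \<bullet> b) * G b x)"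
proof
  \<comment> \<open>The factor \<open>t ^ 0\<close> makes this the case m = 0 of
    \<open>Ck_on_ray_integral\<close>.\<close>
  let ?G = "\<lambda>b x. integral (cbox 0 1) (\<lambda>t::real. t ^ 0 * dd b f (a + t *\<^sub>R (x - a)))"
  show "smooth_on (ball a r) (?G b)" for b
    using smooth_on_dd[OF f, of b] unfolding smooth_on_def
    by (blast intro: Ck_on_ray_integral)
  show "?G b a = dd b f a" for b by simp
  fix x assume x: "x \<in> ball a r"
  have in_ball: "a + t *\<^sub>R (x - a) \<in> ball a r" if "0 \<le> t" "t \<le> 1" for t
    using ray_in_ball[OF x that] .
  have d: "((\<lambda>t. f (a + t *\<^sub>R (x - a))) has_vector_derivative dd (x - a) f (a + t *\<^sub>R (x - a))) (at t within {0..1})"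
    if "t \<in> {0..1}" for t
  proof -
    have "((\<lambda>t. a + t *\<^sub>R (x - a)) has_derivative (\<lambda>t. t *\<^sub>R (x - a))) (at t)"
      by (auto intro!: derivative_eq_intros)
    from has_derivative_compose[OF this smooth_on_has_derivative[OF f in_ball]] that
    have "((\<lambda>t. f (a + t *\<^sub>R (x - a))) has_derivative (\<lambda>s. dd (s *\<^sub>R (x - a)) f (a + t *\<^sub>R (x - a)))) (at t)"
      by simp
    moreover have "dd (s *\<^sub>R (x - a)) f (a + t *\<^sub>R (x - a)) = s *\<^sub>R dd (x - a) f (a + t *\<^sub>R (x - a))" for s
      using linear_cmul[OF smooth_on_linear_dd[OF f in_ball]] that by simp
    ultimately show ?thesis
      by (simp add: has_vector_derivative_def has_derivative_at_withinI)
  qed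
  have cont: "continuous_on {0..1} (\<lambda>t. dd b f (a + t *\<^sub>R (x - a)))" for b
    using in_ball
    by (intro continuous_on_compose2[OF smooth_on_continuous_on[OF smooth_on_dd[OF f, of b]]] continuous_intros) auto
  have "f x = f a + integral {0..1} (\<lambda>t. dd (x - a) f (a + t *\<^sub>R (x - a)))"
    using integral_unique[OF fundamental_theorem_of_calculus[of 0 1, OF _ d]] by simp
  also have "integral {0..1} (\<lambda>t. dd (x - a) f (a + t *\<^sub>R (x - a))) =
      integral {0..1} (\<lambda>t. \<Sum>b\<in>Basis. ((x - a) \<bullet> b) * dd b f (a + t *\<^sub>R (x - a)))"
  proof (rule integral_cong)
    fix t :: real assume "t \<in> {0..1}"
    then interpret linear "\<lambda>v. dd v f (a + t *\<^sub>R (x - a))"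
      using smooth_on_linear_dd[OF f in_ball[of t]] by simp
    have "dd (x - a) f (a + t *\<^sub>R (x - a)) = dd (\<Sum>b\<in>Basis. ((x - a) \<bullet> b) *\<^sub>R b) f (a + t *\<^sub>R (x - a))"
      by (simp only: euclidean_representation)
    then show "dd (x - a) f (a + t *\<^sub>R (x - a)) = (\<Sum>b\<in>Basis. ((x - a) \<bullet> b) * dd b f (a + t *\<^sub>R (x - a)))"
      by (simp only: sum scale real_scaleR_def)
  qed
  also have "\<dots> = (\<Sum>b\<in>Basis. ((x - a) \<bullet> b) * ?G b x)"
    using cont by (subst integral_sum) (auto intro!: integrable_continuous_real continuous_intros)
  finally show "f x = f a + (\<Sum>b\<in>Basis. ((x - a) \<bullet> b) * ?G b x)" .
qed

section \<open>Charts and smooth functions on a manifold\<close>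

locale manifold =
  fixes M :: "('m::{t2_space,second_countable_topology}, 'n::finite) chart set"
  assumes smooth_manifold: "smooth_manifold M"
begin

lemma chart_open: "c \<in> M \<Longrightarrow> open (cdom c)" "c \<in> M \<Longrightarrow> open (cimg c)"
  using smooth_manifold by (auto simp: smooth_manifold_def is_chart_def)

lemma chart_homeo: "c \<in> M \<Longrightarrow> homeomorphism (cdom c) (cimg c) (cmap c) (cinv c)"
  using smooth_manifold by (auto simp: smooth_manifold_def is_chart_def)

lemma ex_chart: "\<exists>c\<in>M. p \<in> cdom c"
  using smooth_manifold unfolding smooth_manifold_def by (metis UN_iff UNIV_I)

lemma cinv_cmap [simp]: "c \<in> M \<Longrightarrow> p \<in> cdom c \<Longrightarrow> cinv c (cmap c p) = p"
  using homeomorphism_apply1[OF chart_homeo] by blast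

lemma cmap_cinv [simp]: "c \<in> M \<Longrightarrow> x \<in> cimg c \<Longrightarrow> cmap c (cinv c x) = x"
  using homeomorphism_apply2[OF chart_homeo] by blast

lemma cinv_in [simp]: "c \<in> M \<Longrightarrow> x \<in> cimg c \<Longrightarrow> cinv c x \<in> cdom c"
  using chart_homeo[of c] unfolding homeomorphism_def by blast

lemma mem_chart_image: "c \<in> M \<Longrightarrow> x \<in> cmap c ` (cdom c \<inter> W) \<longleftrightarrow> x \<in> cimg c \<and> cinv c x \<in> W"
  using cmap_cinv[of c x] cinv_in[of c x] by fastforce

lemma open_chart_image: "c \<in> M \<Longrightarrow> open W \<Longrightarrow> open (cmap c ` (cdom c \<inter> W))"
  using homeomorphism_imp_open_map[OF chart_homeo, of c "cdom c \<inter> W"] chart_open[of c]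
  by (meson inf.cobounded1 openin_open_Int openin_open_trans)

lemma open_chart_preimage: "c \<in> M \<Longrightarrow> open U \<Longrightarrow> open {p \<in> cdom c. cmap c p \<in> U}"
  using continuous_open_preimage[of "cdom c" "cmap c" U] chart_homeo[of c] chart_open(1)[of c]
  by (auto simp: homeomorphism_def vimage_def Int_def)

lemma smooth_transition:
  "c \<in> M \<Longrightarrow> d \<in> M \<Longrightarrow> smooth_on (cmap c ` (cdom c \<inter> cdom d)) (\<lambda>x. cmap d (cinv c x))"
  using smooth_manifold by (auto simp: smooth_manifold_def smooth_compat_def o_def)

lemma smooth_fun_subset: "smooth_fun M W f \<Longrightarrow> U \<subseteq> W \<Longrightarrow> smooth_fun M U f"
  unfolding smooth_fun_def by (blast intro: smooth_on_subset)

text \<open>Transition maps are smooth, so a single chart containing \<open>W\<close> decides for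
  all charts.\<close>

lemma smooth_fun_chartI:
  assumes c: "c \<in> M" and W: "open W" "W \<subseteq> cdom c"
    and f: "smooth_on (cmap c ` (cdom c \<inter> W)) (\<lambda>x. f (cinv c x))"
  shows "smooth_fun M W f"
  unfolding smooth_fun_def
proof
  fix d assume d: "d \<in> M"
  have "smooth_on (cmap d ` (cdom d \<inter> W)) (\<lambda>x. f (cinv c (cmap c (cinv d x))))"
  proof (rule smooth_on_compose[OF f])
    show "smooth_on (cmap d ` (cdom d \<inter> W)) (\<lambda>x. cmap c (cinv d x))"
      using W(2) by (intro smooth_on_subset[OF smooth_transition[OF d c]]) blast
    show "(\<lambda>x. cmap c (cinv d x)) ` cmap d ` (cdom d \<inter> W) \<subseteq> cmap c ` (cdom c \<inter> W)"
      using W c d by auto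
  qed (use c d W open_chart_image[OF c] open_chart_image[OF d] in auto)
  then show "smooth_on (cmap d ` (cdom d \<inter> W)) (f \<circ> cinv d)"
    by (rule smooth_on_cong) (use c d W open_chart_image[OF c] open_chart_image[OF d] in auto)
qed

lemma smooth_funD:
  "smooth_fun M W f \<Longrightarrow> c \<in> M \<Longrightarrow> smooth_on (cmap c ` (cdom c \<inter> W)) (\<lambda>x. f (cinv c x))"
  by (simp add: smooth_fun_def o_def)

lemma smooth_fun_local:
  assumes "\<And>p. p \<in> W \<Longrightarrow> f \<in> smooth_at M p"
  shows "smooth_fun M W f"
  unfolding smooth_fun_def
proof (intro ballI smooth_on_local)
  fix c x assume c: "c \<in> M" and x: "x \<in> cmap c ` (cdom c \<inter> W)"
  then have p: "cinv c x \<in> W" "x \<in> cimg c" by (simp_all add: mem_chart_image)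
  then obtain U where "open U" "cinv c x \<in> U" "smooth_fun M U f"
    using assms by (auto simp: smooth_at_def)
  then show "\<exists>U. open U \<and> x \<in> U \<and> smooth_on U (f \<circ> cinv c)"
    using c p by (intro exI[of _ "cmap c ` (cdom c \<inter> U)"])
      (auto simp: mem_chart_image open_chart_image o_def dest: smooth_funD)
qed

lemma smooth_fun_smooth_at: "smooth_fun M W f \<Longrightarrow> open W \<Longrightarrow> p \<in> W \<Longrightarrow> f \<in> smooth_at M p"
  by (auto simp: smooth_at_def)

text \<open>The neighbourhood is taken to be a ball because \<open>hadamard\<close> integrates along
  rays from the centre.\<close>

lemma smooth_at_chart:
  assumes c: "c \<in> M" and p: "p \<in> cdom c"
  shows "f \<in> smooth_at M p \<longleftrightarrow> (\<exists>r>0. ball (cmap c p) r \<subseteq> cimg c \<and> smooth_on (ball (cmap c p) r) (\<lambda>x. f (cinv c x)))"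
proof
  assume "f \<in> smooth_at M p"
  then obtain W where W: "open W" "p \<in> W" "smooth_fun M W f" by (auto simp: smooth_at_def)
  obtain r where "r > 0" "ball (cmap c p) r \<subseteq> cmap c ` (cdom c \<inter> W)"
    using open_chart_image[OF c W(1)] p W(2) openE by (metis IntI imageI)
  then show "\<exists>r>0. ball (cmap c p) r \<subseteq> cimg c \<and> smooth_on (ball (cmap c p) r) (\<lambda>x. f (cinv c x))"
    using smooth_funD[OF W(3) c] by (intro exI[of _ r]) (blast intro: smooth_on_subset)
next
  assume "\<exists>r>0. ball (cmap c p) r \<subseteq> cimg c \<and> smooth_on (ball (cmap c p) r) (\<lambda>x. f (cinv c x))"
  then obtain r where r: "r > 0" "ball (cmap c p) r \<subseteq> cimg c" "smooth_on (ball (cmap c p) r) (\<lambda>x. f (cinv c x))"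
    by auto
  let ?W = "{q \<in> cdom c. cmap c q \<in> ball (cmap c p) r}"
  have "smooth_fun M ?W f"
    by (rule smooth_fun_chartI[OF c open_chart_preimage[OF c open_ball]])
       (auto intro: smooth_on_subset[OF r(3)])
  then show "f \<in> smooth_at M p"
    using r p open_chart_preimage[OF c open_ball] by (intro smooth_fun_smooth_at[of ?W]) auto
qed

lemma smooth_at_cong:
  assumes "f \<in> smooth_at M p" "open W" "p \<in> W" "\<And>q. q \<in> W \<Longrightarrow> f q = g q"
  shows "g \<in> smooth_at M p"
proof -
  obtain U where U: "open U" "p \<in> U" "smooth_fun M U f" using assms(1) by (auto simp: smooth_at_def)
  have "smooth_fun M (U \<inter> W) g"
    unfolding smooth_fun_def
  proof
    fix c assume c: "c \<in> M"
    show "smooth_on (cmap c ` (cdom c \<inter> (U \<inter> W))) (g \<circ> cinv c)"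
      by (rule smooth_on_cong[OF smooth_on_subset[OF smooth_funD[OF U(3) c]]])
         (use c U assms open_chart_image[OF c open_Int[OF U(1) assms(2)]] in auto)
  qed
  then show ?thesis using U assms by (auto intro: smooth_fun_smooth_at)
qed

lemma smooth_at_const: "(\<lambda>q. a) \<in> smooth_at M p"
  by (auto simp: smooth_at_def smooth_fun_def o_def)

lemma smooth_fun_binop:
  assumes "\<And>S f g. open S \<Longrightarrow> smooth_on S f \<Longrightarrow> smooth_on S g \<Longrightarrow> smooth_on S (\<lambda>x::real^'n. m (f x) (g x))"
    and "open W" "smooth_fun M W f" "smooth_fun M W g"
  shows "smooth_fun M W (\<lambda>q. m (f q) (g q))"
  using assms open_chart_image by (auto simp: smooth_fun_def o_def)

lemma smooth_at_binop:
  assumes "\<And>S f g. open S \<Longrightarrow> smooth_on S f \<Longrightarrow> smooth_on S g \<Longrightarrow> smooth_on S (\<lambda>x::real^'n. m (f x) (g x))"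
    and "f \<in> smooth_at M p" "g \<in> smooth_at M p"
  shows "(\<lambda>q. m (f q) (g q)) \<in> smooth_at M p"
proof -
  obtain U W where U: "open U" "p \<in> U" "smooth_fun M U f" and W: "open W" "p \<in> W" "smooth_fun M W g"
    using assms by (auto simp: smooth_at_def)
  have "smooth_fun M (U \<inter> W) (\<lambda>q. m (f q) (g q))"
    using U W by (intro smooth_fun_binop[of m] assms(1)) (auto elim: smooth_fun_subset)
  then show ?thesis using U W by (auto intro: smooth_fun_smooth_at)
qed

lemma smooth_at_add: "f \<in> smooth_at M p \<Longrightarrow> g \<in> smooth_at M p \<Longrightarrow> (\<lambda>q. f q + g q) \<in> smooth_at M p"
  by (rule smooth_at_binop[OF smooth_on_add])

lemma smooth_at_mult: "f \<in> smooth_at M p \<Longrightarrow> g \<in> smooth_at M p \<Longrightarrow> (\<lambda>q. f q * g q) \<in> smooth_at M p"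
  by (rule smooth_at_binop[OF smooth_on_mult])

lemma smooth_at_diff: "f \<in> smooth_at M p \<Longrightarrow> g \<in> smooth_at M p \<Longrightarrow> (\<lambda>q. f q - g q) \<in> smooth_at M p"
  by (rule smooth_at_binop[OF smooth_on_diff])

lemma smooth_at_sum: "(\<And>i. i \<in> I \<Longrightarrow> f i \<in> smooth_at M p) \<Longrightarrow> (\<lambda>q. \<Sum>i\<in>I. f i q) \<in> smooth_at M p"
  by (induction I rule: infinite_finite_induct) (auto intro: smooth_at_const smooth_at_add)

lemma smooth_at_coord: "c \<in> M \<Longrightarrow> p \<in> cdom c \<Longrightarrow> (\<lambda>q. cmap c q $ i) \<in> smooth_at M p"
proof -
  assume c: "c \<in> M" and p: "p \<in> cdom c"
  have "smooth_on (cmap c ` (cdom c \<inter> cdom c)) (\<lambda>x. cmap c (cinv c x) $ i)"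
    by (rule smooth_on_cong[of _ "\<lambda>x. x $ i"])
       (use c chart_open(2)[OF c] smooth_on_vec_nth[OF _ smooth_on_ident] in auto)
  then have "smooth_fun M (cdom c) (\<lambda>q. cmap c q $ i)"
    using c chart_open by (intro smooth_fun_chartI[of c]) auto
  then show ?thesis using p chart_open(1)[OF c] by (auto intro: smooth_fun_smooth_at)
qed

lemma smooth_at_comp_chart:
  assumes "c \<in> M" "p \<in> cdom c" "smooth_on U F" "open U" "cmap c p \<in> U"
  shows "(\<lambda>q. F (cmap c q)) \<in> smooth_at M p"
proof -
  have "open (U \<inter> cimg c)" using assms chart_open by auto
  moreover have "cmap c p \<in> U \<inter> cimg c" using assms by auto
  ultimately obtain r where r: "r > 0" "ball (cmap c p) r \<subseteq> U \<inter> cimg c" using openE by metis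
  have "smooth_on (ball (cmap c p) r) (\<lambda>x. F (cmap c (cinv c x)))"
    by (rule smooth_on_cong[OF smooth_on_subset[OF assms(3)]]) (use r assms in auto)
  then show ?thesis using r assms by (auto simp: smooth_at_chart[of c])
qed

section \<open>Derivations: linearity, constants and locality\<close>

context
  fixes p v assumes v: "v \<in> tangent_space M p"
begin

lemma tangent_add: "f \<in> smooth_at M p \<Longrightarrow> g \<in> smooth_at M p \<Longrightarrow> v (\<lambda>q. f q + g q) = v f + v g"
  using v by (auto simp: tangent_space_def plus_fun_def)

lemma tangent_cmult: "f \<in> smooth_at M p \<Longrightarrow> v (\<lambda>q. a * f q) = a * v f"
  using v by (auto simp: tangent_space_def)

lemma tangent_mult:
  "f \<in> smooth_at M p \<Longrightarrow> g \<in> smooth_at M p \<Longrightarrow> v (\<lambda>q. f q * g q) = v f * g p + f p * v g"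
  using v by (auto simp: tangent_space_def times_fun_def)

lemma tangent_nonsmooth: "f \<notin> smooth_at M p \<Longrightarrow> v f = 0"
  using v by (auto simp: tangent_space_def)

lemma tangent_const: "v (\<lambda>q. a) = 0"
  using tangent_mult[of "\<lambda>_. 1" "\<lambda>_. 1"] tangent_cmult[of "\<lambda>_. 1" a] by (simp add: smooth_at_const)

lemma tangent_sum:
  "(\<And>i. i \<in> I \<Longrightarrow> f i \<in> smooth_at M p) \<Longrightarrow> v (\<lambda>q. \<Sum>i\<in>I. f i q) = (\<Sum>i\<in>I. v (f i))"
  by (induction I rule: infinite_finite_induct) (auto simp: tangent_const tangent_add smooth_at_sum)

lemma tangent_diff: "f \<in> smooth_at M p \<Longrightarrow> g \<in> smooth_at M p \<Longrightarrow> v (\<lambda>q. f q - g q) = v f - v g"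
  using tangent_add[of f "\<lambda>q. -1 * g q"] tangent_cmult[of g "-1"]
    smooth_at_mult[OF smooth_at_const, of g p "-1"] by simp

lemma tangent_cong:
  assumes "open W" "p \<in> W" "\<And>q. q \<in> W \<Longrightarrow> f q = g q"
  shows "v f = v g"
proof (cases "f \<in> smooth_at M p")
  case True
  then have g: "g \<in> smooth_at M p" using smooth_at_cong assms by blast
  \<comment> \<open>\<open>smooth_at\<close> only looks near \<open>p\<close>, where this indicator
    of the complement of \<open>W\<close> is constant, so the discontinuous \<open>h\<close> is a
    legitimate multiplier. Both \<open>h\<close> and f - g vanish at \<open>p\<close>, and the
    Leibniz rule annihilates their product.\<close>
  define h where "h q = (if q \<in> W then 0 else 1 :: real)" for q
  have h: "h \<in> smooth_at M p"
    using smooth_at_cong[OF smooth_at_const[of 0] assms(1,2), of h] by (simp add: h_def)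
  have "(\<lambda>q. f q - g q) = (\<lambda>q. h q * (f q - g q))"
    using assms by (auto simp: h_def)
  then have "v (\<lambda>q. f q - g q) = v (\<lambda>q. h q * (f q - g q))" by simp
  also have "\<dots> = 0"
    using tangent_mult[OF h smooth_at_diff[OF True g]] assms by (simp add: h_def)
  finally show ?thesis using tangent_diff[OF True g] by simp
next
  case False
  then have "g \<notin> smooth_at M p" using smooth_at_cong[of g p W f] assms by auto
  with False show ?thesis using tangent_nonsmooth by simp
qed

end

end

section \<open>Coordinates of tangent vectors\<close>

definition cvec :: "('m, 'n::finite) chart \<Rightarrow> 'm tvec \<Rightarrow> real ^ 'n" where
  "cvec c v = (\<chi> i. comp c v i)"

text \<open>The inverse of \<open>cvec\<close> at \<open>p\<close>. As a directional derivative it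
  inherits linearity and the derivation rules from \<open>dd\<close>; \<open>sum_coord_field\<close>
  identifies it with the sum of coordinate fields used by \<open>tparam\<close>.\<close>

definition tvec :: "('m::topological_space, 'n::finite) chart set \<Rightarrow> ('m, 'n) chart \<Rightarrow> 'm \<Rightarrow> real ^ 'n \<Rightarrow> 'm tvec" where
  "tvec M c p w = (\<lambda>f. if f \<in> smooth_at M p then dd w (\<lambda>x. f (cinv c x)) (cmap c p) else 0)"

lemma cvec_nth: "cvec c v $ i = comp c v i"
  by (simp add: cvec_def)

lemma cvec_add [simp]: "cvec c (u + v) = cvec c u + cvec c v"
  by (simp add: cvec_def vec_eq_iff comp_def)

lemma cvec_diff [simp]: "cvec c (u - v) = cvec c u - cvec c v"
  by (simp add: cvec_def vec_eq_iff comp_def fun_diff_def)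

lemma cvec_0 [simp]: "cvec c 0 = 0"
  by (simp add: cvec_def vec_eq_iff comp_def)

lemma cvec_scale [simp]: "cvec c (a *\<^sub>t v) = a *\<^sub>R cvec c v"
  by (simp add: cvec_def vec_eq_iff comp_def tscale_def)

lemma cvec_sum [simp]: "cvec c (\<Sum>i\<in>I. f i) = (\<Sum>i\<in>I. cvec c (f i))"
proof (induction I rule: infinite_finite_induct)
  case (insert x F)
  then show ?case by (metis sum.insert cvec_add)
qed (metis sum.infinite sum.empty cvec_0)+

context manifold begin

context
  fixes c p assumes c: "c \<in> M" and p: "p \<in> cdom c"
begin

lemma smooth_at_derivative:
  assumes "f \<in> smooth_at M p"
  shows "((\<lambda>x. f (cinv c x)) has_derivative (\<lambda>w. dd w (\<lambda>x. f (cinv c x)) (cmap c p))) (at (cmap c p))"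
proof -
  obtain r where "r > 0" "smooth_on (ball (cmap c p) r) (\<lambda>x. f (cinv c x))"
    using assms smooth_at_chart[OF c p] by auto
  then show ?thesis by (auto intro: smooth_on_has_derivative)
qed

lemma tvec_tangent: "tvec M c p w \<in> tangent_space M p"
  unfolding tangent_space_def
proof (intro CollectI conjI ballI allI impI)
  fix f g assume f: "f \<in> smooth_at M p" and g: "g \<in> smooth_at M p"
  note df = smooth_at_derivative[OF f] and dg = smooth_at_derivative[OF g]
  have "f + g \<in> smooth_at M p" "f * g \<in> smooth_at M p"
    using smooth_at_add[OF f g] smooth_at_mult[OF f g] by (simp_all add: plus_fun_def times_fun_def)
  then show "tvec M c p w (f + g) = tvec M c p w f + tvec M c p w g"
    "tvec M c p w (f * g) = tvec M c p w f * g p + f p * tvec M c p w g"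
    using f g dd_eqI[OF has_derivative_add[OF df dg]] dd_eqI[OF has_derivative_mult[OF df dg]] c p
    by (simp_all add: tvec_def)
next
  fix a f assume f: "f \<in> smooth_at M p"
  show "tvec M c p w (\<lambda>q. a * f q) = a * tvec M c p w f"
    using f smooth_at_mult[OF smooth_at_const f]
      dd_eqI[OF has_derivative_mult_right[OF smooth_at_derivative[OF f]]] by (simp add: tvec_def)
qed (simp add: tvec_def)

lemma cvec_tvec [simp]: "cvec c (tvec M c p w) = w"
proof -
  have "dd w (\<lambda>x. cmap c (cinv c x) $ i) (cmap c p) = w $ i" for i
  proof -
    have "dd w (\<lambda>x. cmap c (cinv c x) $ i) (cmap c p) = dd w (\<lambda>x. x $ i) (cmap c p)"
      using c p chart_open by (intro dd_cong[of "cimg c"]) auto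
    also have "\<dots> = w $ i"
      by (intro dd_eqI bounded_linear_imp_has_derivative bounded_linear_vec_nth)
    finally show ?thesis .
  qed
  then show ?thesis
    using smooth_at_coord[OF c p] by (simp add: vec_eq_iff cvec_def comp_def tvec_def)
qed

text \<open>By Hadamard's lemma, \<open>f\<close> is near \<open>p\<close> a constant plus products
  whose first factor is a coordinate difference vanishing at \<open>p\<close>. The Leibniz rule
  leaves the values of \<open>v\<close> on the coordinates, times the partial derivatives of
  \<open>f\<close>.\<close>

lemma tvec_cvec:
  assumes v: "v \<in> tangent_space M p"
  shows "tvec M c p (cvec c v) = v"
proof
  fix f
  show "tvec M c p (cvec c v) f = v f"
  proof (cases "f \<in> smooth_at M p")
    case f: True
    let ?F = "\<lambda>x. f (cinv c x)" and ?a = "cmap c p"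
    obtain r where r: "r > 0" "ball ?a r \<subseteq> cimg c" "smooth_on (ball ?a r) ?F"
      using f smooth_at_chart[OF c p] by auto
    obtain G where G: "\<And>b. smooth_on (ball ?a r) (G b)" "\<And>b. G b ?a = dd b ?F ?a"
      "\<And>x. x \<in> ball ?a r \<Longrightarrow> ?F x = ?F ?a + (\<Sum>b\<in>Basis. ((x - ?a) \<bullet> b) * G b x)"
      by (rule hadamard[OF r(3,1)]) blast
    have Gs: "(\<lambda>q. G b (cmap c q)) \<in> smooth_at M p" for b
      using smooth_at_comp_chart[OF c p G(1) open_ball] r by simp
    have xs: "(\<lambda>q. (cmap c q - ?a) $ i) \<in> smooth_at M p" for i
      using smooth_at_diff[OF smooth_at_coord[OF c p] smooth_at_const] by simp
    have "v f = v (\<lambda>q. f p + (\<Sum>i\<in>UNIV. (cmap c q - ?a) $ i * G (axis i 1) (cmap c q)))"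
    proof (rule tangent_cong[OF v, of "{q \<in> cdom c. cmap c q \<in> ball ?a r}"])
      fix q assume "q \<in> {q \<in> cdom c. cmap c q \<in> ball ?a r}"
      then show "f q = f p + (\<Sum>i\<in>UNIV. (cmap c q - ?a) $ i * G (axis i 1) (cmap c q))"
        using G(3)[of "cmap c q"] c p
        by (simp add: Basis_vec_def inner_axis UNION_singleton_eq_range sum.reindex inj_on_def axis_eq_axis)
    qed (use open_chart_preimage[OF c open_ball] p r in auto)
    also have "\<dots> = (\<Sum>i\<in>UNIV. v (\<lambda>q. (cmap c q - ?a) $ i * G (axis i 1) (cmap c q)))"
      using v by (simp add: tangent_add[OF v] tangent_sum[OF v] tangent_const[OF v]
          smooth_at_const smooth_at_sum smooth_at_mult[OF xs Gs] del: vector_minus_component)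
    also have "\<dots> = (\<Sum>i\<in>UNIV. comp c v i * dd (axis i 1) ?F ?a)"
    proof (rule sum.cong[OF refl])
      fix i
      have "v (\<lambda>q. (cmap c q - ?a) $ i) = comp c v i"
        using tangent_diff[OF v smooth_at_coord[OF c p] smooth_at_const] by (simp add: comp_def tangent_const[OF v])
      then show "v (\<lambda>q. (cmap c q - ?a) $ i * G (axis i 1) (cmap c q)) = comp c v i * dd (axis i 1) ?F ?a"
        using tangent_mult[OF v xs Gs] G(2) by simp
    qed
    also have "\<dots> = dd (cvec c v) ?F ?a"
    proof -
      interpret linear "\<lambda>w. dd w ?F ?a"
        using smooth_at_derivative[OF f] has_derivative_linear by blast
      have "cvec c v = (\<Sum>i\<in>UNIV. comp c v i *\<^sub>R axis i 1)"
        by (simp add: cvec_def vec_eq_iff axis_def if_distrib cong: if_cong)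
      then show ?thesis by (simp add: sum scale)
    qed
    finally show ?thesis using f by (simp add: tvec_def)
  next
    case False
    then show ?thesis using v by (simp add: tvec_def tangent_nonsmooth)
  qed
qed

lemma tangent_apply:
  assumes "v \<in> tangent_space M p" "f \<in> smooth_at M p"
  shows "v f = dd (cvec c v) (\<lambda>x. f (cinv c x)) (cmap c p)"
  using tvec_cvec[OF assms(1)] assms(2) by (metis tvec_def)

lemma cvec_eqD:
  assumes "u \<in> tangent_space M p" "v \<in> tangent_space M p" "cvec c u = cvec c v"
  shows "u = v"
  using tvec_cvec assms by metis

lemma tvec_linear: "tvec M c p (u + w) = tvec M c p u + tvec M c p w"
  "tvec M c p (a *\<^sub>R w) = a *\<^sub>t tvec M c p w" "tvec M c p 0 = 0"
proof -
  have lin: "linear (\<lambda>w. dd w (\<lambda>x. f (cinv c x)) (cmap c p))" if "f \<in> smooth_at M p" for f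
    using smooth_at_derivative[OF that] has_derivative_linear by blast
  show "tvec M c p (u + w) = tvec M c p u + tvec M c p w"
    "tvec M c p (a *\<^sub>R w) = a *\<^sub>t tvec M c p w" "tvec M c p 0 = 0"
    using linear_add[OF lin] linear_cmul[OF lin] linear_0[OF lin] by (auto simp: tvec_def tscale_def fun_eq_iff)
qed

lemma tvec_sum: "tvec M c p (\<Sum>i\<in>I. w i) = (\<Sum>i\<in>I. tvec M c p (w i))"
  by (induction I rule: infinite_finite_induct) (auto simp: tvec_linear)

lemma coord_field_eq: "coord_field M c i p = tvec M c p (axis i 1)"
proof
  fix f
  show "coord_field M c i p f = tvec M c p (axis i 1) f"
  proof (cases "f \<in> smooth_at M p")
    case True
    have "((\<lambda>t. cmap c p + t *\<^sub>R axis i 1) has_derivative (\<lambda>t. t *\<^sub>R axis i 1)) (at (0::real))"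
      by (auto intro!: derivative_eq_intros)
    from has_derivative_compose[OF this] smooth_at_derivative[OF True]
    have "((\<lambda>t. f (cinv c (cmap c p + t *\<^sub>R axis i 1))) has_derivative
        (\<lambda>t. dd (t *\<^sub>R axis i 1) (\<lambda>x. f (cinv c x)) (cmap c p))) (at 0)"
      by simp
    moreover have "dd (t *\<^sub>R axis i 1) (\<lambda>x. f (cinv c x)) (cmap c p) =
        dd (axis i 1) (\<lambda>x. f (cinv c x)) (cmap c p) * t" for t
      using linear_cmul[OF has_derivative_linear[OF smooth_at_derivative[OF True]]] by simp
    ultimately have "deriv (\<lambda>t. f (cinv c (cmap c p + t *\<^sub>R axis i 1))) 0 = dd (axis i 1) (\<lambda>x. f (cinv c x)) (cmap c p)"
      by (intro DERIV_imp_deriv) (simp add: has_field_derivative_def)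
    then show ?thesis using True by (simp add: coord_field_def tvec_def)
  qed (simp add: coord_field_def tvec_def)
qed

lemma sum_coord_field: "(\<Sum>i\<in>UNIV. (y $ i) *\<^sub>t coord_field M c i p) = tvec M c p y"
proof -
  have "y = (\<Sum>i\<in>UNIV. y $ i *\<^sub>R axis i 1)"
    by (simp add: vec_eq_iff axis_def if_distrib cong: if_cong)
  then have "tvec M c p y = tvec M c p (\<Sum>i\<in>UNIV. y $ i *\<^sub>R axis i 1)" by simp
  then show ?thesis by (simp only: coord_field_eq tvec_sum tvec_linear)
qed

end

end

section \<open>Bump functions and vector fields\<close>

text \<open>The powers of 1/t are included because the family is then closed under differentiation
  (\<open>flat_derivative\<close>), so that one induction over all \<open>n\<close> at once proves
  smoothness.\<close>

definition flat :: "nat \<Rightarrow> real \<Rightarrow> real" where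
  "flat n t = (if t > 0 then inverse t ^ n * exp (- inverse t) else 0)"

text \<open>From the right, the substitution s = 1/t turns the function into s^n / exp s with s
  tending to infinity.\<close>

lemma flat_tendsto: "(flat n \<longlongrightarrow> 0) (at 0)"
proof (rule filterlim_split_at)
  have "\<forall>\<^sub>F t in at_left 0. flat n t = 0"
    by (auto simp: flat_def eventually_at_filter)
  then show "(flat n \<longlongrightarrow> 0) (at_left 0)" by (rule tendsto_eventually)
  have "((\<lambda>t::real. inverse t ^ n / exp (inverse t)) \<longlongrightarrow> 0) (at_right 0)"
    using tendsto_power_div_exp_0 filterlim_inverse_at_top_right by (rule filterlim_compose)
  moreover have "\<forall>\<^sub>F t in at_right 0. inverse t ^ n / exp (inverse t) = flat n t"
    by (auto simp: flat_def eventually_at_filter exp_minus divide_inverse)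
  ultimately show "(flat n \<longlongrightarrow> 0) (at_right 0)" by (rule Lim_transform_eventually)
qed

lemma flat_derivative: "(flat n has_real_derivative (flat (n + 2) t - n * flat (n + 1) t)) (at t)"
proof (cases t "0 :: real" rule: linorder_cases)
  case less
  have "((\<lambda>_. 0) has_real_derivative (flat (n + 2) t - n * flat (n + 1) t)) (at t)"
    using less by (simp add: flat_def)
  then show ?thesis
    by (rule has_field_derivative_transform_within_open[where S = "{..<0}"]) (use less in \<open>auto simp: flat_def\<close>)
next
  case equal
  \<comment> \<open>At 0 the difference quotient of \<open>flat n\<close> is
    \<open>flat (Suc n)\<close> itself.\<close>
  have "\<forall>\<^sub>F h in at 0. flat (Suc n) h = (flat n (0 + h) - flat n 0) / h"
    by (auto simp: flat_def eventually_at_filter field_simps)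
  then have "((\<lambda>h. (flat n (0 + h) - flat n 0) / h) \<longlongrightarrow> 0) (at 0)"
    by (rule Lim_transform_eventually[OF flat_tendsto])
  then show ?thesis using equal by (simp add: DERIV_def flat_def)
next
  case greater
  define u where "u = inverse t"
  \<comment> \<open>The exponent of the power rule is truncated at n = 0, where the factor n
    vanishes.\<close>
  have n: "n * u ^ (n - 1) * (u * u) = n * (u ^ n * u)"
    by (cases n) auto
  have "n * u ^ (n - 1) * (- (u * u)) * exp (- u) + exp (- u) * (u * u) * u ^ n =
      - (n * u ^ (n - 1) * (u * u)) * exp (- u) + exp (- u) * (u * u) * u ^ n"
    by (simp only: mult_minus_left mult_minus_right)
  also have "\<dots> = flat (n + 2) t - n * flat (n + 1) t"
    unfolding n using greater by (simp add: flat_def u_def[symmetric] algebra_simps)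
  finally have e: "n * u ^ (n - 1) * (- (u * u)) * exp (- u) + exp (- u) * (u * u) * u ^ n =
      flat (n + 2) t - n * flat (n + 1) t" .
  have "((\<lambda>t. inverse t ^ n * exp (- inverse t)) has_real_derivative
      n * u ^ (n - 1) * (- (u * u)) * exp (- u) + exp (- u) * (u * u) * u ^ n) (at t)"
    using greater unfolding u_def by (auto intro!: derivative_eq_intros simp: power2_eq_square)
  then have "((\<lambda>t. inverse t ^ n * exp (- inverse t)) has_real_derivative (flat (n + 2) t - n * flat (n + 1) t)) (at t)"
    by (simp only: e)
  then show ?thesis
    by (rule has_field_derivative_transform_within_open[where S = "{0<..}"]) (use greater in \<open>auto simp: flat_def\<close>)
qed

lemma smooth_on_flat: "smooth_on UNIV (flat n)"
proof -
  have "Ck_on k UNIV (flat n)" for k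
  proof (induction k arbitrary: n)
    case 0
    show ?case
      using flat_derivative by (auto intro!: continuous_at_imp_continuous_on DERIV_isCont)
  next
    case (Suc k)
    have d: "(flat n has_derivative (\<lambda>v. v * (flat (n + 2) t - n * flat (n + 1) t))) (at t)" for t
      using flat_derivative[of n t] by (simp add: has_field_derivative_def mult_commute_abs)
    have "Ck_on k UNIV (\<lambda>t. v * (flat (n + 2) t + (- real n) * flat (n + 1) t))" for v
      by (intro Ck_on_bilinear[OF bounded_bilinear_mult] Ck_on_add Ck_on_const Suc.IH) auto
    then have "Ck_on k UNIV (\<lambda>t. v * (flat (n + 2) t - n * flat (n + 1) t))" for v by simp
    moreover have "dd v (flat n) = (\<lambda>t. v * (flat (n + 2) t - n * flat (n + 1) t))" for v
      using dd_eqI[OF d] by auto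
    ultimately have "Ck_on k UNIV (dd v (flat n))" for v by simp
    then show ?case using d by (auto simp: Ck_on_Suc intro: differentiableI)
  qed
  then show ?thesis by (simp add: smooth_on_def)
qed

text \<open>A quotient u / (u + w) with u positive exactly inside the radius r and w positive
  exactly outside the radius r/2; these regions cover the space, so the denominator never vanishes.
  Squared distances are used because they are smooth at the centre too.\<close>

lemma euclidean_bump:
  fixes a :: "'e::euclidean_space"
  assumes "r > 0"
  obtains \<rho> :: "'e \<Rightarrow> real" where "smooth_on UNIV \<rho>" "\<And>x. x \<in> ball a (r / 2) \<Longrightarrow> \<rho> x = 1"
    "\<And>x. x \<notin> cball a r \<Longrightarrow> \<rho> x = 0"
proof
  define q where "q x = (x - a) \<bullet> (x - a)" for x
  let ?u = "\<lambda>x. flat 0 (r\<^sup>2 - q x)" and ?w = "\<lambda>x. flat 0 (q x - (r / 2)\<^sup>2)"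
  let ?\<rho> = "\<lambda>x. ?u x / (?u x + ?w x)"
  have q_dist: "q x = (dist a x)\<^sup>2" for x
    by (simp add: q_def dist_norm dot_square_norm norm_minus_commute)
  have q: "smooth_on UNIV q"
    unfolding q_def smooth_on_def
    by (intro allI Ck_on_bilinear[OF bounded_bilinear_inner])
       (use smooth_on_diff[OF open_UNIV smooth_on_ident smooth_on_const] in \<open>auto simp: smooth_on_def\<close>)
  have r2: "(r / 2)\<^sup>2 < r\<^sup>2" using assms by (simp add: power2_eq_square)
  have pos: "?u x + ?w x \<noteq> 0" for x
  proof -
    have nonneg: "flat 0 s \<ge> 0" for s by (simp add: flat_def)
    have "?u x > 0 \<or> ?w x > 0"
      using r2 by (auto simp: flat_def)
    then show ?thesis using nonneg[of "r\<^sup>2 - q x"] nonneg[of "q x - (r / 2)\<^sup>2"] by linarith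
  qed
  show "smooth_on UNIV ?\<rho>"
    by (intro smooth_on_divide smooth_on_add smooth_on_compose[OF smooth_on_flat] smooth_on_diff
        smooth_on_const q open_UNIV) (use pos in auto)
  show "?\<rho> x = 1" if "x \<in> ball a (r / 2)" for x
  proof -
    have "q x < (r / 2)\<^sup>2"
      using that assms unfolding q_dist by (intro power_strict_mono) auto
    then have "?w x = 0" by (simp add: flat_def)
    then show ?thesis using pos[of x] by simp
  qed
  show "?\<rho> x = 0" if "x \<notin> cball a r" for x
  proof -
    have "r\<^sup>2 < q x"
      using that assms unfolding q_dist by (intro power_strict_mono) auto
    then show ?thesis by (simp add: flat_def)
  qed
qed

context manifold begin

text \<open>\<open>K\<close> is the image of a compact ball and hence closed, the manifold being
  Hausdorff. Its complement is thus an open set on which \<open>h\<close> is zero, and the extension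
  by zero is smooth at every point.\<close>

lemma bump:
  assumes c: "c \<in> M" and p: "p \<in> cdom c" "p \<in> \<Omega>" and \<Omega>: "open \<Omega>"
  obtains h K U where "\<And>q. h \<in> smooth_at M q" "closed K" "K \<subseteq> cdom c \<inter> \<Omega>" "\<And>q. q \<notin> K \<Longrightarrow> h q = (0::real)"
    "open U" "p \<in> U" "U \<subseteq> K" "\<And>q. q \<in> U \<Longrightarrow> h q = 1"
proof -
  let ?a = "cmap c p"
  obtain r where r: "r > 0" "cball ?a r \<subseteq> cmap c ` (cdom c \<inter> \<Omega>)"
    using open_chart_image[OF c \<Omega>] p open_contains_cball by (metis IntI imageI)
  obtain \<rho> :: "real ^ 'n \<Rightarrow> real" where \<rho>: "smooth_on UNIV \<rho>" "\<And>x. x \<in> ball ?a (r / 2) \<Longrightarrow> \<rho> x = 1"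
    "\<And>x. x \<notin> cball ?a r \<Longrightarrow> \<rho> x = 0"
    using euclidean_bump[OF r(1)] by blast
  define h where "h q = (if q \<in> cdom c then \<rho> (cmap c q) else 0)" for q
  let ?K = "cinv c ` cball ?a r" and ?U = "{q \<in> cdom c. cmap c q \<in> ball ?a (r / 2)}"
  have "continuous_on (cball ?a r) (cinv c)"
    using chart_homeo[OF c] r(2) by (auto simp: homeomorphism_def elim!: continuous_on_subset)
  then have K: "closed ?K"
    using compact_continuous_image compact_cball compact_imp_closed by blast
  have Ksub: "?K \<subseteq> cdom c \<inter> \<Omega>" using r(2) c by auto
  have h0: "h q = 0" if "q \<notin> ?K" for q
  proof (cases "q \<in> cdom c")
    case True
    then have "cmap c q \<notin> cball ?a r" using that cinv_cmap[OF c True] by (metis imageI)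
    then show ?thesis using \<rho>(3) by (simp add: h_def)
  qed (simp add: h_def)
  show ?thesis
  proof
    show "h \<in> smooth_at M q" for q
    proof (cases "q \<in> cdom c")
      case True
      show ?thesis
        by (rule smooth_at_cong[OF smooth_at_comp_chart[OF c True \<rho>(1)] chart_open(1)[OF c] True])
           (auto simp: h_def)
    next
      case False
      then show ?thesis
        using K Ksub h0 by (intro smooth_at_cong[OF smooth_at_const[of 0], of "- ?K"]) (auto simp: open_Compl)
    qed
    show "?U \<subseteq> ?K"
    proof
      fix q assume "q \<in> ?U"
      then have "q = cinv c (cmap c q)" "cmap c q \<in> cball ?a r" using c r(1) by auto
      then show "q \<in> ?K" by blast
    qed
    show "open ?U" by (rule open_chart_preimage[OF c open_ball])
    show "p \<in> ?U" using p r by simp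
    show "h q = 1" if "q \<in> ?U" for q using that \<rho>(2) by (simp add: h_def)
  qed (use K Ksub h0 in auto)
qed

section \<open>Smooth vector fields and the Lie bracket\<close>

lemma tangent_space_add: "u \<in> tangent_space M p \<Longrightarrow> v \<in> tangent_space M p \<Longrightarrow> u + v \<in> tangent_space M p"
proof -
  assume uv: "u \<in> tangent_space M p" "v \<in> tangent_space M p"
  obtain c where c: "c \<in> M" "p \<in> cdom c" using ex_chart by blast
  have "u + v = tvec M c p (cvec c u + cvec c v)"
    using tvec_cvec[OF c] uv by (simp only: tvec_linear[OF c])
  then show ?thesis using tvec_tangent[OF c] by simp
qed

lemma tangent_space_scale: "u \<in> tangent_space M p \<Longrightarrow> a *\<^sub>t u \<in> tangent_space M p"
proof -
  assume u: "u \<in> tangent_space M p"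
  obtain c where c: "c \<in> M" "p \<in> cdom c" using ex_chart by blast
  have "a *\<^sub>t u = tvec M c p (a *\<^sub>R cvec c u)"
    using tvec_cvec[OF c] u by (simp only: tvec_linear[OF c])
  then show ?thesis using tvec_tangent[OF c] by simp
qed

text \<open>Near \<open>p\<close>, \<open>X\<close> applied to \<open>f\<close> is the sum of its
  components times the partial derivatives of \<open>f\<close>. With a coordinate of another chart
  as \<open>f\<close> this is the transformation of components, which is why
  \<open>vector_fieldsI\<close> asks for one chart per point only.\<close>

lemma field_apply_smooth:
  assumes c: "c \<in> M" "p \<in> cdom c" and W: "open W" "p \<in> W" "\<And>q. q \<in> W \<Longrightarrow> X q \<in> tangent_space M q"
    and X: "\<And>i. (\<lambda>q. comp c (X q) i) \<in> smooth_at M p" and f: "f \<in> smooth_at M p"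
  shows "(\<lambda>q. X q f) \<in> smooth_at M p"
proof -
  obtain r where r: "r > 0" "ball (cmap c p) r \<subseteq> cimg c" "smooth_on (ball (cmap c p) r) (\<lambda>x. f (cinv c x))"
    using f smooth_at_chart[OF c] by auto
  obtain U where U: "open U" "p \<in> U" "smooth_fun M U f" using f by (auto simp: smooth_at_def)
  let ?W = "{q \<in> cdom c. cmap c q \<in> ball (cmap c p) r} \<inter> W \<inter> U"
  have "(\<lambda>q. \<Sum>j\<in>UNIV. comp c (X q) j * dd (axis j 1) (\<lambda>x. f (cinv c x)) (cmap c q)) \<in> smooth_at M p"
    using smooth_at_comp_chart[OF c smooth_on_dd[OF r(3)] open_ball] r(1)
    by (intro smooth_at_sum smooth_at_mult X) auto
  then show ?thesis
  proof (rule smooth_at_cong[where W = ?W])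
    show "open ?W" using open_chart_preimage[OF c(1) open_ball] W U by auto
    show "p \<in> ?W" using c r W U by auto
    fix q assume q: "q \<in> ?W"
    then have fq: "f \<in> smooth_at M q" using U by (auto intro: smooth_fun_smooth_at)
    interpret linear "\<lambda>w. dd w (\<lambda>x. f (cinv c x)) (cmap c q)"
      using smooth_at_derivative[OF c(1) _ fq] q has_derivative_linear by blast
    have "cvec c (X q) = (\<Sum>j\<in>UNIV. comp c (X q) j *\<^sub>R axis j 1)"
      by (simp add: cvec_def vec_eq_iff axis_def if_distrib cong: if_cong)
    then have "dd (cvec c (X q)) (\<lambda>x. f (cinv c x)) (cmap c q) =
        (\<Sum>j\<in>UNIV. comp c (X q) j * dd (axis j 1) (\<lambda>x. f (cinv c x)) (cmap c q))"
      by (simp add: sum scale)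
    then show "(\<Sum>j\<in>UNIV. comp c (X q) j * dd (axis j 1) (\<lambda>x. f (cinv c x)) (cmap c q)) = X q f"
      using tangent_apply[OF c(1) _ W(3) fq] q by simp
  qed
qed

lemma vf_tangent: "X \<in> vector_fields M \<Omega> \<Longrightarrow> p \<in> \<Omega> \<Longrightarrow> X p \<in> tangent_space M p"
  by (simp add: vector_fields_def)

lemma vf_comp:
  assumes "X \<in> vector_fields M \<Omega>" "open \<Omega>" "p \<in> \<Omega>" "c \<in> M" "p \<in> cdom c"
  shows "(\<lambda>q. comp c (X q) i) \<in> smooth_at M p"
  using assms chart_open(1)[OF assms(4)]
  by (intro smooth_fun_smooth_at[of "\<Omega> \<inter> cdom c"]) (auto simp: vector_fields_def)

lemma vector_fieldsI:
  assumes \<Omega>: "open \<Omega>" and t: "\<And>p. p \<in> \<Omega> \<Longrightarrow> X p \<in> tangent_space M p"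
    and s: "\<And>p. p \<in> \<Omega> \<Longrightarrow> \<exists>c\<in>M. p \<in> cdom c \<and> (\<forall>i. (\<lambda>q. comp c (X q) i) \<in> smooth_at M p)"
  shows "X \<in> vector_fields M \<Omega>"
  unfolding vector_fields_def
proof (intro CollectI conjI ballI allI smooth_fun_local)
  fix d i p assume d: "d \<in> M" and p: "p \<in> \<Omega> \<inter> cdom d"
  then obtain c where c: "c \<in> M" "p \<in> cdom c" "\<And>i. (\<lambda>q. comp c (X q) i) \<in> smooth_at M p"
    using s[of p] by auto
  show "(\<lambda>q. comp d (X q) i) \<in> smooth_at M p"
    unfolding comp_def
    by (rule field_apply_smooth[OF c(1,2) \<Omega> _ t c(3) smooth_at_coord]) (use p d in auto)
qed (use t in auto)

lemma vf_apply_smooth: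
  assumes "X \<in> vector_fields M \<Omega>" "open \<Omega>" "p \<in> \<Omega>" "f \<in> smooth_at M p"
  shows "(\<lambda>q. X q f) \<in> smooth_at M p"
proof -
  obtain c where c: "c \<in> M" "p \<in> cdom c" using ex_chart by blast
  show ?thesis
    by (rule field_apply_smooth[OF c assms(2,3) vf_tangent[OF assms(1)] vf_comp[OF assms(1-3) c] assms(4)])
qed

lemma vf_subset: "X \<in> vector_fields M \<Omega> \<Longrightarrow> W \<subseteq> \<Omega> \<Longrightarrow> X \<in> vector_fields M W"
  unfolding vector_fields_def
  using smooth_fun_subset[of "\<Omega> \<inter> cdom _" _ "W \<inter> cdom _"] by blast

lemma vf_add:
  assumes "X \<in> vector_fields M \<Omega>" "Y \<in> vector_fields M \<Omega>" "open \<Omega>"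
  shows "X + Y \<in> vector_fields M \<Omega>"
proof (rule vector_fieldsI[OF assms(3)])
  fix p assume p: "p \<in> \<Omega>"
  then show "(X + Y) p \<in> tangent_space M p"
    using vf_tangent[OF assms(1)] vf_tangent[OF assms(2)] tangent_space_add by (simp only: plus_fun_apply)
  obtain c where c: "c \<in> M" "p \<in> cdom c" using ex_chart by blast
  then show "\<exists>c\<in>M. p \<in> cdom c \<and> (\<forall>i. (\<lambda>q. comp c ((X + Y) q) i) \<in> smooth_at M p)"
    using smooth_at_add[OF vf_comp[OF assms(1,3) p c] vf_comp[OF assms(2,3) p c]]
    by (intro bexI[of _ c]) (simp_all add: comp_def)
qed

lemma vf_scale:
  assumes "X \<in> vector_fields M \<Omega>" "\<And>p. p \<in> \<Omega> \<Longrightarrow> h \<in> smooth_at M p" "open \<Omega>"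
  shows "h *\<^sub>f X \<in> vector_fields M \<Omega>"
proof (rule vector_fieldsI[OF assms(3)])
  fix p assume p: "p \<in> \<Omega>"
  then show "(h *\<^sub>f X) p \<in> tangent_space M p"
    using vf_tangent[OF assms(1)] tangent_space_scale by (simp add: vfscale_def)
  obtain c where c: "c \<in> M" "p \<in> cdom c" using ex_chart by blast
  then show "\<exists>c\<in>M. p \<in> cdom c \<and> (\<forall>i. (\<lambda>q. comp c ((h *\<^sub>f X) q) i) \<in> smooth_at M p)"
    using smooth_at_mult[OF assms(2)[OF p] vf_comp[OF assms(1,3) p c]]
    by (intro bexI[of _ c]) (simp_all add: comp_def vfscale_def tscale_def)
qed

lemma vf_zero: "open \<Omega> \<Longrightarrow> 0 \<in> vector_fields M \<Omega>"
proof (rule vector_fieldsI)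
  fix p assume "p \<in> \<Omega>"
  obtain c where c: "c \<in> M" "p \<in> cdom c" using ex_chart by blast
  show "(0::'m vfield) p \<in> tangent_space M p"
    using tvec_tangent[OF c, of 0] tvec_linear(3)[OF c] by (simp only: zero_fun_apply)
  show "\<exists>c\<in>M. p \<in> cdom c \<and> (\<forall>i. (\<lambda>q. comp c ((0::'m vfield) q) i) \<in> smooth_at M p)"
    using c smooth_at_const[of 0] by (intro bexI[of _ c]) (simp_all add: comp_def)
qed

lemma vf_sum:
  assumes "\<And>i. i \<in> I \<Longrightarrow> X i \<in> vector_fields M \<Omega>" "open \<Omega>"
  shows "(\<Sum>i\<in>I. X i) \<in> vector_fields M \<Omega>"
  using assms(1)
proof (induction I rule: infinite_finite_induct)
  case (insert i I)
  then show ?case using vf_add[OF _ _ assms(2)] by (metis insertCI sum.insert)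
qed (metis sum.infinite sum.empty vf_zero[OF assms(2)])+

definition xrep :: "('m, 'n) chart \<Rightarrow> 'm vfield \<Rightarrow> real ^ 'n \<Rightarrow> real ^ 'n" where
  "xrep c X x = cvec c (X (cinv c x))"

lemma xrep_smooth:
  assumes "X \<in> vector_fields M \<Omega>" "c \<in> M" "open \<Omega>"
  shows "smooth_on (cmap c ` (cdom c \<inter> \<Omega>)) (xrep c X)"
proof -
  have "smooth_fun M (\<Omega> \<inter> cdom c) (\<lambda>p. comp c (X p) i)" for i
    using assms by (auto simp: vector_fields_def)
  moreover have "cdom c \<inter> (\<Omega> \<inter> cdom c) = cdom c \<inter> \<Omega>" by blast
  ultimately have "smooth_on (cmap c ` (cdom c \<inter> \<Omega>)) (\<lambda>x. comp c (X (cinv c x)) i)" for i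
    using smooth_funD[OF _ assms(2), of "\<Omega> \<inter> cdom c" "\<lambda>p. comp c (X p) i" for i] by simp
  then
  have "smooth_on (cmap c ` (cdom c \<inter> \<Omega>)) (\<lambda>x. xrep c X x $ i)" for i
    by (simp add: xrep_def cvec_def)
  then show ?thesis
    using smooth_on_vec_iff[OF open_chart_image[OF assms(2,3)]] by blast
qed

lemma xrep_cmap [simp]: "c \<in> M \<Longrightarrow> p \<in> cdom c \<Longrightarrow> xrep c X (cmap c p) = cvec c (X p)"
  by (simp add: xrep_def)

lemma tangent_apply_comp:
  assumes c: "c \<in> M" "p \<in> cdom c" and v: "v \<in> tangent_space M p"
    and Y: "Y \<in> vector_fields M \<Omega>" "p \<in> \<Omega>" "open \<Omega>"
  shows "v (\<lambda>q. comp c (Y q) i) = dd (cvec c v) (xrep c Y) (cmap c p) $ i"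
proof -
  have "cmap c p \<in> cmap c ` (cdom c \<inter> \<Omega>)" using c Y by auto
  then have "(xrep c Y has_derivative (\<lambda>w. dd w (xrep c Y) (cmap c p))) (at (cmap c p))"
    using xrep_smooth[OF Y(1) c(1) Y(3)] smooth_on_has_derivative by blast
  then have "((\<lambda>x. xrep c Y x $ i) has_derivative (\<lambda>w. dd w (xrep c Y) (cmap c p) $ i)) (at (cmap c p))"
    by (rule bounded_linear.has_derivative[OF bounded_linear_vec_nth])
  then show ?thesis
    using tangent_apply[OF c v vf_comp[OF Y(1,3,2) c]] by (simp add: dd_eqI xrep_def cvec_def)
qed

lemma smooth_at_vec_chart:
  assumes c: "c \<in> M" "p \<in> cdom c" and W: "open W" "p \<in> W"
    and F: "smooth_on (cmap c ` (cdom c \<inter> W)) F" "\<And>q. q \<in> W \<Longrightarrow> q \<in> cdom c \<Longrightarrow> f q = F (cmap c q)"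
  shows "f \<in> smooth_at M p"
proof (rule smooth_at_cong)
  show "(\<lambda>q. F (cmap c q)) \<in> smooth_at M p"
    by (rule smooth_at_comp_chart[OF c F(1) open_chart_image]) (use c W in auto)
  show "open (W \<inter> cdom c)" using W chart_open(1)[OF c(1)] by auto
qed (use c W F(2) in auto)

text \<open>A composition of two fields is a second-order operator; antisymmetrizing removes exactly
  the terms that violate the Leibniz rule.\<close>

lemma lie_bracket_vf:
  assumes X: "X \<in> vector_fields M \<Omega>" and Y: "Y \<in> vector_fields M \<Omega>" and \<Omega>: "open \<Omega>"
  shows "lie_bracket M X Y \<in> vector_fields M \<Omega>"
proof (rule vector_fieldsI[OF \<Omega>])
  fix p assume p: "p \<in> \<Omega>"
  have smooth: "(\<lambda>q. Z q f) \<in> smooth_at M p" if "Z \<in> vector_fields M \<Omega>" "f \<in> smooth_at M p" for Z f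
    using that p \<Omega> vf_apply_smooth by blast
  \<comment> \<open>The inner field acts at all \<open>q\<close> near \<open>p\<close>, so its
    derivation rules require smoothness of the functions at these \<open>q\<close> as well.\<close>
  have near: "\<exists>W. open W \<and> p \<in> W \<and> W \<subseteq> \<Omega> \<and> (\<forall>q\<in>W. f \<in> smooth_at M q \<and> g \<in> smooth_at M q)"
    if f: "f \<in> smooth_at M p" and g: "g \<in> smooth_at M p" for f g
  proof -
    obtain U where "open U" "p \<in> U" "smooth_fun M U f"
      using f by (auto simp: smooth_at_def)
    moreover obtain W where "open W" "p \<in> W" "smooth_fun M W g"
      using g by (auto simp: smooth_at_def)
    ultimately show ?thesis
      using p \<Omega> by (intro exI[of _ "U \<inter> W \<inter> \<Omega>"]) (auto intro: smooth_fun_smooth_at)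
  qed
  show "lie_bracket M X Y p \<in> tangent_space M p"
    unfolding tangent_space_def
  proof (intro CollectI conjI ballI allI impI)
    fix f g assume f: "f \<in> smooth_at M p" and g: "g \<in> smooth_at M p"
    obtain W where W: "open W" "p \<in> W" "W \<subseteq> \<Omega>" "\<And>q. q \<in> W \<Longrightarrow> f \<in> smooth_at M q" "\<And>q. q \<in> W \<Longrightarrow> g \<in> smooth_at M q"
      using near[OF f g] by blast
    have fg: "(\<lambda>q. f q + g q) \<in> smooth_at M p" "(\<lambda>q. f q * g q) \<in> smooth_at M p"
      using f g by (simp_all add: smooth_at_add smooth_at_mult)
    have add: "Z p (\<lambda>q. T q (\<lambda>q. f q + g q)) = Z p (\<lambda>q. T q f) + Z p (\<lambda>q. T q g)"
      if Z: "Z \<in> vector_fields M \<Omega>" and T: "T \<in> vector_fields M \<Omega>" for Z T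
    proof -
      have "Z p (\<lambda>q. T q (\<lambda>q. f q + g q)) = Z p (\<lambda>q. T q f + T q g)"
        using W tangent_add[OF vf_tangent[OF T]] by (intro tangent_cong[OF vf_tangent[OF Z p] W(1,2)]) auto
      then show ?thesis using tangent_add[OF vf_tangent[OF Z p] smooth[OF T f] smooth[OF T g]] by simp
    qed
    \<comment> \<open>The two mixed terms \<open>T p f * Z p g\<close> and
      \<open>Z p f * T p g\<close> are interchanged by swapping \<open>Z\<close> and
      \<open>T\<close>, and so cancel in the bracket.\<close>
    have mult: "Z p (\<lambda>q. T q (\<lambda>q. f q * g q)) =
        (Z p (\<lambda>q. T q f) * g p + T p f * Z p g) + (Z p f * T p g + f p * Z p (\<lambda>q. T q g))"
      if Z: "Z \<in> vector_fields M \<Omega>" and T: "T \<in> vector_fields M \<Omega>" for Z T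
    proof -
      note z = vf_tangent[OF Z p]
      have "Z p (\<lambda>q. T q (\<lambda>q. f q * g q)) = Z p (\<lambda>q. T q f * g q + f q * T q g)"
        using W tangent_mult[OF vf_tangent[OF T]] by (intro tangent_cong[OF z W(1,2)]) auto
      then show ?thesis
        using tangent_add[OF z smooth_at_mult[OF smooth[OF T f] g] smooth_at_mult[OF f smooth[OF T g]]]
          tangent_mult[OF z smooth[OF T f] g] tangent_mult[OF z f smooth[OF T g]] by simp
    qed
    show "lie_bracket M X Y p (f + g) = lie_bracket M X Y p f + lie_bracket M X Y p g"
      using f g fg add[OF X Y] add[OF Y X] by (simp add: lie_bracket_def plus_fun_def)
    show "lie_bracket M X Y p (f * g) = lie_bracket M X Y p f * g p + f p * lie_bracket M X Y p g"
      using f g fg mult[OF X Y] mult[OF Y X] by (simp add: lie_bracket_def times_fun_def algebra_simps)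
  next
    fix a f assume f: "f \<in> smooth_at M p"
    obtain W where W: "open W" "p \<in> W" "W \<subseteq> \<Omega>" "\<And>q. q \<in> W \<Longrightarrow> f \<in> smooth_at M q"
      using near[OF f f] by blast
    have "Z p (\<lambda>q. T q (\<lambda>q. a * f q)) = a * Z p (\<lambda>q. T q f)"
      if Z: "Z \<in> vector_fields M \<Omega>" and T: "T \<in> vector_fields M \<Omega>" for Z T
    proof -
      have "Z p (\<lambda>q. T q (\<lambda>q. a * f q)) = Z p (\<lambda>q. a * T q f)"
        using W tangent_cmult[OF vf_tangent[OF T]] by (intro tangent_cong[OF vf_tangent[OF Z p] W(1,2)]) auto
      then show ?thesis using tangent_cmult[OF vf_tangent[OF Z p] smooth[OF T f]] by simp
    qed
    then show "lie_bracket M X Y p (\<lambda>q. a * f q) = a * lie_bracket M X Y p f"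
      using f X Y smooth_at_mult[OF smooth_at_const f] by (simp add: lie_bracket_def algebra_simps)
  qed (simp add: lie_bracket_def)
  obtain c where c: "c \<in> M" "p \<in> cdom c" using ex_chart by blast
  have "(\<lambda>q. comp c (lie_bracket M X Y q) i) \<in> smooth_at M p" for i
  proof (rule smooth_at_cong)
    show "(\<lambda>q. X q (\<lambda>q. comp c (Y q) i) - Y q (\<lambda>q. comp c (X q) i)) \<in> smooth_at M p"
      by (rule smooth_at_diff[OF smooth[OF X vf_comp[OF Y \<Omega> p c]] smooth[OF Y vf_comp[OF X \<Omega> p c]]])
    show "open (\<Omega> \<inter> cdom c)" using \<Omega> chart_open(1)[OF c(1)] by auto
  qed (use p c smooth_at_coord[OF c(1)] in \<open>auto simp: comp_def lie_bracket_def\<close>)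
  then show "\<exists>c\<in>M. p \<in> cdom c \<and> (\<forall>i. (\<lambda>q. comp c (lie_bracket M X Y q) i) \<in> smooth_at M p)"
    using c by blast
qed

lemma cvec_lie_bracket:
  assumes c: "c \<in> M" "p \<in> cdom c" and X: "X \<in> vector_fields M \<Omega>" and Y: "Y \<in> vector_fields M \<Omega>"
    and \<Omega>: "p \<in> \<Omega>" "open \<Omega>"
  shows "cvec c (lie_bracket M X Y p) =
    dd (cvec c (X p)) (xrep c Y) (cmap c p) - dd (cvec c (Y p)) (xrep c X) (cmap c p)"
proof -
  have "comp c (lie_bracket M X Y p) i = X p (\<lambda>q. comp c (Y q) i) - Y p (\<lambda>q. comp c (X q) i)" for i
    using smooth_at_coord[OF c] by (simp add: comp_def lie_bracket_def)
  then show ?thesis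
    using tangent_apply_comp[OF c vf_tangent[OF X \<Omega>(1)] Y \<Omega>] tangent_apply_comp[OF c vf_tangent[OF Y \<Omega>(1)] X \<Omega>]
    by (simp add: vec_eq_iff cvec_nth)
qed

end

section \<open>The Chern connection coefficients of a Finsler function on a coordinate domain\<close>

lemma vec_axis_expansion: "(\<Sum>i\<in>UNIV. u $ i *\<^sub>R axis i 1) = (u :: real ^ 'n::finite)"
  by (simp add: vec_eq_iff axis_def if_distrib cong: if_cong)

lemma linear_axis_expansion:
  fixes F :: "real ^ 'n::finite \<Rightarrow> 'b::real_vector"
  assumes "linear F"
  shows "F u = (\<Sum>i\<in>UNIV. u $ i *\<^sub>R F (axis i 1))"
proof -
  have "F u = F (\<Sum>i\<in>UNIV. u $ i *\<^sub>R axis i 1)" by (simp only: vec_axis_expansion)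
  then show ?thesis using assms by (simp only: linear_sum linear_cmul)
qed

lemma smooth_on_linear_apply:
  fixes F :: "'e::euclidean_space \<Rightarrow> real ^ 'n::finite \<Rightarrow> 'b::real_normed_vector"
  assumes "open T" "\<And>z. z \<in> T \<Longrightarrow> linear (F z)" "\<And>i. smooth_on T (\<lambda>z. F z (axis i 1))" "smooth_on T u"
  shows "smooth_on T (\<lambda>z. F z (u z))"
proof (rule smooth_on_cong)
  show "smooth_on T (\<lambda>z. \<Sum>i\<in>UNIV. u z $ i *\<^sub>R F z (axis i 1))"
    by (intro smooth_on_sum smooth_on_scaleR smooth_on_vec_nth assms)
qed (use assms(1) linear_axis_expansion[OF assms(2)] in auto)

text \<open>Common setting for the metric \<open>g\<close> and the connection coefficients
  \<open>G\<close>, both of which will be evaluated at a moving point (x, V x) and on moving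
  vectors.\<close>

locale smooth_bilinear_field =
  fixes T :: "'z::euclidean_space set"
    and B :: "'z \<Rightarrow> real ^ 'n::finite \<Rightarrow> real ^ 'n \<Rightarrow> 'b::real_normed_vector"
  assumes open_domain: "open T"
    and linear_left: "\<And>z b. z \<in> T \<Longrightarrow> linear (\<lambda>a. B z a b)"
    and linear_right: "\<And>z a. z \<in> T \<Longrightarrow> linear (\<lambda>b. B z a b)"
    and smooth_coeff: "\<And>a b. smooth_on T (\<lambda>z. B z a b)"
begin

lemma expansion:
  assumes "z \<in> T"
  shows "B z a b = (\<Sum>j\<in>UNIV. \<Sum>k\<in>UNIV. (a $ j * b $ k) *\<^sub>R B z (axis j 1) (axis k 1))"
proof -
  have "B z a b = (\<Sum>j\<in>UNIV. a $ j *\<^sub>R B z (axis j 1) b)"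
    by (rule linear_axis_expansion[OF linear_left[OF assms]])
  also have "\<dots> = (\<Sum>j\<in>UNIV. a $ j *\<^sub>R (\<Sum>k\<in>UNIV. b $ k *\<^sub>R B z (axis j 1) (axis k 1)))"
    using linear_axis_expansion[OF linear_right[OF assms]] by metis
  finally show ?thesis by (simp add: scaleR_sum_right)
qed

lemma dd_expansion:
  assumes z: "z \<in> T"
  shows "dd v (\<lambda>z. B z a b) z = (\<Sum>j\<in>UNIV. \<Sum>k\<in>UNIV. (a $ j * b $ k) *\<^sub>R dd v (\<lambda>z. B z (axis j 1) (axis k 1)) z)"
proof -
  have "dd v (\<lambda>z. B z a b) z = dd v (\<lambda>z. \<Sum>j\<in>UNIV. \<Sum>k\<in>UNIV. (a $ j * b $ k) *\<^sub>R B z (axis j 1) (axis k 1)) z"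
    using expansion by (intro dd_cong[OF open_domain z])
  also have "\<dots> = (\<Sum>j\<in>UNIV. \<Sum>k\<in>UNIV. (a $ j * b $ k) *\<^sub>R dd v (\<lambda>z. B z (axis j 1) (axis k 1)) z)"
    by (intro dd_eqI has_derivative_sum has_derivative_scaleR_right smooth_on_has_derivative[OF smooth_coeff z])
  finally show ?thesis .
qed

text \<open>Expanding both arguments in the fixed basis reduces this to the product rule, with the
  base point entering only through finitely many coefficient functions.\<close>

lemma has_derivative_along:
  assumes z: "\<zeta> x \<in> T" and \<zeta>: "(\<zeta> has_derivative \<zeta>') (at x)" and Y: "(Y has_derivative Y') (at x)"
    and Z: "(Z has_derivative Z') (at x)"
  shows "((\<lambda>x. B (\<zeta> x) (Y x) (Z x)) has_derivative
    (\<lambda>w. dd (\<zeta>' w) (\<lambda>z. B z (Y x) (Z x)) (\<zeta> x) + B (\<zeta> x) (Y' w) (Z x) + B (\<zeta> x) (Y x) (Z' w))) (at x)"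
proof -
  let ?e = "\<lambda>i. axis i 1 :: real ^ 'n"
  have Bd: "((\<lambda>x. B (\<zeta> x) (?e j) (?e k)) has_derivative (\<lambda>w. dd (\<zeta>' w) (\<lambda>z. B z (?e j) (?e k)) (\<zeta> x))) (at x)" for j k
    by (rule has_derivative_compose[OF \<zeta> smooth_on_has_derivative[OF smooth_coeff z]])
  have nth: "((\<lambda>x. F x $ j) has_derivative (\<lambda>w. F' w $ j)) (at x)" if "(F has_derivative F') (at x)"
    for F :: "_ \<Rightarrow> real ^ 'n" and F' j
    using that by (rule bounded_linear.has_derivative[OF bounded_linear_vec_nth])
  have *: "((\<lambda>x. \<Sum>j\<in>UNIV. \<Sum>k\<in>UNIV. (Y x $ j * Z x $ k) *\<^sub>R B (\<zeta> x) (?e j) (?e k)) has_derivative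
    (\<lambda>w. \<Sum>j\<in>UNIV. \<Sum>k\<in>UNIV. (Y x $ j * Z x $ k) *\<^sub>R dd (\<zeta>' w) (\<lambda>z. B z (?e j) (?e k)) (\<zeta> x) +
        (Y x $ j * Z' w $ k + Y' w $ j * Z x $ k) *\<^sub>R B (\<zeta> x) (?e j) (?e k))) (at x)"
    by (intro has_derivative_sum has_derivative_scaleR has_derivative_mult nth Y Z Bd)
  \<comment> \<open>The expansion is available only on \<open>T\<close>; continuity of the curve
    keeps it there near \<open>x\<close>.\<close>
  have ev: "\<forall>\<^sub>F x in at x. \<zeta> x \<in> T"
    using has_derivative_continuous[OF \<zeta>] open_domain z
    by (auto simp: continuous_within intro: topological_tendstoD)
  show ?thesis
  proof (rule has_derivative_transform_eventually[OF _ _ _ UNIV_I])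
    show "\<forall>\<^sub>F x in at x. (\<Sum>j\<in>UNIV. \<Sum>k\<in>UNIV. (Y x $ j * Z x $ k) *\<^sub>R B (\<zeta> x) (?e j) (?e k)) = B (\<zeta> x) (Y x) (Z x)"
      using ev by eventually_elim (rule expansion[symmetric])
    show "(\<Sum>j\<in>UNIV. \<Sum>k\<in>UNIV. (Y x $ j * Z x $ k) *\<^sub>R B (\<zeta> x) (?e j) (?e k)) = B (\<zeta> x) (Y x) (Z x)"
      by (rule expansion[OF z, symmetric])
    show "((\<lambda>x. \<Sum>j\<in>UNIV. \<Sum>k\<in>UNIV. (Y x $ j * Z x $ k) *\<^sub>R B (\<zeta> x) (?e j) (?e k)) has_derivative
      (\<lambda>w. dd (\<zeta>' w) (\<lambda>z. B z (Y x) (Z x)) (\<zeta> x) + B (\<zeta> x) (Y' w) (Z x) + B (\<zeta> x) (Y x) (Z' w))) (at x)"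
      using * unfolding dd_expansion[OF z, of _ "Y x" "Z x"] expansion[OF z, of "Y x" "Z' _"] expansion[OF z, of "Y' _" "Z x"]
      by (simp add: sum.distrib scaleR_left_distrib algebra_simps)
  qed
qed

lemma smooth_along:
  fixes \<zeta> :: "'x::euclidean_space \<Rightarrow> 'z"
  assumes "open U" "\<zeta> ` U \<subseteq> T" "smooth_on U \<zeta>" "smooth_on U Y" "smooth_on U Z"
  shows "smooth_on U (\<lambda>x. B (\<zeta> x) (Y x) (Z x))"
proof (rule smooth_on_linear_apply[OF assms(1) _ _ assms(5)])
  fix k
  show "smooth_on U (\<lambda>x. B (\<zeta> x) (Y x) (axis k 1))"
    by (rule smooth_on_linear_apply[OF assms(1) linear_left smooth_on_compose[OF smooth_coeff open_domain assms(1,3,2)] assms(4)])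
       (use assms(2) in auto)
qed (use assms(2) linear_right in auto)

end

lemma matrix_inv_apply:
  fixes B :: "real ^ 'n ^ 'n"
  assumes "invertible B"
  shows "B *v (matrix_inv B *v b) = b"
proof -
  have "B ** matrix_inv B = mat 1"
    using assms unfolding matrix_inv_def invertible_def by (metis (mono_tags, lifting) someI_ex)
  then show ?thesis by (simp add: matrix_vector_mul_assoc)
qed

text \<open>Coordinate model of \<open>A\<close> and \<open>L\<close> in one chart. Points are pairs
  (x, y) of position and velocity, so a direction (0, u) is tangent to the fibre and a direction (k,
  0) varies the position while the components of the velocity are fixed.\<close>

locale local_finsler =
  fixes T :: "((real ^ 'n::finite) \<times> (real ^ 'n)) set" and L :: "(real ^ 'n) \<times> (real ^ 'n) \<Rightarrow> real"
  assumes open_T: "open T"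
    and smooth_L: "smooth_on T L"
    and cone: "\<And>x y a. (x, y) \<in> T \<Longrightarrow> a > 0 \<Longrightarrow> (x, a *\<^sub>R y) \<in> T"
    and homogeneous: "\<And>x y a. (x, y) \<in> T \<Longrightarrow> a > 0 \<Longrightarrow> L (x, a *\<^sub>R y) = a\<^sup>2 * L (x, y)"
    and nondegenerate: "\<And>z u. z \<in> T \<Longrightarrow> (\<And>w. dd (0, u) (dd (0, w) L) z = 0) \<Longrightarrow> u = 0"
begin

definition g where "g z u w = 1 / 2 * dd (0, u) (dd (0, w) L) z"
text \<open>The factor 1/2, together with the one in \<open>g\<close>, gives the 1/4 of the Cartan
  tensor (see \<open>g_vertical_derivative\<close>). \<open>K\<close> is the derivative of the
  metric coefficients with respect to position, as it enters Koszul's formula.\<close>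

definition C where "C z u v w = 1 / 2 * dd (0, u) (\<lambda>z. g z v w) z"
definition K where "K z k u w = dd (k, 0) (\<lambda>z. g z u w) z"

lemma smooth_g: "smooth_on T (\<lambda>z. g z u w)"
  unfolding g_def by (intro smooth_on_mult smooth_on_const open_T smooth_on_dd smooth_L)

lemma smooth_C: "smooth_on T (\<lambda>z. C z u v w)"
  unfolding C_def by (intro smooth_on_mult smooth_on_const open_T smooth_on_dd smooth_g)

lemma smooth_K: "smooth_on T (\<lambda>z. K z k u w)"
  unfolding K_def using smooth_on_dd[OF smooth_g] by (simp add: eta_contract_eq)

lemma linear_vertical:
  assumes "smooth_on T f" "z \<in> T"
  shows "linear (\<lambda>u. dd (0, u) f z)" "linear (\<lambda>k. dd (k, 0) f z)"
proof -
  note l = smooth_on_linear_dd[OF assms]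
  show "linear (\<lambda>u. dd (0, u) f z)" "linear (\<lambda>k. dd (k, 0) f z)"
    using linear_compose[OF _ l, of "\<lambda>u. (0, u)"] linear_compose[OF _ l, of "\<lambda>u. (u, 0)"]
    by (auto simp: o_def linear_iff)
qed

context fixes z assumes z: "z \<in> T" begin

lemma g_commute: "g z u w = g z w u"
  unfolding g_def using dd_commute[OF open_T smooth_L z] by simp

lemma linear_g: "linear (\<lambda>u. g z u w)" "linear (\<lambda>w. g z u w)"
proof -
  show 1: "linear (\<lambda>u. g z u w)" for w
    unfolding g_def using linear_compose_scale_right[OF linear_vertical(1)[OF smooth_on_dd[OF smooth_L] z], of "1/2"]
    by simp
  show "linear (\<lambda>w. g z u w)" using 1 by (simp add: g_commute[of u])
qed

lemma g_eqI: "(\<And>w. g z u w = g z u' w) \<Longrightarrow> u = u'"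
  using nondegenerate[OF z, of "u - u'"] linear_diff[OF linear_g(1)]
  by (simp add: g_def)

end

lemma g_vertical_derivative: "z \<in> T \<Longrightarrow> dd (0, u) (\<lambda>z. g z v w) z = 1 / 2 * dd (0, u) (dd (0, v) (dd (0, w) L)) z"
  unfolding g_def
  by (intro dd_eqI has_derivative_mult_right has_derivative_dd smooth_on_differentiable[OF smooth_on_dd[OF smooth_on_dd[OF smooth_L]]])

context fixes z assumes z: "z \<in> T" begin

lemma C_commute: "C z u v w = C z v u w" "C z u v w = C z u w v"
proof -
  show "C z u v w = C z v u w"
    unfolding C_def g_vertical_derivative[OF z]
    using dd_commute[OF open_T smooth_on_dd[OF smooth_L] z] by simp
  show "C z u v w = C z u w v"
    unfolding C_def using g_commute by (simp add: dd_cong[OF open_T z, of "\<lambda>z. g z v w" "\<lambda>z. g z w v"])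
qed

lemma linear_C: "linear (\<lambda>u. C z u v w)" "linear (\<lambda>v. C z u v w)" "linear (\<lambda>w. C z u v w)"
proof -
  show 1: "linear (\<lambda>u. C z u v w)" for v w
    unfolding C_def using linear_compose_scale_right[OF linear_vertical(1)[OF smooth_g z], of "1/2"] by simp
  show 2: "linear (\<lambda>v. C z u v w)" for w using 1 by (simp add: C_commute(1)[of u])
  show "linear (\<lambda>w. C z u v w)" using 2 by (simp add: C_commute(2)[of u v])
qed

lemma K_commute: "K z k u w = K z k w u"
  unfolding K_def using g_commute by (intro dd_cong[OF open_T z]) auto

lemma linear_K: "linear (\<lambda>k. K z k u w)" "linear (\<lambda>u. K z k u w)" "linear (\<lambda>w. K z k u w)"
proof -
  show "linear (\<lambda>k. K z k u w)"
    unfolding K_def by (rule linear_vertical(2)[OF smooth_g z])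
  note d = smooth_on_has_derivative[OF smooth_g z]
  show 2: "linear (\<lambda>u. K z k u w)" for w
  proof (rule linearI)
    fix u v a
    have "K z k (u + v) w = dd (k, 0) (\<lambda>z. g z u w + g z v w) z"
      unfolding K_def using linear_add[OF linear_g(1)] by (intro dd_cong[OF open_T z]) auto
    also have "\<dots> = K z k u w + K z k v w"
      unfolding K_def by (intro dd_eqI has_derivative_add d)
    finally show "K z k (u + v) w = K z k u w + K z k v w" .
    have "K z k (a *\<^sub>R u) w = dd (k, 0) (\<lambda>z. a * g z u w) z"
      unfolding K_def using linear_cmul[OF linear_g(1)] by (intro dd_cong[OF open_T z]) auto
    also have "\<dots> = a * K z k u w"
      unfolding K_def by (intro dd_eqI has_derivative_mult_right d)
    finally show "K z k (a *\<^sub>R u) w = a *\<^sub>R K z k u w" by simp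
  qed
  show "linear (\<lambda>w. K z k u w)" using 2 by (simp add: K_commute[of k u])
qed

end

text \<open>Differentiating the homogeneity of \<open>L\<close> twice along the fibre shows that \<open>g\<close> is homogeneous of
  degree \<open>0\<close>; a third derivative, in the radial direction, then vanishes.\<close>

lemma C_radial:
  assumes z: "(x, y) \<in> T"
  shows "C (x, y) y v w = 0"
proof -
  have scale: "((\<lambda>z. (fst z, a *\<^sub>R snd z)) has_derivative (\<lambda>z. (fst z, a *\<^sub>R snd z))) (at z)" for a and z :: "(real ^ 'n) \<times> (real ^ 'n)"
    by (auto intro!: derivative_eq_intros)
  \<comment> \<open>A fibre derivative lowers the degree of homogeneity by one. The factor
    \<open>b\<close> is kept separate because this is used for \<open>L\<close> with b = a^2 and for
    its first derivative with b = a.\<close>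
  have deriv_scale: "a * dd (0, u) f (x, a *\<^sub>R y) = b * dd (0, u) f (x, y)"
    if f: "smooth_on T f" "\<And>x y. (x, y) \<in> T \<Longrightarrow> f (x, a *\<^sub>R y) = b * f (x, y)" and a: "a > 0" and xy: "(x, y) \<in> T"
    for f :: "(real ^ 'n) \<times> (real ^ 'n) \<Rightarrow> real" and a b x y u
  proof -
    have "((\<lambda>z. f (fst z, a *\<^sub>R snd z)) has_derivative (\<lambda>w. dd (fst w, a *\<^sub>R snd w) f (x, a *\<^sub>R y))) (at (x, y))"
      using has_derivative_compose[OF scale[of a "(x, y)"] smooth_on_has_derivative[OF f(1)]] cone[OF xy a] by simp
    then have "dd (0, u) (\<lambda>z. f (fst z, a *\<^sub>R snd z)) (x, y) = dd (0, a *\<^sub>R u) f (x, a *\<^sub>R y)"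
      by (simp add: dd_eqI)
    also have "\<dots> = a * dd (0, u) f (x, a *\<^sub>R y)"
      using linear_cmul[OF linear_vertical(1)[OF f(1) cone[OF xy a]]] by simp
    finally have "a * dd (0, u) f (x, a *\<^sub>R y) = dd (0, u) (\<lambda>z. f (fst z, a *\<^sub>R snd z)) (x, y)" by simp
    also have "\<dots> = dd (0, u) (\<lambda>z. b * f z) (x, y)"
      using f(2) by (intro dd_cong[OF open_T xy]) auto
    also have "\<dots> = b * dd (0, u) f (x, y)"
      by (intro dd_eqI has_derivative_mult_right smooth_on_has_derivative[OF f(1) xy])
    finally show ?thesis .
  qed
  have L1: "dd (0, w) L (x, a *\<^sub>R y) = a * dd (0, w) L (x, y)" if "a > 0" "(x, y) \<in> T" for a x y
    using deriv_scale[OF smooth_L homogeneous[OF _ that(1)] that, of w] that(1) by (simp add: power2_eq_square)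
  have g_scale: "g (x, a *\<^sub>R y) v w = g (x, y) v w" if "a > 0" for a
    using deriv_scale[OF smooth_on_dd[OF smooth_L] L1[OF that] that z] that by (simp add: g_def)
  let ?f = "\<lambda>z. g z v w"
  \<comment> \<open>The radial curve through (x, y): its velocity at t = 1 is (0, y), and
    \<open>g\<close> is constant along it.\<close>
  have "((\<lambda>t. (x, t *\<^sub>R y)) has_derivative (\<lambda>t. (0, t *\<^sub>R y))) (at (1 :: real))"
    by (auto intro!: derivative_eq_intros)
  from has_derivative_compose[OF this, of ?f] smooth_on_has_derivative[OF smooth_g z, of v w]
  have "((\<lambda>t. ?f (x, t *\<^sub>R y)) has_derivative (\<lambda>t. dd (0, t *\<^sub>R y) ?f (x, y))) (at 1)"
    by simp
  moreover have "((\<lambda>t. ?f (x, t *\<^sub>R y)) has_derivative (\<lambda>t. 0)) (at 1)"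
    by (rule has_derivative_transform_within_open[of "\<lambda>t. ?f (x, y)" _ _ _ "{0<..}"])
       (auto simp: g_scale)
  ultimately have "(\<lambda>t::real. dd (0, t *\<^sub>R y) ?f (x, y)) = (\<lambda>t. 0)"
    by (rule has_derivative_unique)
  from fun_cong[OF this, of 1] show ?thesis by (simp add: C_def)
qed

definition gram :: "(real ^ 'n) \<times> (real ^ 'n) \<Rightarrow> real ^ 'n ^ 'n" where
  "gram z = (\<chi> i j. g z (axis i 1) (axis j 1))"

text \<open>Raising an index: the vector that represents the covector \<phi> with respect to
  \<open>g z\<close>, as \<open>g_sharp\<close> shows.\<close>

definition sharp :: "(real ^ 'n) \<times> (real ^ 'n) \<Rightarrow> (real ^ 'n \<Rightarrow> real) \<Rightarrow> real ^ 'n" where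
  "sharp z \<phi> = matrix_inv (gram z) *v (\<chi> i. \<phi> (axis i 1))"

lemma g_matrix: "z \<in> T \<Longrightarrow> g z u w = (gram z *v u) \<bullet> w"
proof -
  assume z: "z \<in> T"
  have "g z u w = (\<Sum>j\<in>UNIV. w $ j * (\<Sum>i\<in>UNIV. u $ i * g z (axis i 1) (axis j 1)))"
    using linear_axis_expansion[OF linear_g(2)[OF z], of u w]
      linear_axis_expansion[OF linear_g(1)[OF z], of u "axis j 1" for j] by simp
  also have "\<dots> = (\<Sum>j\<in>UNIV. w $ j * (gram z *v u) $ j)"
    using g_commute[OF z] by (simp add: gram_def matrix_vector_mult_def mult.commute)
  finally show ?thesis by (simp add: inner_vec_def mult.commute)
qed

lemma invertible_gram: "z \<in> T \<Longrightarrow> invertible (gram z)"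
proof -
  assume z: "z \<in> T"
  have "u = 0" if "gram z *v u = 0" for u
    using g_eqI[OF z, of u 0] that linear_0[OF linear_g(1)[OF z]] by (simp add: g_matrix[OF z])
  then show ?thesis
    using matrix_left_invertible_ker invertible_left_inverse by blast
qed

lemma g_sharp: "z \<in> T \<Longrightarrow> linear \<phi> \<Longrightarrow> g z (sharp z \<phi>) w = \<phi> w"
proof -
  assume z: "z \<in> T" and \<phi>: "linear \<phi>"
  have "gram z *v sharp z \<phi> = (\<chi> i. \<phi> (axis i 1))"
    unfolding sharp_def by (rule matrix_inv_apply[OF invertible_gram[OF z]])
  then show ?thesis
    using linear_axis_expansion[OF \<phi>, of w] by (simp add: g_matrix[OF z] inner_vec_def mult.commute)
qed

text \<open>Cramer's rule: the components are quotients of determinants with smooth entries, where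
  \<open>?A k\<close> has the k-th column replaced by the right-hand side.\<close>

lemma smooth_sharp:
  assumes "\<And>i. smooth_on T (\<lambda>z. \<phi> z (axis i 1))"
  shows "smooth_on T (\<lambda>z. sharp z (\<phi> z))"
proof -
  let ?A = "\<lambda>k z. (\<chi> i j. if j = k then \<phi> z (axis i 1) else gram z $ i $ j) :: real ^ 'n ^ 'n"
  have d: "det (gram z) \<noteq> 0" if "z \<in> T" for z
    using invertible_gram[OF that] invertible_det_nz by blast
  have sG: "smooth_on T (\<lambda>z. gram z $ i $ j)" for i j
    by (simp add: gram_def smooth_g)
  have "smooth_on T (\<lambda>z. \<chi> k. det (?A k z) / det (gram z))"
  proof (intro smooth_on_vec_lambda smooth_on_divide smooth_on_det open_T sG d)
    fix k i j
    show "smooth_on T (\<lambda>z. ?A k z $ i $ j)" by (cases "j = k") (use assms sG in simp_all)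
  qed
  then show ?thesis
  proof (rule smooth_on_cong[OF _ open_T])
    fix z assume z: "z \<in> T"
    have "gram z *v sharp z (\<phi> z) = (\<chi> i. \<phi> z (axis i 1))"
      unfolding sharp_def by (rule matrix_inv_apply[OF invertible_gram[OF z]])
    then show "(\<chi> k. det (?A k z) / det (gram z)) = sharp z (\<phi> z)"
      using cramer[OF d[OF z]] by (simp cong: if_cong)
  qed
qed

text \<open>\<open>G\<close>, \<open>N\<close> and \<open>S\<close> are \<open>\<Gamma>(a, b)\<close>, \<open>\<Gamma>(a, y)\<close> and \<open>\<Gamma>(y, y)\<close>. The Koszul formula for \<open>\<Gamma>\<close> contains \<open>\<Gamma>(\<cdot>, y)\<close>,
  which contracting with \<open>y\<close> once and twice expresses through \<open>\<Gamma>(y, y)\<close> and known terms.\<close>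

definition formal_christoffel where "formal_christoffel z a b c = 1 / 2 * (K z a b c + K z b a c - K z c a b)"
definition S where "S z = sharp z (formal_christoffel z (snd z) (snd z))"
definition N where "N z a = sharp z (\<lambda>c. formal_christoffel z a (snd z) c - C z (S z) a c)"
definition G where "G z a b = sharp z (\<lambda>c. formal_christoffel z a b c - C z (N z a) b c - C z (N z b) a c + C z (N z c) a b)"

lemma smooth_gam: "smooth_on T (\<lambda>z. formal_christoffel z a b c)"
  unfolding formal_christoffel_def by (intro smooth_on_mult smooth_on_const smooth_on_add smooth_on_diff open_T smooth_K)

context fixes z assumes z: "z \<in> T" begin

lemma gam_commute: "formal_christoffel z a b c = formal_christoffel z b a c"
  using K_commute[OF z] by (simp add: formal_christoffel_def)

lemma linear_gam: "linear (\<lambda>a. formal_christoffel z a b c)" "linear (\<lambda>b. formal_christoffel z a b c)" "linear (\<lambda>c. formal_christoffel z a b c)"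
proof -
  note l = linear_add[OF linear_K(1)[OF z]] linear_add[OF linear_K(2)[OF z]] linear_add[OF linear_K(3)[OF z]]
    linear_cmul[OF linear_K(1)[OF z]] linear_cmul[OF linear_K(2)[OF z]] linear_cmul[OF linear_K(3)[OF z]]
  show "linear (\<lambda>a. formal_christoffel z a b c)" "linear (\<lambda>b. formal_christoffel z a b c)" "linear (\<lambda>c. formal_christoffel z a b c)"
    by (auto intro!: linearI simp: formal_christoffel_def l field_simps)
qed

lemmas lin_simps =
  linear_add[OF linear_gam(1)] linear_add[OF linear_gam(2)] linear_add[OF linear_gam(3)]
  linear_cmul[OF linear_gam(1)] linear_cmul[OF linear_gam(2)] linear_cmul[OF linear_gam(3)]
  linear_add[OF linear_C(1)[OF z]] linear_add[OF linear_C(2)[OF z]] linear_add[OF linear_C(3)[OF z]]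
  linear_cmul[OF linear_C(1)[OF z]] linear_cmul[OF linear_C(2)[OF z]] linear_cmul[OF linear_C(3)[OF z]]
  linear_add[OF linear_g(1)[OF z]] linear_cmul[OF linear_g(1)[OF z]]

lemma g_S: "g z (S z) c = formal_christoffel z (snd z) (snd z) c"
  unfolding S_def by (rule g_sharp[OF z linear_gam(3)])

lemma g_N: "g z (N z a) c = formal_christoffel z a (snd z) c - C z (S z) a c"
  unfolding N_def by (rule g_sharp[OF z]) (auto intro!: linearI simp: lin_simps algebra_simps)

lemma linear_N: "linear (N z)"
proof (rule linearI; rule g_eqI[OF z])
qed (simp_all add: g_N lin_simps algebra_simps)

lemmas N_simps = linear_add[OF linear_N] linear_cmul[OF linear_N]

lemma g_G: "g z (G z a b) c = formal_christoffel z a b c - C z (N z a) b c - C z (N z b) a c + C z (N z c) a b"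
  unfolding G_def by (rule g_sharp[OF z]) (auto intro!: linearI simp: N_simps lin_simps algebra_simps)

lemma G_commute: "G z a b = G z b a"
  by (rule g_eqI[OF z]) (simp add: g_G gam_commute[of a b] C_commute(2)[OF z, of _ a b])

lemma linear_G: "linear (\<lambda>a. G z a b)" "linear (\<lambda>b. G z a b)"
proof -
  show 1: "linear (\<lambda>a. G z a b)" for b
  proof (rule linearI; rule g_eqI[OF z])
  qed (simp_all add: g_G N_simps lin_simps algebra_simps)
  show "linear (\<lambda>b. G z a b)" using 1 by (simp add: G_commute[of a])
qed

lemma C_radial': "C z (snd z) a b = 0" "C z a (snd z) b = 0" "C z a b (snd z) = 0"
  using C_radial[of "fst z" "snd z"] z C_commute[OF z] by simp_all

text \<open>Consistency of the staged definitions: inserting y into \<open>N\<close> gives back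
  \<open>S\<close>, and then inserting y into \<open>G\<close> gives back \<open>N\<close>. Only
  this makes \<open>G\<close> a solution of the implicit equation, in whose Cartan term
  \<open>G\<close> itself occurs.\<close>

lemma N_radial: "N z (snd z) = S z"
  by (rule g_eqI[OF z]) (simp add: g_N g_S C_radial')

lemma G_radial: "G z a (snd z) = N z a"
  by (rule g_eqI[OF z]) (simp add: g_G g_N N_radial C_radial')

text \<open>In the sum of the two metric terms the formal Christoffel symbols add up to
  \<open>K\<close>. The Cartan terms in \<open>N z a\<close> and \<open>N z b\<close> cancel, and
  twice the one in \<open>N z k\<close> is compensated by the last summand.\<close>

lemma G_compatible: "K z k a b = g z (G z k a) b + g z a (G z k b) + 2 * C z (G z k (snd z)) a b"
  unfolding G_radial g_commute[OF z, of a] g_G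
  using C_commute(1)[OF z, of _ k] C_commute(2)[OF z] K_commute[OF z, of a b k] K_commute[OF z, of b a k]
    K_commute[OF z, of k a b] by (simp add: formal_christoffel_def field_simps)

lemma G_unique:
  assumes sym: "\<And>a b. H a b = H b a"
    and H: "\<And>k a b. K z k a b = g z (H k a) b + g z a (H k b) + 2 * C z (H k (snd z)) a b"
  shows "H a b = G z a b"
proof -
  \<comment> \<open>The alternating sum of the compatibility equations for the directions
    \<open>a\<close>, \<open>b\<close> and \<open>c\<close>; symmetry of \<open>H\<close> leaves the
    single metric term with \<open>H a b\<close>.\<close>
  have koszul: "g z (H a b) c = formal_christoffel z a b c - C z (H a (snd z)) b c - C z (H b (snd z)) a c + C z (H c (snd z)) a b"
    for a b c
    using sym[of a b] sym[of a c] sym[of b c] g_commute[OF z, of _ "H _ _"]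
    unfolding formal_christoffel_def H[of a b c] H[of b a c] H[of c a b]
    by (simp add: field_simps)
  \<comment> \<open>From here on the unknown is determined from the inside out: the Cartan terms of
    each equation contain only values of \<open>H\<close> already identified, or vanish because y is
    one of their arguments.\<close>
  have "H (snd z) (snd z) = S z"
    by (rule g_eqI[OF z]) (simp add: koszul g_S C_radial')
  then have "H a (snd z) = N z a" for a
    by (intro g_eqI[OF z]) (simp add: koszul g_N C_radial')
  then show ?thesis
    by (intro g_eqI[OF z]) (simp add: koszul g_G)
qed

end

lemma smooth_S: "smooth_on T S"
proof -
  have "smooth_on T (\<lambda>z. formal_christoffel z (snd z) (snd z) c)" for c
    by (rule smooth_on_linear_apply[OF open_T linear_gam(2)], assumption,
        rule smooth_on_linear_apply[OF open_T linear_gam(1)], assumption, rule smooth_gam)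
       (intro smooth_on_bounded_linear[OF bounded_linear_snd] open_T smooth_on_ident)+
  then show ?thesis
    unfolding S_def by (intro smooth_sharp)
qed

lemma smooth_N: "smooth_on T (\<lambda>z. N z a)"
  unfolding N_def
  by (intro smooth_sharp smooth_on_diff open_T
      smooth_on_linear_apply[OF open_T linear_gam(2) smooth_gam] smooth_on_linear_apply[OF open_T linear_C(1) smooth_C]
      smooth_S smooth_on_bounded_linear[OF bounded_linear_snd] smooth_on_ident)

lemma smooth_G: "smooth_on T (\<lambda>z. G z a b)"
  unfolding G_def
  by (intro smooth_sharp smooth_on_diff smooth_on_add open_T smooth_gam
      smooth_on_linear_apply[OF open_T linear_C(1) smooth_C] smooth_N)

sublocale G: smooth_bilinear_field T G
  by (rule smooth_bilinear_field.intro[OF open_T linear_G smooth_G])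

sublocale g: smooth_bilinear_field T g
  by (rule smooth_bilinear_field.intro[OF open_T linear_g smooth_g])

lemma dd_g:
  assumes z: "z \<in> T"
  shows "dd (k, v) (\<lambda>z. g z a b) z = K z k a b + 2 * C z v a b"
proof -
  have "dd ((k, 0) + (0, v)) (\<lambda>z. g z a b) z = dd (k, 0) (\<lambda>z. g z a b) z + dd (0, v) (\<lambda>z. g z a b) z"
    by (rule linear_add[OF smooth_on_linear_dd[OF smooth_g z]])
  then show ?thesis by (simp add: K_def C_def)
qed

end

section \<open>The Chern connection in a chart\<close>

text \<open>Bridge from one-variable \<open>deriv\<close> to \<open>dd\<close>. Comparing
  \<open>F\<close> with \<open>f\<close> only on \<open>T\<close> permits nesting, since an inner
  \<open>deriv\<close> is known to be a \<open>dd\<close> only on the domain of the Finsler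
  function.\<close>

lemma deriv_line:
  fixes f :: "'e::euclidean_space \<Rightarrow> real"
  assumes T: "open T" "z \<in> T" and f: "smooth_on T f" and F: "\<And>z. z \<in> T \<Longrightarrow> F z = f z"
  shows "deriv (\<lambda>t. F (z + t *\<^sub>R v)) 0 = dd v f z"
proof (rule DERIV_imp_deriv)
  have "((\<lambda>t. z + t *\<^sub>R v) has_derivative (\<lambda>t. t *\<^sub>R v)) (at (0 :: real))"
    by (auto intro!: derivative_eq_intros)
  from has_derivative_compose[OF this] smooth_on_has_derivative[OF f T(2)]
  have "((\<lambda>t. f (z + t *\<^sub>R v)) has_derivative (\<lambda>t. dd (t *\<^sub>R v) f z)) (at 0)" by simp
  moreover have "dd (t *\<^sub>R v) f z = dd v f z * t" for t
    using linear_cmul[OF smooth_on_linear_dd[OF f T(2)]] by simp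
  ultimately have "((\<lambda>t. f (z + t *\<^sub>R v)) has_real_derivative dd v f z) (at 0)"
    by (simp add: has_field_derivative_def)
  then show "((\<lambda>t. F (z + t *\<^sub>R v)) has_real_derivative dd v f z) (at 0)"
  proof (rule has_field_derivative_transform_within_open)
    show "open ((\<lambda>t. z + t *\<^sub>R v) -` T)"
      by (intro open_vimage T continuous_intros)
  qed (use T F in auto)
qed

context manifold begin

lemma tvec_diff: "c \<in> M \<Longrightarrow> p \<in> cdom c \<Longrightarrow> tvec M c p (u - w) = tvec M c p u - tvec M c p w"
  using tvec_linear(1)[of c p "u - w" w] by (simp add: eq_diff_eq)

lemma tangent_space_diff: "u \<in> tangent_space M p \<Longrightarrow> v \<in> tangent_space M p \<Longrightarrow> u - v \<in> tangent_space M p"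
  using tangent_space_add[OF _ tangent_space_scale[of v p "-1"], of u]
  by (simp add: tscale_def fun_diff_def plus_fun_def)

lemma tangent_space_sum:
  "(\<And>i. i \<in> I \<Longrightarrow> f i \<in> tangent_space M p) \<Longrightarrow> (\<Sum>i\<in>I. f i) \<in> tangent_space M p"
proof (induction I rule: infinite_finite_induct)
  case (insert i I)
  then show ?case using tangent_space_add by (metis insertCI sum.insert)
qed (use vf_tangent[OF vf_zero[OF open_UNIV] UNIV_I] in \<open>simp_all add: zero_fun_def\<close>)

end

locale finsler_manifold =
  fixes M :: "('m::{t2_space,second_countable_topology}, 'n::finite) chart set"
    and A :: "('m \<times> 'm tvec) set" and L :: "'m \<times> 'm tvec \<Rightarrow> real"
  assumes pseudo_finsler: "pseudo_finsler M A L"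

sublocale finsler_manifold \<subseteq> manifold M
  using pseudo_finsler by unfold_locales (simp add: pseudo_finsler_def)

section \<open>The Finsler structure read in a chart\<close>

context finsler_manifold begin

lemma A_tangent: "(p, v) \<in> A \<Longrightarrow> v \<in> tangent_space M p"
  using pseudo_finsler by (auto simp: pseudo_finsler_def tangent_bundle_def)

abbreviation Lc :: "('m, 'n) chart \<Rightarrow> (real ^ 'n) \<times> (real ^ 'n) \<Rightarrow> real" where
  "Lc c \<equiv> L \<circ> tparam M c"

context fixes c assumes c: "c \<in> M" begin

lemma tparam_eq:
  assumes "x \<in> cimg c"
  shows "tparam M c (x, y) = (cinv c x, tvec M c (cinv c x) y)"
  unfolding tparam_def prod.case sum_coord_field[OF c cinv_in[OF c assms]] ..

lemma mem_tdom: "(x, y) \<in> tdom M c A \<longleftrightarrow> x \<in> cimg c \<and> (cinv c x, tvec M c (cinv c x) y) \<in> A"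
  using tparam_eq by (auto simp: tdom_def)

lemma open_tdom: "open (tdom M c A)"
  using pseudo_finsler c by (auto simp: pseudo_finsler_def)

lemma smooth_Lc: "smooth_on (tdom M c A) (Lc c)"
  using pseudo_finsler c by (auto simp: pseudo_finsler_def)

context fixes p assumes p: "p \<in> cdom c" begin

lemma tparam_cmap: "v \<in> tangent_space M p \<Longrightarrow> tparam M c (cmap c p, cvec c v) = (p, v)"
  using tparam_eq[of "cmap c p"] c p tvec_cvec by simp

lemma tdom_cmap: "v \<in> tangent_space M p \<Longrightarrow> (cmap c p, cvec c v) \<in> tdom M c A \<longleftrightarrow> (p, v) \<in> A"
  using tparam_cmap p by (simp add: tdom_def)

lemma fund_tensor_chart:
  assumes v: "(p, v) \<in> A" and u: "u \<in> tangent_space M p" and w: "w \<in> tangent_space M p"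
  shows "fund_tensor L (p, v) u w = 1 / 2 * dd (0, cvec c u) (dd (0, cvec c w) (Lc c)) (cmap c p, cvec c v)"
proof -
  let ?z = "(cmap c p, cvec c v)"
  note vt = A_tangent[OF v]
  have "L (p, v + t *\<^sub>t u + s *\<^sub>t w) = Lc c ((?z + t *\<^sub>R (0, cvec c u)) + s *\<^sub>R (0, cvec c w))" for t s
    using tparam_cmap[of "v + t *\<^sub>t u + s *\<^sub>t w"] tangent_space_add tangent_space_scale vt u w by simp
  moreover have "deriv (\<lambda>s. Lc c (z + s *\<^sub>R (0, cvec c w))) 0 = dd (0, cvec c w) (Lc c) z" if "z \<in> tdom M c A" for z
    by (rule deriv_line[OF open_tdom that smooth_Lc]) simp
  ultimately show ?thesis
    using deriv_line[OF open_tdom _ smooth_on_dd[OF smooth_Lc],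
        of ?z "\<lambda>z. deriv (\<lambda>s. Lc c (z + s *\<^sub>R (0, cvec c w))) 0" "(0, cvec c w)" "(0, cvec c u)"]
      tdom_cmap[OF vt] v by (simp only: fund_tensor_def prod.case)
qed

lemma cartan_tensor_chart:
  assumes v: "(p, v) \<in> A" and w: "w1 \<in> tangent_space M p" "w2 \<in> tangent_space M p" "w3 \<in> tangent_space M p"
  shows "cartan_tensor L (p, v) w1 w2 w3 =
    1 / 4 * dd (0, cvec c w1) (dd (0, cvec c w2) (dd (0, cvec c w3) (Lc c))) (cmap c p, cvec c v)"
proof -
  let ?z = "(cmap c p, cvec c v)"
  note vt = A_tangent[OF v]
  have "L (p, v + s1 *\<^sub>t w1 + s2 *\<^sub>t w2 + s3 *\<^sub>t w3) =
      Lc c (((?z + s1 *\<^sub>R (0, cvec c w1)) + s2 *\<^sub>R (0, cvec c w2)) + s3 *\<^sub>R (0, cvec c w3))" for s1 s2 s3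
    using tparam_cmap[of "v + s1 *\<^sub>t w1 + s2 *\<^sub>t w2 + s3 *\<^sub>t w3"] tangent_space_add tangent_space_scale vt w by simp
  moreover have 1: "deriv (\<lambda>s. Lc c (z + s *\<^sub>R (0, cvec c w3))) 0 = dd (0, cvec c w3) (Lc c) z" if "z \<in> tdom M c A" for z
    by (rule deriv_line[OF open_tdom that smooth_Lc]) simp
  moreover have "deriv (\<lambda>s2. deriv (\<lambda>s3. Lc c ((z + s2 *\<^sub>R (0, cvec c w2)) + s3 *\<^sub>R (0, cvec c w3))) 0) 0 =
      dd (0, cvec c w2) (dd (0, cvec c w3) (Lc c)) z" if "z \<in> tdom M c A" for z
    by (rule deriv_line[OF open_tdom that smooth_on_dd[OF smooth_Lc] 1])
  ultimately show ?thesis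
    using deriv_line[OF open_tdom _ smooth_on_dd[OF smooth_on_dd[OF smooth_Lc]],
        of ?z "\<lambda>z. deriv (\<lambda>s2. deriv (\<lambda>s3. Lc c ((z + s2 *\<^sub>R (0, cvec c w2)) + s3 *\<^sub>R (0, cvec c w3))) 0) 0"
          "(0, cvec c w2)" "(0, cvec c w3)" "(0, cvec c w1)"]
      tdom_cmap[OF vt] v by (simp only: cartan_tensor_def prod.case)
qed

end

lemma local_finsler: "local_finsler (tdom M c A) (Lc c)"
proof
  show "open (tdom M c A)" "smooth_on (tdom M c A) (Lc c)" by (rule open_tdom, rule smooth_Lc)
  have cone: "(p, a *\<^sub>t v) \<in> A" "L (p, a *\<^sub>t v) = a\<^sup>2 * L (p, v)" if "(p, v) \<in> A" "a > 0" for p v a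
    using pseudo_finsler that by (auto simp: pseudo_finsler_def)
  fix x y and a :: real assume xy: "(x, y) \<in> tdom M c A" and a: "a > 0"
  then have x: "x \<in> cimg c" "(cinv c x, tvec M c (cinv c x) y) \<in> A" by (simp_all add: mem_tdom)
  have "tvec M c (cinv c x) (a *\<^sub>R y) = a *\<^sub>t tvec M c (cinv c x) y"
    using tvec_linear(2)[OF c cinv_in[OF c x(1)]] .
  then show "(x, a *\<^sub>R y) \<in> tdom M c A" "Lc c (x, a *\<^sub>R y) = a\<^sup>2 * Lc c (x, y)"
    using cone[OF x(2) a] x(1) by (simp_all add: mem_tdom tparam_eq)
next
  fix z u assume z: "z \<in> tdom M c A" and 0: "\<And>w. dd (0, u) (dd (0, w) (Lc c)) z = 0"
  obtain x y where xy: "z = (x, y)" by (cases z)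
  let ?p = "cinv c x"
  have x: "x \<in> cimg c" "(?p, tvec M c ?p y) \<in> A" using z xy by (simp_all add: mem_tdom)
  have p: "?p \<in> cdom c" "cmap c ?p = x" using x c by simp_all
  have "fund_tensor L (?p, tvec M c ?p y) (tvec M c ?p u) w = 0" if "w \<in> tangent_space M ?p" for w
    using fund_tensor_chart[OF p(1) x(2) tvec_tangent[OF c p(1), of u] that] 0 p c xy by simp
  then have "tvec M c ?p u = 0"
    using pseudo_finsler x(2) tvec_tangent[OF c p(1)] by (fastforce simp: pseudo_finsler_def)
  then show "u = 0" using cvec_tvec[OF c p(1)] by (metis cvec_0)
qed

end

section \<open>The connection defined by one chart\<close>

abbreviation Gc :: "('m, 'n) chart \<Rightarrow> (real ^ 'n) \<times> (real ^ 'n) \<Rightarrow> real ^ 'n \<Rightarrow> real ^ 'n \<Rightarrow> real ^ 'n" where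
  "Gc c \<equiv> local_finsler.G (Lc c)"

definition chart_conn :: "('m, 'n) chart \<Rightarrow> 'm vfield \<Rightarrow> 'm vfield \<Rightarrow> 'm vfield \<Rightarrow> 'm vfield" where
  "chart_conn c V X Y = (\<lambda>p. tvec M c p (dd (cvec c (X p)) (xrep c Y) (cmap c p) +
     Gc c (cmap c p, cvec c (V p)) (cvec c (X p)) (cvec c (Y p))))"

definition is_chern :: "'m set \<Rightarrow> 'm vfield \<Rightarrow> ('m vfield \<Rightarrow> 'm vfield \<Rightarrow> 'm vfield) \<Rightarrow> bool" where
  "is_chern \<Omega> V D \<longleftrightarrow> affine_connection M \<Omega> D \<and> torsion_free M \<Omega> D \<and> almost_metric M L \<Omega> V D"

text \<open>The open set \<Omega> may reach beyond the domain of \<open>c\<close>; the pointwise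
  formulas concern points of both, so that one global field can be read in several charts.\<close>

context
  fixes c \<Omega> V assumes c: "c \<in> M" and \<Omega>: "open \<Omega>" and V: "admissible M A \<Omega> V"
begin

interpretation loc: local_finsler "tdom M c A" "Lc c"
  by (rule local_finsler[OF c])

lemma V_vf: "V \<in> vector_fields M \<Omega>" and V_A: "p \<in> \<Omega> \<Longrightarrow> (p, V p) \<in> A"
  using V by (auto simp: admissible_def)

lemma V_tdom: "x \<in> cmap c ` (cdom c \<inter> \<Omega>) \<Longrightarrow> (x, xrep c V x) \<in> tdom M c A"
  using V_A tdom_cmap[OF c _ A_tangent[OF V_A]] c by auto

lemma V_tdom': "p \<in> \<Omega> \<Longrightarrow> p \<in> cdom c \<Longrightarrow> (cmap c p, cvec c (V p)) \<in> tdom M c A"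
  using V_tdom[of "cmap c p"] c by simp

lemma smooth_V_curve: "smooth_on (cmap c ` (cdom c \<inter> \<Omega>)) (\<lambda>x. (x, xrep c V x))"
  by (intro smooth_on_Pair open_chart_image[OF c \<Omega>] smooth_on_ident xrep_smooth[OF V_vf c \<Omega>])

lemma fund_tensor_g:
  assumes "p \<in> \<Omega>" "p \<in> cdom c" "u \<in> tangent_space M p" "w \<in> tangent_space M p"
  shows "fund_tensor L (p, V p) u w = loc.g (cmap c p, cvec c (V p)) (cvec c u) (cvec c w)"
  using fund_tensor_chart[OF c assms(2) V_A[OF assms(1)] assms(3,4)] by (simp add: loc.g_def)

lemma cartan_tensor_C:
  assumes "p \<in> \<Omega>" "p \<in> cdom c" "u \<in> tangent_space M p" "v \<in> tangent_space M p" "w \<in> tangent_space M p"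
  shows "cartan_tensor L (p, V p) u v w = loc.C (cmap c p, cvec c (V p)) (cvec c u) (cvec c v) (cvec c w)"
  using cartan_tensor_chart[OF c assms(2) V_A[OF assms(1)] assms(3-5)] V_tdom'[OF assms(1,2)]
  by (simp add: loc.C_def loc.g_vertical_derivative)

context fixes p assumes p: "p \<in> \<Omega>" "p \<in> cdom c" begin

lemma cmap_image: "cmap c p \<in> cmap c ` (cdom c \<inter> \<Omega>)"
  using p by auto

lemma xrep_derivative:
  "X \<in> vector_fields M \<Omega> \<Longrightarrow> (xrep c X has_derivative (\<lambda>w. dd w (xrep c X) (cmap c p))) (at (cmap c p))"
  using xrep_smooth[OF _ c \<Omega>] cmap_image smooth_on_has_derivative by blast

lemma V_curve_derivative:
  "((\<lambda>x. (x, xrep c V x)) has_derivative (\<lambda>w. (w, dd w (xrep c V) (cmap c p)))) (at (cmap c p))"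
  by (intro has_derivative_Pair has_derivative_ident xrep_derivative V_vf)

text \<open>The metric is taken at the reference field, so the chain rule along x \<mapsto> (x, V x)
  adds a fibre derivative in the direction dV(v), which is twice a Cartan tensor.\<close>

lemma metric_derivative:
  assumes v: "v \<in> tangent_space M p" and Y: "Y \<in> vector_fields M \<Omega>" and Z: "Z \<in> vector_fields M \<Omega>"
  defines "z \<equiv> (cmap c p, cvec c (V p))" and "a \<equiv> cvec c v"
  shows "v (\<lambda>q. fund_tensor L (q, V q) (Y q) (Z q)) =
    loc.K z a (cvec c (Y p)) (cvec c (Z p)) +
    2 * loc.C z (dd a (xrep c V) (cmap c p)) (cvec c (Y p)) (cvec c (Z p)) +
    loc.g z (dd a (xrep c Y) (cmap c p)) (cvec c (Z p)) + loc.g z (cvec c (Y p)) (dd a (xrep c Z) (cmap c p))"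
proof -
  let ?f = "\<lambda>q. fund_tensor L (q, V q) (Y q) (Z q)"
  let ?F = "\<lambda>x. loc.g (x, xrep c V x) (xrep c Y x) (xrep c Z x)" and ?U = "cmap c ` (cdom c \<inter> \<Omega>)"
  have fF: "?f q = ?F (cmap c q)" if "q \<in> \<Omega>" "q \<in> cdom c" for q
    using fund_tensor_g[OF that vf_tangent[OF Y that(1)] vf_tangent[OF Z that(1)]] that c by simp
  have "smooth_on ?U ?F"
    using V_tdom by (intro loc.g.smooth_along open_chart_image[OF c \<Omega>] smooth_V_curve xrep_smooth Y Z c \<Omega>) auto
  then have "?f \<in> smooth_at M p"
    by (rule smooth_at_vec_chart[OF c p(2) \<Omega> p(1), where F = ?F]) (rule fF)
  then have "v ?f = dd a (\<lambda>x. ?f (cinv c x)) (cmap c p)"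
    unfolding a_def by (rule tangent_apply[OF c p(2) v])
  also have "\<dots> = dd a ?F (cmap c p)"
    using fF c by (intro dd_cong[OF open_chart_image[OF c \<Omega>] cmap_image]) auto
  also have "\<dots> = dd (a, dd a (xrep c V) (cmap c p)) (\<lambda>z. loc.g z (xrep c Y (cmap c p)) (xrep c Z (cmap c p))) (cmap c p, xrep c V (cmap c p)) +
      loc.g (cmap c p, xrep c V (cmap c p)) (dd a (xrep c Y) (cmap c p)) (xrep c Z (cmap c p)) +
      loc.g (cmap c p, xrep c V (cmap c p)) (xrep c Y (cmap c p)) (dd a (xrep c Z) (cmap c p))"
    by (rule dd_eqI[OF loc.g.has_derivative_along[OF V_tdom[OF cmap_image] V_curve_derivative xrep_derivative[OF Y] xrep_derivative[OF Z]]])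
  finally show ?thesis
    using V_tdom'[OF p] c p by (simp add: loc.dd_g z_def)
qed

lemma conn_tangent: "chart_conn c V X Y p \<in> tangent_space M p"
  unfolding chart_conn_def by (rule tvec_tangent[OF c p(2)])

lemma cvec_conn: "cvec c (chart_conn c V X Y p) = dd (cvec c (X p)) (xrep c Y) (cmap c p) +
    Gc c (cmap c p, cvec c (V p)) (cvec c (X p)) (cvec c (Y p))"
  unfolding chart_conn_def by (rule cvec_tvec[OF c p(2)])

end

definition conn_rep :: "'m vfield \<Rightarrow> 'm vfield \<Rightarrow> real ^ 'n \<Rightarrow> real ^ 'n" where
  "conn_rep X Y x = dd (xrep c X x) (xrep c Y) x + Gc c (x, xrep c V x) (xrep c X x) (xrep c Y x)"

lemma xrep_conn: "x \<in> cmap c ` (cdom c \<inter> \<Omega>) \<Longrightarrow> xrep c (chart_conn c V X Y) x = conn_rep X Y x"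
  using c by (auto simp: conn_rep_def cvec_conn)

lemma smooth_conn_rep:
  assumes "X \<in> vector_fields M \<Omega>" "Y \<in> vector_fields M \<Omega>"
  shows "smooth_on (cmap c ` (cdom c \<inter> \<Omega>)) (conn_rep X Y)"
proof -
  let ?U = "cmap c ` (cdom c \<inter> \<Omega>)"
  note U = open_chart_image[OF c \<Omega>] and sX = xrep_smooth[OF assms(1) c \<Omega>] and sY = xrep_smooth[OF assms(2) c \<Omega>]
  have "smooth_on ?U (\<lambda>x. dd (xrep c X x) (xrep c Y) x)"
    by (rule smooth_on_linear_apply[OF U smooth_on_linear_dd[OF sY] _ sX])
       (use smooth_on_dd[OF sY] in auto)
  moreover have "smooth_on ?U (\<lambda>x. Gc c (x, xrep c V x) (xrep c X x) (xrep c Y x))"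
    by (rule loc.G.smooth_along[OF U _ smooth_V_curve sX sY]) (use V_tdom in auto)
  ultimately show ?thesis
    using smooth_on_add[OF U] by (simp add: conn_rep_def[abs_def])
qed

lemma conn_smooth_at:
  assumes "X \<in> vector_fields M \<Omega>" "Y \<in> vector_fields M \<Omega>" "p \<in> \<Omega>" "p \<in> cdom c"
  shows "(\<lambda>q. comp c (chart_conn c V X Y q) i) \<in> smooth_at M p"
proof (rule smooth_at_vec_chart[OF c assms(4) \<Omega> assms(3)])
  show "smooth_on (cmap c ` (cdom c \<inter> \<Omega>)) (\<lambda>x. conn_rep X Y x $ i)"
    by (rule smooth_on_vec_nth[OF open_chart_image[OF c \<Omega>] smooth_conn_rep[OF assms(1,2)]])
  show "comp c (chart_conn c V X Y q) i = conn_rep X Y (cmap c q) $ i" if "q \<in> \<Omega>" "q \<in> cdom c" for q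
    using that c by (simp add: cvec_nth[symmetric] cvec_conn conn_rep_def)
qed

lemma conn_is_chern:
  assumes sub: "\<Omega> \<subseteq> cdom c"
  shows "is_chern \<Omega> V (chart_conn c V)"
  unfolding is_chern_def
proof (intro conjI)
  have pc: "p \<in> cdom c" if "p \<in> \<Omega>" for p using sub that by auto
  show "affine_connection M \<Omega> (chart_conn c V)"
    unfolding affine_connection_def
  proof (intro conjI ballI allI impI)
    fix X Y assume XY: "X \<in> vector_fields M \<Omega>" "Y \<in> vector_fields M \<Omega>"
    show "chart_conn c V X Y \<in> vector_fields M \<Omega>"
      by (rule vector_fieldsI[OF \<Omega> conn_tangent[OF _ pc]]) (use conn_smooth_at[OF XY] pc c in blast)+
  next
    fix X Y Z p assume X: "X \<in> vector_fields M \<Omega>" and Y: "Y \<in> vector_fields M \<Omega>"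
      and Z: "Z \<in> vector_fields M \<Omega>" and p: "p \<in> \<Omega>"
    note p' = p pc[OF p]
    note lin = linear_add[OF loc.linear_G(1)[OF V_tdom'[OF p']]] linear_add[OF loc.linear_G(2)[OF V_tdom'[OF p']]]
      linear_add[OF has_derivative_linear[OF xrep_derivative[OF p' Z]]]
    show "chart_conn c V (X + Y) Z p = chart_conn c V X Z p + chart_conn c V Y Z p"
      by (rule cvec_eqD[OF c p'(2) conn_tangent[OF p'] tangent_space_add[OF conn_tangent[OF p'] conn_tangent[OF p']]])
         (simp add: cvec_conn[OF p'] lin)
    have "xrep c (Y + Z) = (\<lambda>x. xrep c Y x + xrep c Z x)"
      by (auto simp: xrep_def)
    then have "dd w (xrep c (Y + Z)) (cmap c p) = dd w (xrep c Y) (cmap c p) + dd w (xrep c Z) (cmap c p)" for w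
      using dd_eqI[OF has_derivative_add[OF xrep_derivative[OF p' Y] xrep_derivative[OF p' Z]]] by simp
    then show "chart_conn c V X (Y + Z) p = chart_conn c V X Y p + chart_conn c V X Z p"
      by (intro cvec_eqD[OF c p'(2) conn_tangent[OF p'] tangent_space_add[OF conn_tangent[OF p'] conn_tangent[OF p']]])
         (simp add: cvec_conn[OF p'] lin)
  next
    fix h X Y p assume h: "smooth_fun M \<Omega> h" and X: "X \<in> vector_fields M \<Omega>" and Y: "Y \<in> vector_fields M \<Omega>" and p: "p \<in> \<Omega>"
    note p' = p pc[OF p]
    note lin = linear_cmul[OF loc.linear_G(1)[OF V_tdom'[OF p']]] linear_cmul[OF loc.linear_G(2)[OF V_tdom'[OF p']]]
      linear_cmul[OF has_derivative_linear[OF xrep_derivative[OF p' Y]]]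
    show "chart_conn c V (h *\<^sub>f X) Y p = h p *\<^sub>t chart_conn c V X Y p"
      by (rule cvec_eqD[OF c p'(2) conn_tangent[OF p'] tangent_space_scale[OF conn_tangent[OF p']]])
         (simp add: cvec_conn[OF p'] lin vfscale_def scaleR_add_right)
    note hs = smooth_fun_smooth_at[OF h \<Omega> p]
    have "xrep c (h *\<^sub>f Y) = (\<lambda>x. h (cinv c x) *\<^sub>R xrep c Y x)"
      by (auto simp: xrep_def vfscale_def)
    then have "dd w (xrep c (h *\<^sub>f Y)) (cmap c p) =
        h p *\<^sub>R dd w (xrep c Y) (cmap c p) + dd w (\<lambda>x. h (cinv c x)) (cmap c p) *\<^sub>R cvec c (Y p)" for w
      using dd_eqI[OF has_derivative_scaleR[OF smooth_at_derivative[OF c p'(2) hs] xrep_derivative[OF p' Y]]] c p'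
      by simp
    then show "chart_conn c V X (h *\<^sub>f Y) p = X p h *\<^sub>t Y p + h p *\<^sub>t chart_conn c V X Y p"
      using tangent_apply[OF c p'(2) vf_tangent[OF X p] hs]
      by (intro cvec_eqD[OF c p'(2) conn_tangent[OF p'] tangent_space_add[OF tangent_space_scale[OF vf_tangent[OF Y p]]
              tangent_space_scale[OF conn_tangent[OF p']]]])
         (simp add: cvec_conn[OF p'] lin vfscale_def scaleR_add_right)
  qed
  show "torsion_free M \<Omega> (chart_conn c V)"
    unfolding torsion_free_def
  proof (intro ballI)
    fix X Y p assume X: "X \<in> vector_fields M \<Omega>" and Y: "Y \<in> vector_fields M \<Omega>" and p: "p \<in> \<Omega>"
    note p' = p pc[OF p]
    show "chart_conn c V X Y p - chart_conn c V Y X p = lie_bracket M X Y p"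
      by (rule cvec_eqD[OF c p'(2) tangent_space_diff[OF conn_tangent[OF p'] conn_tangent[OF p']]
            vf_tangent[OF lie_bracket_vf[OF X Y \<Omega>] p]])
         (simp add: cvec_conn[OF p'] cvec_lie_bracket[OF c p'(2) X Y p \<Omega>] loc.G_commute[OF V_tdom'[OF p'], of "cvec c (X p)"])
  qed
  show "almost_metric M L \<Omega> V (chart_conn c V)"
    unfolding almost_metric_def
  proof (intro ballI)
    fix X Y Z p assume X: "X \<in> vector_fields M \<Omega>" and Y: "Y \<in> vector_fields M \<Omega>"
      and Z: "Z \<in> vector_fields M \<Omega>" and p: "p \<in> \<Omega>"
    note p' = p pc[OF p]
    note z = V_tdom'[OF p']
    note lin = linear_add[OF loc.linear_g(1)[OF z]] linear_add[OF loc.linear_g(2)[OF z]] linear_add[OF loc.linear_C(1)[OF z]]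
    \<comment> \<open>\<open>G_compatible\<close> splits \<open>K\<close> into terms with
      \<open>G\<close>. Added to the derivatives of \<open>Y\<close>, \<open>Z\<close> and
      \<open>V\<close> in \<open>metric_derivative\<close>, these complete the coordinates of the
      three covariant derivatives.\<close>
    show "X p (\<lambda>q. fund_tensor L (q, V q) (Y q) (Z q)) =
        fund_tensor L (p, V p) (chart_conn c V X Y p) (Z p) + fund_tensor L (p, V p) (Y p) (chart_conn c V X Z p) +
        2 * cartan_tensor L (p, V p) (chart_conn c V X V p) (Y p) (Z p)"
      using loc.G_compatible[OF z, of "cvec c (X p)" "cvec c (Y p)" "cvec c (Z p)"]
      by (simp add: metric_derivative[OF p' vf_tangent[OF X p] Y Z] fund_tensor_g[OF p'] cartan_tensor_C[OF p']
          conn_tangent[OF p'] vf_tangent[OF X p] vf_tangent[OF Y p] vf_tangent[OF Z p] cvec_conn[OF p'] lin)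
  qed
qed

end

end

section \<open>Existence and uniqueness of the Chern connection\<close>

lemma tscale_simps [simp]: "0 *\<^sub>t v = 0" "1 *\<^sub>t v = v" "a *\<^sub>t 0 = 0"
  by (auto simp: tscale_def)

lemma vfield_sum_apply: "(\<Sum>i\<in>I. X i) q = (\<Sum>i\<in>I. (X i :: 'm vfield) q)"
proof (induction I rule: infinite_finite_induct)
  case (infinite I)
  show ?case by (simp only: sum.infinite[OF infinite] zero_fun_apply)
next
  case empty
  show ?case by (simp only: sum.empty zero_fun_apply)
next
  case (insert i I)
  then show ?case by (simp only: sum.insert[OF insert(1,2)] plus_fun_apply)
qed

context finsler_manifold begin

text \<open>A coordinate frame cut off by a bump function consists of fields on all of \<Omega> and
  is unchanged near \<open>p\<close>. The Leibniz rule then expresses \<open>D\<close> at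
  \<open>p\<close> by its values \<open>H\<close> on this frame, and torsion-freeness and
  almost-metricity become the hypotheses of \<open>G_unique\<close>.\<close>

lemma is_chern_unique:
  assumes c: "c \<in> M" and \<Omega>: "open \<Omega>" and V: "admissible M A \<Omega> V" and D: "is_chern \<Omega> V D"
    and p: "p \<in> \<Omega>" "p \<in> cdom c" and X: "X \<in> vector_fields M \<Omega>" and Y: "Y \<in> vector_fields M \<Omega>"
  shows "D X Y p = chart_conn c V X Y p"
proof -
  interpret loc: local_finsler "tdom M c A" "Lc c"
    by (rule local_finsler[OF c])
  let ?x = "cmap c p" and ?e = "\<lambda>i. axis i 1 :: real ^ 'n"
  let ?z = "(?x, cvec c (V p))"
  note z = V_tdom'[OF c \<Omega> V p] and Vvf = V_vf[OF c \<Omega> V]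
  have aff: "affine_connection M \<Omega> D" and tor: "torsion_free M \<Omega> D" and met: "almost_metric M L \<Omega> V D"
    using D by (auto simp: is_chern_def)
  have D_vf: "D X Y \<in> vector_fields M \<Omega>"
    and D_add: "D (X + Y) Z p = D X Z p + D Y Z p" "D X (Y + Z) p = D X Y p + D X Z p"
    if "X \<in> vector_fields M \<Omega>" "Y \<in> vector_fields M \<Omega>" "Z \<in> vector_fields M \<Omega>" for X Y Z
    using aff that p(1) by (auto simp: affine_connection_def)
  have D_scale: "D (h *\<^sub>f X) Y p = h p *\<^sub>t D X Y p" "D X (h *\<^sub>f Y) p = X p h *\<^sub>t Y p + h p *\<^sub>t D X Y p"
    if "smooth_fun M \<Omega> h" "X \<in> vector_fields M \<Omega>" "Y \<in> vector_fields M \<Omega>" for h X Y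
    using aff that p(1) by (auto simp: affine_connection_def)
  have D_0: "D X 0 p = 0" "D 0 X p = 0" if "X \<in> vector_fields M \<Omega>" for X
    using D_add(2)[OF that vf_zero[OF \<Omega>] vf_zero[OF \<Omega>]] D_add(1)[OF vf_zero[OF \<Omega>] vf_zero[OF \<Omega>] that]
    by (simp_all only: add_0 add_cancel_right_right)
  have D_sum: "D X (\<Sum>i\<in>I. F i) p = (\<Sum>i\<in>I. D X (F i) p)" "D (\<Sum>i\<in>I. F i) X p = (\<Sum>i\<in>I. D (F i) X p)"
    if F: "\<And>i. F i \<in> vector_fields M \<Omega>" and X: "X \<in> vector_fields M \<Omega>" for F X and I :: "'n set"
  proof -
    have "D X (\<Sum>i\<in>I. F i) p = (\<Sum>i\<in>I. D X (F i) p) \<and> D (\<Sum>i\<in>I. F i) X p = (\<Sum>i\<in>I. D (F i) X p)"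
      using finite[of I]
    proof (induction I rule: finite_induct)
      case empty
      show ?case by (simp only: sum.empty D_0[OF X])
    next
      case (insert i I)
      then show ?case
        using D_add(2)[OF X F[of i] vf_sum[OF F \<Omega>, where I = I]] D_add(1)[OF F[of i] vf_sum[OF F \<Omega>, where I = I] X]
        by (simp only: sum.insert[OF insert(1,2)])
    qed
    then show "D X (\<Sum>i\<in>I. F i) p = (\<Sum>i\<in>I. D X (F i) p)" "D (\<Sum>i\<in>I. F i) X p = (\<Sum>i\<in>I. D (F i) X p)"
      by blast+
  qed
  obtain h K U where h: "\<And>q. h \<in> smooth_at M q" and K: "closed K" "K \<subseteq> cdom c \<inter> \<Omega>" "\<And>q. q \<notin> K \<Longrightarrow> h q = (0::real)"
    and U: "open U" "p \<in> U" "U \<subseteq> K" "\<And>q. q \<in> U \<Longrightarrow> h q = 1"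
    using bump[OF c p(2,1) \<Omega>] by metis
  have Kc: "q \<in> cdom c" "q \<in> \<Omega>" if "q \<in> K" for q using K(2) that by auto
  have cutoff: "f \<in> smooth_at M q"
    if "\<And>q. q \<notin> K \<Longrightarrow> f q = 0" "q \<in> K \<Longrightarrow> f \<in> smooth_at M q" for f q
    using that smooth_at_cong[OF smooth_at_const[of 0], of "- K" q f] K(1) by (cases "q \<in> K") auto
  \<comment> \<open>Outside the chart domain \<open>tvec M c q a\<close> has no meaning, but
    \<open>h\<close> vanishes there.\<close>
  define E where "E a = (\<lambda>q. h q *\<^sub>t tvec M c q a)" for a
  have E_tangent: "E a q \<in> tangent_space M q" for a q
    using tangent_space_scale[OF tvec_tangent[OF c Kc(1)]] K(3) vf_tangent[OF vf_zero[OF open_UNIV], of q]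
    by (cases "q \<in> K") (simp_all add: E_def)
  have cvec_E: "cvec c (E a q) = h q *\<^sub>R a" if "q \<in> K" for a q
    using cvec_tvec[OF c Kc(1)[OF that]] by (simp add: E_def)
  have E_vf: "E a \<in> vector_fields M \<Omega>" for a
  proof (rule vector_fieldsI[OF \<Omega> E_tangent])
    fix q assume "q \<in> \<Omega>"
    show "\<exists>d\<in>M. q \<in> cdom d \<and> (\<forall>i. (\<lambda>q. comp d (E a q) i) \<in> smooth_at M q)"
    proof (cases "q \<in> K")
      case True
      have "(\<lambda>q. comp c (E a q) i) \<in> smooth_at M q" for i
      proof (rule smooth_at_cong[OF smooth_at_mult[OF h smooth_at_const[of "a $ i"]] chart_open(1)[OF c] Kc(1)[OF True]])
        fix q assume "q \<in> cdom c"
        then show "h q * a $ i = comp c (E a q) i"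
          using cvec_tvec[OF c, of q a] by (simp add: cvec_nth[symmetric] E_def)
      qed
      then show ?thesis using c Kc(1)[OF True] by blast
    next
      case False
      obtain d where d: "d \<in> M" "q \<in> cdom d" using ex_chart by blast
      have "(\<lambda>q. comp d (E a q) i) \<in> smooth_at M q" for i
        using False K(1,3) by (intro smooth_at_cong[OF smooth_at_const[of 0], of "- K"]) (auto simp: E_def comp_def tscale_def)
      then show ?thesis using d by blast
    qed
  qed
  have E_p: "cvec c (E a p) = a" for a
    using cvec_E[of p a] U by auto
  have dd_E: "dd w (xrep c (E a)) ?x = 0" for w a
  proof -
    have "dd w (xrep c (E a)) ?x = dd w (\<lambda>x. a) ?x"
      using U c cvec_E Kc by (intro dd_cong[OF open_chart_image[OF c U(1)]]) (auto simp: xrep_def)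
    then show ?thesis by (simp add: dd_def)
  qed
  \<comment> \<open>Two factors of \<open>h\<close> are needed for a global expansion: one turns the
    components of a field into smooth functions on \<Omega>, the other sits in the frame field
    \<open>E\<close>.\<close>
  have hh: "smooth_fun M \<Omega> (\<lambda>q. h q * h q)"
    by (intro smooth_fun_local smooth_at_mult h)
  have frame: "(\<lambda>q. h q * h q) *\<^sub>f Y = (\<Sum>i\<in>UNIV. (\<lambda>q. h q * comp c (Y q) i) *\<^sub>f E (?e i))"
    and coeff: "smooth_fun M \<Omega> (\<lambda>q. h q * comp c (Y q) i)" if Y: "Y \<in> vector_fields M \<Omega>" for Y i
  proof -
    show "smooth_fun M \<Omega> (\<lambda>q. h q * comp c (Y q) i)"
      by (rule smooth_fun_local, rule cutoff)
         (use K(3) smooth_at_mult[OF h vf_comp[OF Y \<Omega> Kc(2) c Kc(1)]] in auto)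
    show "(\<lambda>q. h q * h q) *\<^sub>f Y = (\<Sum>i\<in>UNIV. (\<lambda>q. h q * comp c (Y q) i) *\<^sub>f E (?e i))"
    proof
      fix q
      show "((\<lambda>q. h q * h q) *\<^sub>f Y) q = (\<Sum>i\<in>UNIV. (\<lambda>q. h q * comp c (Y q) i) *\<^sub>f E (?e i)) q"
        unfolding vfield_sum_apply
      proof (cases "q \<in> K")
        case True
        show "((\<lambda>q. h q * h q) *\<^sub>f Y) q = (\<Sum>i\<in>UNIV. ((\<lambda>q. h q * comp c (Y q) i) *\<^sub>f E (?e i)) q)"
          unfolding vfscale_def
        proof (rule cvec_eqD[OF c Kc(1)[OF True]])
          show "(h q * h q) *\<^sub>t Y q \<in> tangent_space M q"
            by (rule tangent_space_scale[OF vf_tangent[OF Y Kc(2)[OF True]]])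
          show "(\<Sum>i\<in>UNIV. (h q * comp c (Y q) i) *\<^sub>t E (?e i) q) \<in> tangent_space M q"
            by (intro tangent_space_sum tangent_space_scale E_tangent)
          have "(h q * h q) *\<^sub>R cvec c (Y q) = (h q * h q) *\<^sub>R (\<Sum>i\<in>UNIV. cvec c (Y q) $ i *\<^sub>R ?e i)"
            by (simp only: vec_axis_expansion)
          then show "cvec c ((h q * h q) *\<^sub>t Y q) = cvec c (\<Sum>i\<in>UNIV. (h q * comp c (Y q) i) *\<^sub>t E (?e i) q)"
            by (simp add: cvec_E[OF True] scaleR_sum_right cvec_nth mult.commute mult.left_commute)
        qed
      next
        case False
        have "(\<Sum>i\<in>UNIV. ((\<lambda>q. h q * comp c (Y q) i) *\<^sub>f E (?e i)) q) = 0"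
          using K(3)[OF False] by (intro sum.neutral) (simp add: vfscale_def)
        then show "((\<lambda>q. h q * h q) *\<^sub>f Y) q = (\<Sum>i\<in>UNIV. ((\<lambda>q. h q * comp c (Y q) i) *\<^sub>f E (?e i)) q)"
          using K(3)[OF False] by (simp only: vfscale_def mult_zero_left tscale_simps)
      qed
    qed
  qed
  have cE_vf: "(\<lambda>q. h q * comp c (Y q) i) *\<^sub>f E a \<in> vector_fields M \<Omega>" if "Y \<in> vector_fields M \<Omega>" for Y i a
    using smooth_fun_smooth_at[OF coeff[OF that] \<Omega>] by (intro vf_scale E_vf \<Omega>)
  have right: "cvec c (D X Y p) = dd (cvec c (X p)) (xrep c Y) ?x + (\<Sum>i\<in>UNIV. cvec c (Y p) $ i *\<^sub>R cvec c (D X (E (?e i)) p))"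
    if X: "X \<in> vector_fields M \<Omega>" and Y: "Y \<in> vector_fields M \<Omega>" for X Y
  proof -
    note Xp = vf_tangent[OF X p(1)]
    \<comment> \<open>The square of \<open>h\<close> is 1 near \<open>p\<close>, so its derivative
      vanishes there and replacing \<open>Y\<close> by its cut-off does not change
      \<open>D X Y p\<close>.\<close>
    have "X p (\<lambda>q. h q * h q) = X p (\<lambda>q. 1)"
      using U by (intro tangent_cong[OF Xp U(1,2)]) auto
    then have "D X Y p = D X ((\<lambda>q. h q * h q) *\<^sub>f Y) p"
      using tangent_const[OF Xp] D_scale(2)[OF hh X Y] U(2,4) by simp
    also have "\<dots> = (\<Sum>i\<in>UNIV. D X ((\<lambda>q. h q * comp c (Y q) i) *\<^sub>f E (?e i)) p)"
      unfolding frame[OF Y] by (rule D_sum(1)[OF cE_vf[OF Y] X])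
    finally have *: "cvec c (D X Y p) = (\<Sum>i\<in>UNIV. cvec c (D X ((\<lambda>q. h q * comp c (Y q) i) *\<^sub>f E (?e i)) p))"
      by simp
    have **: "cvec c (D X ((\<lambda>q. h q * comp c (Y q) i) *\<^sub>f E (?e i)) p) =
        dd (cvec c (X p)) (xrep c Y) ?x $ i *\<^sub>R ?e i + cvec c (Y p) $ i *\<^sub>R cvec c (D X (E (?e i)) p)" for i
    proof -
      have "X p (\<lambda>q. h q * comp c (Y q) i) = X p (\<lambda>q. comp c (Y q) i)"
        using U by (intro tangent_cong[OF Xp U(1,2)]) auto
      then show ?thesis
        using D_scale(2)[OF coeff[OF Y] X E_vf] tangent_apply_comp[OF c p(2) Xp Y p(1) \<Omega>] U(2,4)
        by (simp add: E_p cvec_nth)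
    qed
    show ?thesis unfolding * ** by (simp add: sum.distrib vec_axis_expansion)
  qed
  have left: "cvec c (D X Y p) = (\<Sum>j\<in>UNIV. cvec c (X p) $ j *\<^sub>R cvec c (D (E (?e j)) Y p))"
    if X: "X \<in> vector_fields M \<Omega>" and Y: "Y \<in> vector_fields M \<Omega>" for X Y
  proof -
    have "D X Y p = D ((\<lambda>q. h q * h q) *\<^sub>f X) Y p"
      using D_scale(1)[OF hh X Y] U(2,4) by simp
    also have "\<dots> = (\<Sum>j\<in>UNIV. D ((\<lambda>q. h q * comp c (X q) j) *\<^sub>f E (?e j)) Y p)"
      unfolding frame[OF X] by (rule D_sum(2)[OF cE_vf[OF X] Y])
    finally have "cvec c (D X Y p) = (\<Sum>j\<in>UNIV. cvec c (D ((\<lambda>q. h q * comp c (X q) j) *\<^sub>f E (?e j)) Y p))"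
      by simp
    then show ?thesis
      using D_scale(1)[OF coeff[OF X] E_vf Y] U(2,4) by (simp add: cvec_nth)
  qed
  define H where "H a b = cvec c (D (E a) (E b) p)" for a b
  have formula: "cvec c (D X Y p) = dd (cvec c (X p)) (xrep c Y) ?x + H (cvec c (X p)) (cvec c (Y p))"
    if X: "X \<in> vector_fields M \<Omega>" and Y: "Y \<in> vector_fields M \<Omega>" for X Y
  proof -
    \<comment> \<open>The components of \<open>E a\<close> are constant near \<open>p\<close>, so
      \<open>right\<close> has no derivative term on frame fields, and together with
      \<open>left\<close> it gives the bilinear expansion of \<open>H\<close>.\<close>
    have "H a b = (\<Sum>i\<in>UNIV. b $ i *\<^sub>R (\<Sum>j\<in>UNIV. a $ j *\<^sub>R H (?e j) (?e i)))" for a b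
    proof -
      have 1: "cvec c (D (E a) (E b) p) = (\<Sum>i\<in>UNIV. b $ i *\<^sub>R cvec c (D (E a) (E (?e i)) p))"
        using right[OF E_vf E_vf, of a b] by (simp only: E_p dd_E add_0)
      have 2: "cvec c (D (E a) (E (?e i)) p) = (\<Sum>j\<in>UNIV. a $ j *\<^sub>R cvec c (D (E (?e j)) (E (?e i)) p))" for i
        using left[OF E_vf E_vf, of a "?e i"] by (simp only: E_p)
      show ?thesis unfolding H_def 1 unfolding 2 ..
    qed
    then show ?thesis
      unfolding right[OF X Y] left[OF X E_vf] H_def by metis
  qed
  \<comment> \<open>Fields with constant components near \<open>p\<close> commute at
    \<open>p\<close>, so absence of torsion is symmetry of \<open>H\<close>.\<close>
  have "H a b = H b a" for a b
  proof -
    have "D (E a) (E b) p - D (E b) (E a) p = lie_bracket M (E a) (E b) p"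
      using tor E_vf p(1) by (simp only: torsion_free_def)
    then have "cvec c (D (E a) (E b) p - D (E b) (E a) p) = 0"
      by (simp only: cvec_lie_bracket[OF c p(2) E_vf E_vf p(1) \<Omega>] dd_E diff_self)
    then show ?thesis by (simp add: H_def)
  qed
  \<comment> \<open>On frame fields the derivatives of the arguments drop out. The dV part of
    \<open>D (E k) V p\<close> cancels the Cartan term of \<open>metric_derivative\<close>, which
    leaves a purely algebraic condition on \<open>H\<close>.\<close>
  moreover have "loc.K ?z k a b = loc.g ?z (H k a) b + loc.g ?z a (H k b) + 2 * loc.C ?z (H k (snd ?z)) a b" for k a b
  proof -
    have t: "D (E k) Y p \<in> tangent_space M p" if "Y \<in> vector_fields M \<Omega>" for Y
      using vf_tangent[OF D_vf[OF E_vf that that] p(1)] .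
    have "E k p (\<lambda>q. fund_tensor L (q, V q) (E a q) (E b q)) =
      fund_tensor L (p, V p) (D (E k) (E a) p) (E b p) + fund_tensor L (p, V p) (E a p) (D (E k) (E b) p) +
      2 * cartan_tensor L (p, V p) (D (E k) V p) (E a p) (E b p)"
      using met E_vf p(1) unfolding almost_metric_def by blast
    then show ?thesis
      using formula[OF E_vf Vvf, of k] linear_add[OF loc.linear_C(1)[OF z]]
        linear_0[OF loc.linear_g(1)[OF z]] linear_0[OF loc.linear_g(2)[OF z]]
      by (simp add: metric_derivative[OF c \<Omega> V p E_tangent E_vf E_vf] fund_tensor_g[OF c \<Omega> V p]
          cartan_tensor_C[OF c \<Omega> V p] t E_vf Vvf E_tangent E_p dd_E H_def[symmetric])
  qed
  ultimately have "H a b = Gc c ?z a b" for a b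
    by (rule loc.G_unique[OF z])
  then show ?thesis
    using formula[OF X Y]
    by (intro cvec_eqD[OF c p(2) vf_tangent[OF D_vf[OF X Y Y] p(1)] conn_tangent[OF c \<Omega> V p]])
       (simp add: cvec_conn[OF c \<Omega> V p])
qed

lemma admissible_subset: "admissible M A \<Omega> V \<Longrightarrow> W \<subseteq> \<Omega> \<Longrightarrow> admissible M A W V"
  by (auto simp: admissible_def vf_subset)

text \<open>Uniqueness replaces a computation with the transformation law of \<Gamma>: on the
  overlap the formula of \<open>c\<close> defines a Chern connection, and any such connection is
  given by the formula of \<open>d\<close>.\<close>

lemma conn_chart_independent:
  assumes c: "c \<in> M" and d: "d \<in> M" and \<Omega>: "open \<Omega>" and V: "admissible M A \<Omega> V"
    and p: "p \<in> \<Omega>" "p \<in> cdom c" "p \<in> cdom d" and X: "X \<in> vector_fields M \<Omega>" and Y: "Y \<in> vector_fields M \<Omega>"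
  shows "chart_conn c V X Y p = chart_conn d V X Y p"
proof (rule is_chern_unique[OF d])
  let ?W = "\<Omega> \<inter> cdom c \<inter> cdom d"
  show W: "open ?W" using \<Omega> chart_open(1)[OF c] chart_open(1)[OF d] by auto
  show V': "admissible M A ?W V" by (rule admissible_subset[OF V]) auto
  show "is_chern ?W V (chart_conn c V)" by (rule conn_is_chern[OF c W V']) auto
  show "X \<in> vector_fields M ?W" "Y \<in> vector_fields M ?W"
    by (rule vf_subset[OF X], blast, rule vf_subset[OF Y], blast)
qed (use p in auto)

text \<open>A chart is chosen at each point. The algebraic axioms, torsion and metricity are
  equations at one point, hence hold by the result for the chart chosen there; smoothness compares
  neighbouring points and rests on chart independence.\<close>

lemma is_chern_exists:
  assumes \<Omega>: "open \<Omega>" and V: "admissible M A \<Omega> V"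
  shows "\<exists>D. is_chern \<Omega> V D"
proof -
  define ch where "ch p = (SOME c. c \<in> M \<and> p \<in> cdom c)" for p
  have ch: "ch p \<in> M" "p \<in> cdom (ch p)" for p
    using someI_ex[of "\<lambda>c. c \<in> M \<and> p \<in> cdom c"] ex_chart[of p] unfolding ch_def by blast+
  define D where "D X Y p = chart_conn (ch p) V X Y p" for X Y p
  have D: "D X Y p = chart_conn c V X Y p"
    if "c \<in> M" "p \<in> cdom c" "p \<in> \<Omega>" "X \<in> vector_fields M \<Omega>" "Y \<in> vector_fields M \<Omega>" for c X Y p
    unfolding D_def using that ch by (intro conn_chart_independent[OF _ _ \<Omega> V]) auto
  let ?W = "\<lambda>p. \<Omega> \<inter> cdom (ch p)"
  have W: "open (?W p)" "p \<in> \<Omega> \<Longrightarrow> p \<in> ?W p" "?W p \<subseteq> \<Omega>" for p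
    using \<Omega> chart_open(1)[OF ch(1)] ch(2) by auto
  have chern: "is_chern (?W p) V (chart_conn (ch p) V)" for p
    by (rule conn_is_chern[OF ch(1) W(1) admissible_subset[OF V W(3)]]) auto
  have aff: "affine_connection M (?W p) (chart_conn (ch p) V)" and tor: "torsion_free M (?W p) (chart_conn (ch p) V)"
    and met: "almost_metric M L (?W p) V (chart_conn (ch p) V)" for p
    using chern by (auto simp: is_chern_def)
  have sub: "X \<in> vector_fields M (?W p)" if "X \<in> vector_fields M \<Omega>" for X p
    using vf_subset[OF that W(3)] .
  have Dp: "D X Y p = chart_conn (ch p) V X Y p" for X Y p by (simp add: D_def)
  have "affine_connection M \<Omega> D"
    unfolding affine_connection_def
  proof (intro conjI ballI allI impI)
    fix X Y assume X: "X \<in> vector_fields M \<Omega>" and Y: "Y \<in> vector_fields M \<Omega>"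
    show "D X Y \<in> vector_fields M \<Omega>"
    proof (rule vector_fieldsI[OF \<Omega>])
      fix p assume p: "p \<in> \<Omega>"
      show "D X Y p \<in> tangent_space M p"
        unfolding Dp by (rule conn_tangent[OF ch(1) \<Omega> V p ch(2)])
      \<comment> \<open>At a nearby \<open>q\<close> the connection was defined with
        \<open>ch q\<close>; it is rewritten in the fixed chart \<open>ch p\<close>.\<close>
      have "(\<lambda>q. comp (ch p) (D X Y q) i) \<in> smooth_at M p" for i
        by (rule smooth_at_cong[OF conn_smooth_at[OF ch(1) \<Omega> V X Y p ch(2)] W(1) W(2)[OF p]])
           (use D[OF ch(1) _ _ X Y] in auto)
      then show "\<exists>c\<in>M. p \<in> cdom c \<and> (\<forall>i. (\<lambda>q. comp c (D X Y q) i) \<in> smooth_at M p)"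
        using ch by blast
    qed
  next
    fix X Y Z p assume "X \<in> vector_fields M \<Omega>" "Y \<in> vector_fields M \<Omega>" "Z \<in> vector_fields M \<Omega>" "p \<in> \<Omega>"
    then show "D (X + Y) Z p = D X Z p + D Y Z p" "D X (Y + Z) p = D X Y p + D X Z p"
      using aff[of p] sub[of _ p] W(2)[of p] unfolding affine_connection_def Dp by blast+
  next
    fix h X Y p assume h: "smooth_fun M \<Omega> h" and "X \<in> vector_fields M \<Omega>" "Y \<in> vector_fields M \<Omega>" "p \<in> \<Omega>"
    then show "D (h *\<^sub>f X) Y p = h p *\<^sub>t D X Y p" "D X (h *\<^sub>f Y) p = X p h *\<^sub>t Y p + h p *\<^sub>t D X Y p"
      using aff[of p] sub[of _ p] W(2)[of p] smooth_fun_subset[OF h W(3)[of p]]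
      unfolding affine_connection_def Dp by blast+
  qed
  moreover have "torsion_free M \<Omega> D"
    unfolding torsion_free_def Dp
  proof (intro ballI)
    fix X Y p assume "X \<in> vector_fields M \<Omega>" "Y \<in> vector_fields M \<Omega>" "p \<in> \<Omega>"
    then show "chart_conn (ch p) V X Y p - chart_conn (ch p) V Y X p = lie_bracket M X Y p"
      using tor[of p] sub[of _ p] W(2)[of p] unfolding torsion_free_def by blast
  qed
  moreover have "almost_metric M L \<Omega> V D"
    unfolding almost_metric_def Dp
  proof (intro ballI)
    fix X Y Z p assume "X \<in> vector_fields M \<Omega>" "Y \<in> vector_fields M \<Omega>" "Z \<in> vector_fields M \<Omega>" "p \<in> \<Omega>"
    then show "X p (\<lambda>q. fund_tensor L (q, V q) (Y q) (Z q)) =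
        fund_tensor L (p, V p) (chart_conn (ch p) V X Y p) (Z p) + fund_tensor L (p, V p) (Y p) (chart_conn (ch p) V X Z p) +
        2 * cartan_tensor L (p, V p) (chart_conn (ch p) V X V p) (Y p) (Z p)"
      using met[of p] sub[of _ p] W(2)[of p] unfolding almost_metric_def by blast
  qed
  ultimately show ?thesis unfolding is_chern_def by blast
qed

lemma is_chern_chern:
  assumes "open \<Omega>" "admissible M A \<Omega> V"
  shows "is_chern \<Omega> V (chern M L \<Omega> V)"
  using someI_ex[OF is_chern_exists[OF assms]] unfolding chern_def is_chern_def .

lemma chern_eq_conn:
  assumes "c \<in> M" "open \<Omega>" "admissible M A \<Omega> V" "p \<in> \<Omega>" "p \<in> cdom c"
    "X \<in> vector_fields M \<Omega>" "Y \<in> vector_fields M \<Omega>"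
  shows "chern M L \<Omega> V X Y p = chart_conn c V X Y p"
  using is_chern_unique[OF assms(1-3) is_chern_chern[OF assms(2,3)] assms(4-7)] .

end

section \<open>Curvature\<close>

lemma dd_nth: "f differentiable (at x) \<Longrightarrow> dd v (\<lambda>x. f x $ i) x = dd v f x $ i"
  by (intro dd_eqI bounded_linear.has_derivative[OF bounded_linear_vec_nth] has_derivative_dd)

lemma dd_commute_vec:
  fixes f :: "'e::euclidean_space \<Rightarrow> real ^ 'n::finite"
  assumes S: "open S" "smooth_on S f" "x \<in> S"
  shows "dd u (dd v f) x = dd v (dd u f) x"
proof -
  have "dd u (dd v f) x $ i = dd u (dd v (\<lambda>x. f x $ i)) x" for u v i
  proof -
    have "dd u (dd v f) x $ i = dd u (\<lambda>x. dd v f x $ i) x"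
      by (rule dd_nth[OF smooth_on_differentiable[OF smooth_on_dd[OF S(2)] S(3)], symmetric])
    also have "\<dots> = dd u (dd v (\<lambda>x. f x $ i)) x"
      by (intro dd_cong[OF S(1,3)] dd_nth[symmetric] smooth_on_differentiable[OF S(2)])
    finally show ?thesis .
  qed
  then show ?thesis
    using dd_commute[OF S(1) smooth_on_vec_nth[OF S(1,2)] S(3)] by (simp add: vec_eq_iff)
qed

lemma has_derivative_dd_along:
  fixes Y Z :: "real ^ 'n::finite \<Rightarrow> real ^ 'n"
  assumes U: "open U" "x \<in> U" and Y: "smooth_on U Y" and Z: "smooth_on U Z"
  shows "((\<lambda>x. dd (Y x) Z x) has_derivative (\<lambda>w. dd (Y x) (dd w Z) x + dd (dd w Y x) Z x)) (at x)"
proof -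
  let ?e = "\<lambda>i. axis i 1 :: real ^ 'n"
  have expand: "dd u Z y = (\<Sum>i\<in>UNIV. u $ i *\<^sub>R dd (?e i) Z y)" if "y \<in> U" for u y
    by (rule linear_axis_expansion[OF smooth_on_linear_dd[OF Z that]])
  \<comment> \<open>Symmetry of second derivatives moves the varying direction to the outer
    position, where linearity is that of an ordinary Frechet derivative.\<close>
  have expand2: "dd u (dd w Z) x = (\<Sum>i\<in>UNIV. u $ i *\<^sub>R dd w (dd (?e i) Z) x)" for u w
    using linear_axis_expansion[OF smooth_on_linear_dd[OF smooth_on_dd[OF Z] U(2)], of u w]
      dd_commute_vec[OF U(1) Z U(2), of w] by simp
  have "((\<lambda>x. \<Sum>i\<in>UNIV. Y x $ i *\<^sub>R dd (?e i) Z x) has_derivative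
      (\<lambda>w. \<Sum>i\<in>UNIV. Y x $ i *\<^sub>R dd w (dd (?e i) Z) x + dd w Y x $ i *\<^sub>R dd (?e i) Z x)) (at x)"
    by (intro has_derivative_sum has_derivative_scaleR bounded_linear.has_derivative[OF bounded_linear_vec_nth]
        smooth_on_has_derivative[OF Y U(2)] smooth_on_has_derivative[OF smooth_on_dd[OF Z] U(2)])
  then have "((\<lambda>x. \<Sum>i\<in>UNIV. Y x $ i *\<^sub>R dd (?e i) Z x) has_derivative
      (\<lambda>w. dd (Y x) (dd w Z) x + dd (dd w Y x) Z x)) (at x)"
    by (simp only: sum.distrib expand2[of "Y x", symmetric] expand[OF U(2), of "dd _ Y x", symmetric])
  then show ?thesis
    by (rule has_derivative_transform_within_open[OF _ U]) (rule expand[symmetric])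
qed

context smooth_bilinear_field begin

lemma linear_dd_left: "z \<in> T \<Longrightarrow> linear (\<lambda>a. dd v (\<lambda>z. B z a b) z)"
  by (rule linearI) (simp_all add: dd_expansion[where b = b] sum.distrib scaleR_add_left scaleR_sum_right distrib_right mult.assoc)

lemma linear_dd_right: "z \<in> T \<Longrightarrow> linear (\<lambda>b. dd v (\<lambda>z. B z a b) z)"
  by (rule linearI) (simp_all add: dd_expansion[where a = a] sum.distrib scaleR_add_left scaleR_sum_right distrib_left mult.left_commute)

end

context local_finsler begin

text \<open>\<open>Q z a b d\<close> is \<open>R\<^sub>z(a, b)d\<close>; the vector \<open>(a, - \<Gamma>(y, a))\<close> is the horizontal lift \<open>a\<^sup>k \<delta>/\<delta>x\<^sup>k\<close>.\<close>

definition Q where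
  "Q z a b d = dd (a, - G z (snd z) a) (\<lambda>z. G z d b) z - dd (b, - G z (snd z) b) (\<lambda>z. G z d a) z +
     G z (G z d b) a - G z (G z d a) b"

context fixes z assumes z: "z \<in> T" begin

lemmas G_simps = linear_add[OF linear_G(1)[OF z]] linear_add[OF linear_G(2)[OF z]]
  linear_cmul[OF linear_G(1)[OF z]] linear_cmul[OF linear_G(2)[OF z]]
  linear_add[OF G.linear_dd_left[OF z]] linear_add[OF G.linear_dd_right[OF z]]
  linear_cmul[OF G.linear_dd_left[OF z]] linear_cmul[OF G.linear_dd_right[OF z]]

lemma dd_horizontal:
  "dd (a + a', - (u + u')) (\<lambda>z. G z d b) z = dd (a, - u) (\<lambda>z. G z d b) z + dd (a', - u') (\<lambda>z. G z d b) z"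
  "dd (r *\<^sub>R a, - (r *\<^sub>R u)) (\<lambda>z. G z d b) z = r *\<^sub>R dd (a, - u) (\<lambda>z. G z d b) z"
  using linear_add[OF smooth_on_linear_dd[OF smooth_G z], of "(a, - u)" "(a', - u')" d b]
    linear_cmul[OF smooth_on_linear_dd[OF smooth_G z], of r "(a, - u)" d b] by (simp_all add: add.commute)

lemma linear_Q: "linear (\<lambda>a. Q z a b d)" "linear (\<lambda>b. Q z a b d)" "linear (\<lambda>d. Q z a b d)"
  by (auto intro!: linearI simp: Q_def G_simps dd_horizontal algebra_simps simp del: minus_add_distrib)

lemma dd_G_horizontal:
  "dd (a, - u) (\<lambda>z. G z d b $ i) z = dd (a, 0) (\<lambda>z. G z d b $ i) z - (\<Sum>m\<in>UNIV. u $ m * dd (0, axis m 1) (\<lambda>z. G z d b $ i) z)"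
proof -
  have s: "smooth_on T (\<lambda>z. G z d b $ i)" by (rule smooth_on_vec_nth[OF open_T smooth_G])
  have "dd ((a, 0) - (0, u)) (\<lambda>z. G z d b $ i) z = dd (a, 0) (\<lambda>z. G z d b $ i) z - dd (0, u) (\<lambda>z. G z d b $ i) z"
    by (rule linear_diff[OF smooth_on_linear_dd[OF s z]])
  then show ?thesis
    using linear_axis_expansion[OF linear_vertical(1)[OF s z], of u] by simp
qed

end

end

section \<open>Christoffel symbols, Chern curvature and Chern tensor in terms of \<open>G\<close>
  and \<open>Q\<close>\<close>

context finsler_manifold begin

text \<open>Used in \<open>christoffel_eq\<close> both for the coordinate fields and for the local
  extension of a given vector of \<open>A\<close>.\<close>

lemma constant_field:
  assumes c: "c \<in> M" and W: "open W" "W \<subseteq> cdom c" and X: "\<And>q. q \<in> W \<Longrightarrow> X q = tvec M c q a"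
  shows "X \<in> vector_fields M W" "p \<in> W \<Longrightarrow> dd w (xrep c X) (cmap c p) = 0"
proof -
  show "X \<in> vector_fields M W"
  proof (rule vector_fieldsI[OF W(1)])
    fix p assume p: "p \<in> W"
    then show "X p \<in> tangent_space M p" using X[OF p] tvec_tangent[OF c] W(2) by auto
    have "(\<lambda>q. comp c (X q) i) \<in> smooth_at M p" for i
    proof (rule smooth_at_cong[OF smooth_at_const[of "a $ i"] W(1) p])
      fix q assume q: "q \<in> W"
      then have "cvec c (X q) = a" using X[OF q] cvec_tvec[OF c] W(2) by auto
      then show "a $ i = comp c (X q) i" by (simp add: cvec_nth[symmetric])
    qed
    then show "\<exists>c\<in>M. p \<in> cdom c \<and> (\<forall>i. (\<lambda>q. comp c (X q) i) \<in> smooth_at M p)"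
      using c W(2) p by blast
  qed
  assume p: "p \<in> W"
  have "dd w (xrep c X) (cmap c p) = dd w (\<lambda>x. a) (cmap c p)"
  proof (rule dd_cong[OF open_chart_image[OF c W(1)]])
    show "cmap c p \<in> cmap c ` (cdom c \<inter> W)" using p W by auto
    fix x assume "x \<in> cmap c ` (cdom c \<inter> W)"
    then have "cinv c x \<in> W" "cinv c x \<in> cdom c" using c by (auto simp: mem_chart_image)
    then show "xrep c X x = a" using X cvec_tvec[OF c] by (simp add: xrep_def)
  qed
  then show "dd w (xrep c X) (cmap c p) = 0" by (simp add: dd_def)
qed

lemma christoffel_eq:
  assumes c: "c \<in> M" and p: "p \<in> cdom c" and v: "(p, v) \<in> A"
  shows "christoffel M A L c i j k (p, v) = Gc c (cmap c p, cvec c v) (axis j 1) (axis k 1) $ i"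
proof -
  let ?P = "\<lambda>W V. open W \<and> p \<in> W \<and> W \<subseteq> cdom c \<and> admissible M A W V \<and> V p = v"
  let ?r = "Gc c (cmap c p, cvec c v) (axis j 1) (axis k 1) $ i"
  have val: "comp c (chern M L W V (coord_field M c j) (coord_field M c k) p) i = ?r" if WV: "?P W V" for W V
  proof -
    have W: "open W" "p \<in> W" "W \<subseteq> cdom c" and V: "admissible M A W V" "V p = v" using WV by auto
    have cf: "coord_field M c j q = tvec M c q (axis j 1)" if "q \<in> W" for j q
      using coord_field_eq[OF c] that W(3) by auto
    have vf: "coord_field M c j \<in> vector_fields M W" for j
      by (rule constant_field(1)[OF c W(1,3) cf])
    have dd_cf: "dd w (xrep c (coord_field M c j)) (cmap c p) = 0" for w j
      by (rule constant_field(2)[OF c W(1,3) cf W(2)])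
    have "cvec c (chern M L W V (coord_field M c j) (coord_field M c k) p) =
        Gc c (cmap c p, cvec c v) (axis j 1) (axis k 1)"
      unfolding chern_eq_conn[OF c W(1) V(1) W(2) p vf vf] cvec_conn[OF c W(1) V(1) W(2) p]
        dd_cf cf[OF W(2)] cvec_tvec[OF c p] V(2) by simp
    then show ?thesis by (simp add: cvec_nth[symmetric])
  qed
  have vt: "v \<in> tangent_space M p" by (rule A_tangent[OF v])
  \<comment> \<open>Without an admissible pair every number would satisfy the implication under
    \<open>THE\<close>. Keeping the components of \<open>v\<close> constant gives one, since
    \<open>tdom M c A\<close> is open.\<close>
  let ?y = "cvec c v"
  let ?W = "{q \<in> cdom c. cmap c q \<in> (\<lambda>x. (x, ?y)) -` tdom M c A}"
  have W: "open ?W"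
    by (intro open_chart_preimage[OF c] open_vimage[OF open_tdom[OF c]] continuous_intros)
  have "admissible M A ?W (\<lambda>q. tvec M c q ?y)"
    unfolding admissible_def
    using constant_field(1)[OF c W] tdom_cmap[OF c _ tvec_tangent[OF c]] cvec_tvec[OF c] by auto
  then have ex: "?P ?W (\<lambda>q. tvec M c q ?y)"
    using W p v tdom_cmap[OF c p vt] tvec_cvec[OF c p vt] by auto
  show ?thesis
    unfolding christoffel_def prod.case
  proof (rule the_equality)
    show "\<forall>W V. ?P W V \<longrightarrow> comp c (chern M L W V (coord_field M c j) (coord_field M c k) p) i = ?r"
      using val by blast
    show "r = ?r" if "\<forall>W V. ?P W V \<longrightarrow> comp c (chern M L W V (coord_field M c j) (coord_field M c k) p) i = r" for r
      using that ex val[OF ex] by blast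
  qed
qed

context
  fixes c p v assumes c: "c \<in> M" and p: "p \<in> cdom c" and v: "(p, v) \<in> A"
begin

interpretation loc: local_finsler "tdom M c A" "Lc c"
  by (rule local_finsler[OF c])

abbreviation (input) z where "z \<equiv> (cmap c p, cvec c v)"

lemma z_tdom: "z \<in> tdom M c A"
  using tdom_cmap[OF c p A_tangent[OF v]] v by simp

lemma christoffel_tparam:
  assumes "z' \<in> tdom M c A"
  shows "christoffel M A L c i j k (tparam M c z') = loc.G z' (axis j 1) (axis k 1) $ i"
proof -
  obtain x y where z': "z' = (x, y)" by (cases z')
  then have x: "x \<in> cimg c" "(cinv c x, tvec M c (cinv c x) y) \<in> A"
    using assms mem_tdom[OF c] by auto
  then show ?thesis
    using christoffel_eq[OF c cinv_in[OF c x(1)] x(2)] cvec_tvec[OF c cinv_in[OF c x(1)]] c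
    by (simp add: z' tparam_eq[OF c])
qed

lemma pd_christoffel:
  "pd_x M c m (christoffel M A L c i j k) (p, v) = dd (axis m 1, 0) (\<lambda>z. loc.G z (axis j 1) (axis k 1) $ i) z"
  "pd_y M c m (christoffel M A L c i j k) (p, v) = dd (0, axis m 1) (\<lambda>z. loc.G z (axis j 1) (axis k 1) $ i) z"
proof -
  have "tcoord c (p, v) = z" by (simp add: tcoord_def cvec_def)
  moreover have s: "smooth_on (tdom M c A) (\<lambda>z. loc.G z (axis j 1) (axis k 1) $ i)"
    by (rule smooth_on_vec_nth[OF open_tdom[OF c] loc.smooth_G])
  ultimately show
    "pd_x M c m (christoffel M A L c i j k) (p, v) = dd (axis m 1, 0) (\<lambda>z. loc.G z (axis j 1) (axis k 1) $ i) z"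
    "pd_y M c m (christoffel M A L c i j k) (p, v) = dd (0, axis m 1) (\<lambda>z. loc.G z (axis j 1) (axis k 1) $ i) z"
    unfolding pd_x_def pd_y_def
    using deriv_line[OF open_tdom[OF c] z_tdom s, of "\<lambda>z. christoffel M A L c i j k (tparam M c z)", OF christoffel_tparam]
    by (simp_all only:)
qed

lemma nonlin_conn_eq: "nonlin_conn M A L c m k (p, v) = loc.G z (cvec c v) (axis k 1) $ m"
  using linear_axis_expansion[OF loc.linear_G(1)[OF z_tdom], of "cvec c v" "axis k 1"]
  by (simp add: nonlin_conn_def christoffel_eq[OF c p v] cvec_nth)

lemma delta_christoffel:
  "delta M A L c k (christoffel M A L c i j l) (p, v) =
    dd (axis k 1, - loc.G z (cvec c v) (axis k 1)) (\<lambda>z. loc.G z (axis j 1) (axis l 1)) z $ i"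
proof -
  have "dd w (\<lambda>z. loc.G z (axis j 1) (axis l 1) $ i) z = dd w (\<lambda>z. loc.G z (axis j 1) (axis l 1)) z $ i" for w
    by (rule dd_nth[OF smooth_on_differentiable[OF loc.smooth_G z_tdom]])
  then show ?thesis
    using loc.dd_G_horizontal[OF z_tdom, of "axis k 1" "loc.G z (cvec c v) (axis k 1)" "axis j 1" "axis l 1" i]
    by (simp add: delta_def pd_christoffel nonlin_conn_eq)
qed

lemma chern_curv_coeff_eq:
  "chern_curv_coeff M A L c i j k l (p, v) = loc.Q z (axis k 1) (axis l 1) (axis j 1) $ i"
proof -
  have "(\<Sum>h\<in>UNIV. loc.G z (axis h 1) a $ i * u $ h) = loc.G z u a $ i" for a u
    using linear_axis_expansion[OF loc.linear_G(1)[OF z_tdom], of u a] by (simp add: mult.commute)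
  then show ?thesis
    by (simp add: chern_curv_coeff_def Let_def delta_christoffel christoffel_eq[OF c p v] loc.Q_def sum_subtractf)
qed

lemma chern_curvature_eq:
  "chern_curvature M A L c (p, v) X Y Z = tvec M c p (loc.Q z (cvec c X) (cvec c Y) (cvec c Z))"
proof -
  note lQ = loc.linear_Q[OF z_tdom]
  let ?a = "cvec c X" and ?b = "cvec c Y" and ?d = "cvec c Z" and ?e = "\<lambda>i. axis i 1 :: real ^ 'n"
  have 1: "loc.Q z ?a ?b d = (\<Sum>k\<in>UNIV. ?a $ k *\<^sub>R loc.Q z (?e k) ?b d)" for d
    by (rule linear_axis_expansion[OF lQ(1)])
  have 2: "loc.Q z a ?b d = (\<Sum>l\<in>UNIV. ?b $ l *\<^sub>R loc.Q z a (?e l) d)" for a d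
    by (rule linear_axis_expansion[OF lQ(2)])
  have "loc.Q z ?a ?b ?d = (\<Sum>j\<in>UNIV. ?d $ j *\<^sub>R loc.Q z ?a ?b (?e j))"
    by (rule linear_axis_expansion[OF lQ(3)])
  also have "\<dots> = (\<Sum>j\<in>UNIV. ?d $ j *\<^sub>R (\<Sum>k\<in>UNIV. ?a $ k *\<^sub>R loc.Q z (?e k) ?b (?e j)))"
    by (simp only: 1)
  also have "\<dots> = (\<Sum>j\<in>UNIV. ?d $ j *\<^sub>R (\<Sum>k\<in>UNIV. ?a $ k *\<^sub>R (\<Sum>l\<in>UNIV. ?b $ l *\<^sub>R loc.Q z (?e k) (?e l) (?e j))))"
    by (simp only: 2)
  finally have *: "(\<Sum>j\<in>UNIV. \<Sum>k\<in>UNIV. \<Sum>l\<in>UNIV. comp c X k * comp c Y l * comp c Z j *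
      chern_curv_coeff M A L c i j k l (p, v)) = loc.Q z ?a ?b ?d $ i" for i
    by (simp add: chern_curv_coeff_eq cvec_nth sum_distrib_left mult_ac)
  show ?thesis
    unfolding chern_curvature_def * fst_conv by (rule sum_coord_field[OF c p])
qed

lemma chern_tensor_eq:
  "chern_tensor M A L c (p, v) X Y Z = tvec M c p (dd (0, cvec c Z) (\<lambda>z. loc.G z (cvec c X) (cvec c Y)) z)"
proof -
  let ?a = "cvec c X" and ?b = "cvec c Y" and ?d = "cvec c Z" and ?e = "\<lambda>i. axis i 1 :: real ^ 'n"
  have n: "dd w (\<lambda>z. loc.G z (axis j 1) (axis l 1) $ i) z = dd w (\<lambda>z. loc.G z (axis j 1) (axis l 1)) z $ i" for w i j l
    by (rule dd_nth[OF smooth_on_differentiable[OF loc.smooth_G z_tdom]])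
  have 1: "dd (0, ?d) (\<lambda>z. loc.G z a b) z = (\<Sum>l\<in>UNIV. ?d $ l *\<^sub>R dd (0, ?e l) (\<lambda>z. loc.G z a b) z)" for a b
    by (rule linear_axis_expansion[OF loc.linear_vertical(1)[OF loc.smooth_G z_tdom]])
  have "dd (0, ?d) (\<lambda>z. loc.G z ?a ?b) z =
      (\<Sum>j\<in>UNIV. \<Sum>k\<in>UNIV. (?a $ j * ?b $ k) *\<^sub>R dd (0, ?d) (\<lambda>z. loc.G z (?e j) (?e k)) z)"
    by (rule loc.G.dd_expansion[OF z_tdom])
  also have "\<dots> = (\<Sum>j\<in>UNIV. \<Sum>k\<in>UNIV. (?a $ j * ?b $ k) *\<^sub>R
      (\<Sum>l\<in>UNIV. ?d $ l *\<^sub>R dd (0, ?e l) (\<lambda>z. loc.G z (?e j) (?e k)) z))"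
    by (simp only: 1)
  finally have *: "(\<Sum>j\<in>UNIV. \<Sum>k\<in>UNIV. \<Sum>l\<in>UNIV. comp c X j * comp c Y k * comp c Z l *
      pd_y M c l (christoffel M A L c i j k) (p, v)) = dd (0, ?d) (\<lambda>z. loc.G z ?a ?b) z $ i" for i
    by (simp add: pd_christoffel n cvec_nth sum_distrib_left mult_ac)
  show ?thesis
    unfolding chern_tensor_def * fst_conv by (rule sum_coord_field[OF c p])
qed

end

lemma curvature_chern:
  assumes c: "c \<in> M" and \<Omega>: "open \<Omega>" and V: "admissible M A \<Omega> V" and p: "p \<in> \<Omega>" "p \<in> cdom c"
    and X: "X \<in> vector_fields M \<Omega>" and Y: "Y \<in> vector_fields M \<Omega>" and Z: "Z \<in> vector_fields M \<Omega>"
  shows "curvature M (chern M L \<Omega> V) X Y Z p =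
      chern_curvature M A L c (p, V p) (X p) (Y p) (Z p)
    + chern_tensor M A L c (p, V p) (Y p) (Z p) (chern M L \<Omega> V X V p)
    - chern_tensor M A L c (p, V p) (X p) (Z p) (chern M L \<Omega> V Y V p)"
proof -
  interpret loc: local_finsler "tdom M c A" "Lc c"
    by (rule local_finsler[OF c])
  let ?D = "chern M L \<Omega> V" and ?x = "cmap c p" and ?U = "cmap c ` (cdom c \<inter> \<Omega>)"
  let ?z = "(?x, cvec c (V p))"
  note z = V_tdom'[OF c \<Omega> V p] and Vvf = V_vf[OF c \<Omega> V] and VA = V_A[OF c \<Omega> V p(1)] and U = open_chart_image[OF c \<Omega>]
    and x = cmap_image[OF c \<Omega> V p]
  have D_vf: "?D X Y \<in> vector_fields M \<Omega>" if "X \<in> vector_fields M \<Omega>" "Y \<in> vector_fields M \<Omega>" for X Y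
    using is_chern_chern[OF \<Omega> V] that by (auto simp: is_chern_def affine_connection_def)
  have cvec_D: "cvec c (?D X Y p) = dd (cvec c (X p)) (xrep c Y) ?x + loc.G ?z (cvec c (X p)) (cvec c (Y p))"
    if "X \<in> vector_fields M \<Omega>" "Y \<in> vector_fields M \<Omega>" for X Y
    unfolding chern_eq_conn[OF c \<Omega> V p that] by (rule cvec_conn[OF c \<Omega> V p])
  \<comment> \<open>The outer connection differentiates the inner one, so the chart formula for
    \<open>?D Y Z\<close> is needed on a whole neighbourhood of \<open>p\<close>.\<close>
  have dd_D: "dd w (xrep c (?D Y Z)) ?x =
      dd (cvec c (Y p)) (dd w (xrep c Z)) ?x + dd (dd w (xrep c Y) ?x) (xrep c Z) ?x +
      (dd (w, dd w (xrep c V) ?x) (\<lambda>z. loc.G z (cvec c (Y p)) (cvec c (Z p))) ?z +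
       loc.G ?z (dd w (xrep c Y) ?x) (cvec c (Z p)) + loc.G ?z (cvec c (Y p)) (dd w (xrep c Z) ?x))"
    if Y: "Y \<in> vector_fields M \<Omega>" and Z: "Z \<in> vector_fields M \<Omega>" for w Y Z
  proof -
    have "dd w (xrep c (?D Y Z)) ?x = dd w (conn_rep c V Y Z) ?x"
    proof (rule dd_cong[OF U x])
      fix y assume y: "y \<in> ?U"
      then have "cinv c y \<in> \<Omega>" "cinv c y \<in> cdom c" using c by (auto simp: mem_chart_image)
      then show "xrep c (?D Y Z) y = conn_rep c V Y Z y"
        using xrep_conn[OF c \<Omega> V y, of Y Z] chern_eq_conn[OF c \<Omega> V _ _ Y Z] by (simp add: xrep_def)
    qed
    also have "conn_rep c V Y Z = (\<lambda>x. dd (xrep c Y x) (xrep c Z) x + loc.G (x, xrep c V x) (xrep c Y x) (xrep c Z x))"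
      by (simp add: conn_rep_def[OF c \<Omega> V] fun_eq_iff)
    also have "dd w \<dots> ?x =
      dd (xrep c Y ?x) (dd w (xrep c Z)) ?x + dd (dd w (xrep c Y) ?x) (xrep c Z) ?x +
      (dd (w, dd w (xrep c V) ?x) (\<lambda>z. loc.G z (xrep c Y ?x) (xrep c Z ?x)) (?x, xrep c V ?x) +
       loc.G (?x, xrep c V ?x) (dd w (xrep c Y) ?x) (xrep c Z ?x) + loc.G (?x, xrep c V ?x) (xrep c Y ?x) (dd w (xrep c Z) ?x))"
      by (rule dd_eqI[OF has_derivative_add[OF has_derivative_dd_along[OF U x xrep_smooth[OF Y c \<Omega>] xrep_smooth[OF Z c \<Omega>]]
        loc.G.has_derivative_along[OF V_tdom[OF c \<Omega> V x] V_curve_derivative[OF c \<Omega> V p]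
          xrep_derivative[OF c \<Omega> V p Y] xrep_derivative[OF c \<Omega> V p Z]]]])
    finally show ?thesis using c p by simp
  qed
  let ?a = "cvec c (X p)" and ?b = "cvec c (Y p)" and ?d = "cvec c (Z p)"
  note br = lie_bracket_vf[OF X Y \<Omega>]
  \<comment> \<open>The direction (w, dV(w)) of the curve is the horizontal lift (w, -\<Gamma>(y,
    w)) plus the vertical vector formed from the coordinates of \<nabla>V in direction
    \<open>w\<close>. The arguments of \<open>G\<close> are swapped in the horizontal part to match
    \<open>Q\<close>.\<close>
  have split: "dd (w, dd w (xrep c V) ?x) (\<lambda>z. loc.G z u ?d) ?z =
      dd (w, - loc.G ?z (snd ?z) w) (\<lambda>z. loc.G z ?d u) ?z +
      dd (0, dd w (xrep c V) ?x + loc.G ?z w (cvec c (V p))) (\<lambda>z. loc.G z u ?d) ?z" for w u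
  proof -
    have "dd (w, - loc.G ?z (snd ?z) w) (\<lambda>z. loc.G z ?d u) ?z = dd (w, - loc.G ?z w (cvec c (V p))) (\<lambda>z. loc.G z u ?d) ?z"
      using loc.G_commute[OF z, of w] loc.G_commute dd_cong[OF open_tdom[OF c] z, of "\<lambda>z. loc.G z ?d u" "\<lambda>z. loc.G z u ?d"]
      by simp
    then show ?thesis
      using linear_add[OF smooth_on_linear_dd[OF loc.smooth_G z], of "(w, - loc.G ?z w (cvec c (V p)))"
          "(0, dd w (xrep c V) ?x + loc.G ?z w (cvec c (V p)))" u ?d] by simp
  qed
  have "cvec c (curvature M ?D X Y Z p) = cvec c (?D X (?D Y Z) p) - cvec c (?D Y (?D X Z) p) - cvec c (?D (lie_bracket M X Y) Z p)"
    by (simp add: curvature_def)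
  \<comment> \<open>Second derivatives of \<open>Z\<close> cancel by symmetry, the derivatives of
    \<open>X\<close> and \<open>Y\<close> are absorbed by the Lie bracket, and the terms with
    \<open>G\<close> on one field and a derivative of \<open>Z\<close> occur symmetrically in both
    orders.\<close>
  also have "\<dots> = loc.Q ?z ?a ?b ?d + dd (0, cvec c (?D X V p)) (\<lambda>z. loc.G z ?b ?d) ?z
      - dd (0, cvec c (?D Y V p)) (\<lambda>z. loc.G z ?a ?d) ?z"
    unfolding cvec_D[OF X D_vf[OF Y Z]] cvec_D[OF Y D_vf[OF X Z]] cvec_D[OF br Z] dd_D[OF Y Z] dd_D[OF X Z]
      cvec_D[OF Y Z] cvec_D[OF X Z] cvec_D[OF X Vvf] cvec_D[OF Y Vvf] split
      cvec_lie_bracket[OF c p(2) X Y p(1) \<Omega>] loc.Q_def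
    using dd_commute_vec[OF U xrep_smooth[OF Z c \<Omega>] x, of ?a ?b]
      linear_diff[OF smooth_on_linear_dd[OF xrep_smooth[OF Z c \<Omega>] x]]
      linear_diff[OF loc.linear_G(1)[OF z]] linear_add[OF loc.linear_G(2)[OF z]]
      loc.G_commute[OF z, of ?d] loc.G_commute[OF z, of _ ?a] loc.G_commute[OF z, of _ ?b]
    by simp
  finally have "curvature M ?D X Y Z p = tvec M c p (loc.Q ?z ?a ?b ?d + dd (0, cvec c (?D X V p)) (\<lambda>z. loc.G z ?b ?d) ?z
      - dd (0, cvec c (?D Y V p)) (\<lambda>z. loc.G z ?a ?d) ?z)"
    using tvec_cvec[OF c p(2), of "curvature M ?D X Y Z p"]
      vf_tangent[OF D_vf[OF X D_vf[OF Y Z]] p(1)] vf_tangent[OF D_vf[OF Y D_vf[OF X Z]] p(1)] vf_tangent[OF D_vf[OF br Z] p(1)]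
    by (simp add: curvature_def tangent_space_diff)
  then show ?thesis
    by (simp only: chern_curvature_eq[OF c p(2) VA] chern_tensor_eq[OF c p(2) VA] tvec_linear[OF c p(2)] tvec_diff[OF c p(2)])
qed

end

theorem theorem2p1:
  fixes M :: "('m::{t2_space,second_countable_topology}, 'n::finite) chart set"
    and A :: "('m \<times> 'm tvec) set" and L :: "'m \<times> 'm tvec \<Rightarrow> real"
    and \<Omega> :: "'m set" and V X Y Z :: "'m vfield"
    and c :: "('m, 'n) chart" and p :: 'm
  assumes "pseudo_finsler M A L"
    and "open \<Omega>"
    and "admissible M A \<Omega> V"
    and "X \<in> vector_fields M \<Omega>" and "Y \<in> vector_fields M \<Omega>" and "Z \<in> vector_fields M \<Omega>"
    and "c \<in> M" and "p \<in> cdom c" and "p \<in> \<Omega>"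
  shows "curvature M (chern M L \<Omega> V) X Y Z p =
      chern_curvature M A L c (p, V p) (X p) (Y p) (Z p)
    + chern_tensor M A L c (p, V p) (Y p) (Z p) (chern M L \<Omega> V X V p)
    - chern_tensor M A L c (p, V p) (X p) (Z p) (chern M L \<Omega> V Y V p)"
proof -
  interpret finsler_manifold M A L by unfold_locales fact
  show ?thesis by (rule curvature_chern) fact+
qed

end
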